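(* If $\beta=(\beta_1,\beta_2,\ldots,\beta_d)\vdash n$ where $\beta_i\geq 3$ for all $i$, or $\beta=[1,n-1]$, then every zero of the polynomial $P_{[2,n-2],\beta}(x)$ has real part zero.
   Context: $\mathfrak{S}_n$ is the group of permutations of $[n]$; $\kappa(\pi)$ is the number of disjoint cycles of $\pi$ (fixed points counted). $[p,n-p]$ denotes the partition of $n$ with parts $p$ and $n-p$ (here $n\ge 3$, so that $[2,n-2]$ is a partition with two parts). $\mathcal{C}_\beta$ is the set of permutations in $\mathfrak{S}_n$ of cycle-type $\beta$. Define $$P_{[2,n-2],\beta}(x)=\frac{n(n-1)}{|\mathcal{C}_\beta|}\sum_{\omega\in\mathcal{C}_\beta}x^{\kappa(\alpha\omega)},$$ where $\alpha\in\mathfrak{S}_n$ is a fixed permutation of cycle-type $[2,n-2]$. Zeros are complex zeros. *)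

theory Defs
  imports
    "HOL-Combinatorics.Permutations"
    "HOL-Combinatorics.Orbits"
    "HOL-Computational_Algebra.Polynomial"
    "HOL-Library.Multiset"
    Complex_Main
begin

text \<open>
  The symmetric group on \<open>{1..n}\<close> consists of the functions \<open>p\<close> with \<open>p permutes {1..n}\<close>.
  For such \<open>p\<close>, \<^term>\<open>orbit p x\<close> is the cycle of \<open>p\<close> through \<open>x\<close>; the image of \<open>{1..n}\<close> is used
  because \<open>p\<close> also fixes every number outside \<open>{1..n}\<close>.
\<close>

definition perm_cycles :: "nat \<Rightarrow> (nat \<Rightarrow> nat) \<Rightarrow> nat set set" where
  "perm_cycles n p = orbit p ` {1..n}"

definition num_cycles :: "nat \<Rightarrow> (nat \<Rightarrow> nat) \<Rightarrow> nat" where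
  "num_cycles n p = card (perm_cycles n p)"

text \<open>Integer partitions, and hence cycle types, are multisets of positive parts.\<close>

definition is_partition_of :: "nat multiset \<Rightarrow> nat \<Rightarrow> bool" (infix \<open>\<turnstile>\<^sub>p\<close> 50) where
  "\<beta> \<turnstile>\<^sub>p n \<longleftrightarrow> (\<forall>b\<in>#\<beta>. b > 0) \<and> sum_mset \<beta> = n"

definition perm_cycle_type :: "nat \<Rightarrow> (nat \<Rightarrow> nat) \<Rightarrow> nat multiset" where
  "perm_cycle_type n p = image_mset card (mset_set (perm_cycles n p))"

definition cycle_class :: "nat \<Rightarrow> nat multiset \<Rightarrow> (nat \<Rightarrow> nat) set" where
  "cycle_class n \<beta> = {p. p permutes {1..n} \<and> perm_cycle_type n p = \<beta>}"

text \<open>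
  For \<open>\<alpha>\<close> of cycle type \<open>[2, n - 2]\<close> this is the polynomial \<open>P\<^bsub>[2,n-2],\<beta>\<^esub>\<close>. It depends on \<open>\<alpha>\<close>
  only through its cycle type, since \<^term>\<open>cycle_class n \<beta>\<close> is closed under conjugation.
\<close>

definition P_poly :: "nat \<Rightarrow> (nat \<Rightarrow> nat) \<Rightarrow> nat multiset \<Rightarrow> complex poly" where
  "P_poly n \<alpha> \<beta> =
     smult (of_nat (n * (n - 1)) / of_nat (card (cycle_class n \<beta>)))
       (\<Sum>\<omega>\<in>cycle_class n \<beta>. monom 1 (num_cycles n (\<alpha> \<circ> \<omega>)))"

end

(*
  A generating function sum_N (sum_w N^k(w)) z^N turns the sums of x^k(w) into rational functions:
  x becomes z d/dz and the shift x -> x - 1 becomes multiplication by z.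

  Averaging over conjugates, alpha may be replaced by all products of a transposition (a b) with
  an (n-2)-cycle on the remaining points.  Removing a and b from the cycles of omega (a b), which
  arise from the cycles of omega by one merge or one split, reduces the sum to Stanley's formula
  for products with long cycles; that formula follows in the same way by removing one point.
  Logarithmic differentiation of the product over the cycles then collapses the sum to
    z (1 + z) (d/dz)^2 [ prod_i (1 - z^beta_i) / (1 - z)^(n-1) ],
  that is, P is a multiple of x ((x + 1) Q(x + 1) + (x - 1) Q(x)), where Q arises from
  (x + 1) ... (x + n - 2) by n operations A(x) -> A(x - 1) - rho A(x) with |rho| = 1.
  Each operation moves the vertical line of zeros by 1/2, so that the zeros of Q lie on Re = 1/2,
  and comparing absolute values on both sides of the imaginary axis finishes the proof.

  For beta = [1,n-1] the roles are exchanged: removing the fixed point of omega from alpha leaves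
  Stanley's formula for two cycle types, and the result is a combination of the products
  x (x + 1) ... (x + n - 3) and x (x - 1) ... (x - n + 3).
*)

theory Submission
  imports
    Defs
    "HOL-Combinatorics.Cycles"
    "HOL-Combinatorics.Multiset_Permutations"
    "HOL-Computational_Algebra.Formal_Laurent_Series"
    "HOL-Computational_Algebra.Polynomial_FPS"
    "HOL-Computational_Algebra.Fundamental_Theorem_Algebra"
begin

section \<open>Cycles of a permutation times a transposition\<close>

text \<open>Deleting a point from a cycle of length at least 2 keeps the number of cycles. Deleting
  a fixed point loses a factor x, and on series x acts as the operator \<open>theta\<close>, not as
  a factor. This exceptional case shapes the computation. For parts of size at least 3, a split by
  (a b) isolates at most one of a and b, so \<open>theta\<close> never occurs twice in a row. Every
  term is written as the full product over the cycles times a ratio. Applied to this product,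
  \<open>theta\<close> brings in the logarithmic derivatives of all the other cycles, and these
  cross terms are just what the merges lack. So each summation reduces to one identity for a single
  cycle and one for a pair of cycles, both rational in z, z^k and z^l. Because points are deleted,
  the ground set is an arbitrary finite set A. Long cycles are summed as orderings of their points,
  so a cycle of m points counts m times; this is the origin of the factorials.\<close>

definition cyc :: "'a set \<Rightarrow> ('a \<Rightarrow> 'a) \<Rightarrow> 'a set set" where
  "cyc A p = orbit p ` A"

lemma permutes_permutation: "finite A \<Longrightarrow> p permutes A \<Longrightarrow> permutation p"
  by (auto simp: permutation_permutes)

text \<open>The orbit of x starts at \<open>p x\<close>, so x lies on it only because p returns to
  x. The hypothesis \<open>permutation p\<close> guarantees this here and in the following
  lemmas.\<close>

lemma orbit_eq_of_mem:
  assumes "permutation p" "y \<in> orbit p x"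
  shows "orbit p y = orbit p x"
  by (rule orbit_cyclic_eq3[OF cyclic_on_orbit'[OF assms(1)] assms(2)])

lemma orbit_disjoint:
  assumes "permutation p" "orbit p x \<noteq> orbit p y"
  shows "orbit p x \<inter> orbit p y = {}"
proof (rule ccontr)
  assume "\<not> ?thesis"
  then obtain z where "z \<in> orbit p x" "z \<in> orbit p y" by blast
  hence "orbit p z = orbit p x" "orbit p z = orbit p y" using orbit_eq_of_mem[OF assms(1)] by blast+
  thus False using assms(2) by simp
qed

lemma cyc_eq_orbit:
  assumes "permutation p" "C \<in> cyc A p" "x \<in> C"
  shows "C = orbit p x"
proof -
  obtain y where "C = orbit p y" using assms(2) by (auto simp: cyc_def)
  thus ?thesis using orbit_eq_of_mem[OF assms(1), of x y] assms(3) by simp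
qed

lemma finite_cyc [simp]: "finite A \<Longrightarrow> finite (cyc A p)"
  by (simp add: cyc_def)

lemma cyc_subset:
  assumes "p permutes A" "C \<in> cyc A p"
  shows "C \<subseteq> A"
  using assms(2) permutes_orbit_subset[OF assms(1)] by (auto simp: cyc_def)

lemma Union_cyc:
  assumes "finite A" "p permutes A"
  shows "\<Union>(cyc A p) = A"
proof
  show "\<Union>(cyc A p) \<subseteq> A" using cyc_subset[OF assms(2)] by blast
  show "A \<subseteq> \<Union>(cyc A p)"
    using permutation_self_in_orbit[OF permutes_permutation[OF assms]] by (auto simp: cyc_def)
qed

lemma card_cyc_pos:
  assumes "finite A" "p permutes A" "C \<in> cyc A p"
  shows "finite C" "card C > 0"
proof -
  show "finite C"
    using cyc_subset[OF assms(2,3)] assms(1) finite_subset by blast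
  thus "card C > 0"
    using assms(3) orbit_nonempty[of p] by (auto simp: cyc_def card_gt_0_iff)
qed

lemma sum_over_cyc:
  assumes "finite A" "p permutes A"
  shows "(\<Sum>a\<in>A. f a) = (\<Sum>C\<in>cyc A p. \<Sum>a\<in>C. f a)"
proof -
  have perm: "permutation p" using assms by (rule permutes_permutation)
  have disj: "\<forall>C\<in>cyc A p. \<forall>C'\<in>cyc A p. C \<noteq> C' \<longrightarrow> C \<inter> C' = {}"
    using orbit_disjoint[OF perm] by (auto simp: cyc_def)
  have "sum f (\<Union>(cyc A p)) = (sum \<circ> sum) f (cyc A p)"
    using card_cyc_pos(1)[OF assms] disj by (intro sum.Union_disjoint) blast+
  thus ?thesis using Union_cyc[OF assms] by simp
qed

lemma sum_card_cyc:
  assumes "finite A" "p permutes A"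
  shows "(\<Sum>C\<in>cyc A p. card C) = card A"
  using sum_over_cyc[OF assms, of "\<lambda>_. 1::nat"] by simp

text \<open>Numbers the points of a cycle by exponents below its length. A point on the cycle of a
  is thereby given by its distance from a, the parameter i of a split.\<close>

lemma funpow_orbit:
  fixes a :: 'a
  assumes "permutation p"
  defines "k \<equiv> card (orbit p a)"
  shows "(p ^^ k) a = a" "orbit p a = (\<lambda>j. (p ^^ j) a) ` {..<k}"
    "inj_on (\<lambda>j. (p ^^ j) a) {..<k}" "k > 0"
proof -
  have self: "a \<in> orbit p a" using assms(1) by (rule permutation_self_in_orbit)
  define l where "l = funpow_dist1 p a a"
  have 1: "(p ^^ l) a = a" unfolding l_def by (rule funpow_dist1_prop[OF self])
  have 2: "orbit p a = (\<lambda>j. (p ^^ j) a) ` {0..<l}" unfolding l_def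
    by (rule orbit_conv_funpow_dist1[OF self])
  have 3: "inj_on (\<lambda>j. (p ^^ j) a) {0..<l}" unfolding l_def
    by (rule inj_on_funpow_dist1[OF self])
  have "k = l" unfolding k_def 2 using 3 by (simp add: card_image)
  thus "(p ^^ k) a = a" "orbit p a = (\<lambda>j. (p ^^ j) a) ` {..<k}"
    "inj_on (\<lambda>j. (p ^^ j) a) {..<k}" using 1 2 3 by (simp_all add: atLeast0LessThan)
  show "k > 0" using \<open>k = l\<close> by (simp add: l_def)
qed

lemma orbit_transpose_other:
  assumes "permutation p" "x \<notin> orbit p a" "x \<notin> orbit p b"
  shows "orbit (p \<circ> transpose a b) x = orbit p x"
proof (rule orbit_cong)
  show "x \<in> orbit p x" using assms(1) by (rule permutation_self_in_orbit)
  fix s assume "s \<in> orbit p x"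
  hence "orbit p s = orbit p x" "s \<in> orbit p s" 
    using assms(1) orbit_eq_of_mem permutation_self_in_orbit by metis+
  hence "s \<noteq> a" "s \<noteq> b" 
    using assms(2,3) permutation_self_in_orbit[OF assms(1), of x] by auto
  thus "(p \<circ> transpose a b) s = p s" by simp
qed

text \<open>The common frame of merging and splitting: only the values at a and b change, so if the
  affected points form the same set before and after, all other cycles survive.\<close>

lemma cyc_transpose:
  assumes "finite A" "p permutes A" "a \<in> A" "b \<in> A"
    and "orbit (p \<circ> transpose a b) a \<union> orbit (p \<circ> transpose a b) b = orbit p a \<union> orbit p b"
  shows "cyc A (p \<circ> transpose a b) = {orbit (p \<circ> transpose a b) a, orbit (p \<circ> transpose a b) b}
            \<union> (cyc A p - {orbit p a, orbit p b})"
proof -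
  let ?q = "p \<circ> transpose a b"
  have perm: "permutation p" using assms by (intro permutes_permutation)
  have "?q permutes A" using assms by (simp add: permutes_compose permutes_swap_id)
  hence permq: "permutation ?q" using assms by (intro permutes_permutation)
  have in_ab: "orbit ?q x \<in> {orbit ?q a, orbit ?q b}" if "x \<in> orbit p a \<union> orbit p b" for x
    using that assms(5) orbit_eq_of_mem[OF permq] by blast
  have out: "orbit ?q x = orbit p x \<and> orbit p x \<noteq> orbit p a \<and> orbit p x \<noteq> orbit p b"
    if "x \<notin> orbit p a \<union> orbit p b" for x
    using that orbit_transpose_other[OF perm, of x a b] permutation_self_in_orbit[OF perm, of x] by auto
  show ?thesis
  proof (intro equalityI subsetI)
    fix C assume "C \<in> cyc A ?q"
    then obtain x where "x \<in> A" "C = orbit ?q x" by (auto simp: cyc_def)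
    thus "C \<in> {orbit ?q a, orbit ?q b} \<union> (cyc A p - {orbit p a, orbit p b})"
      using in_ab[of x] out[of x] by (auto simp: cyc_def)
  next
    fix C assume C: "C \<in> {orbit ?q a, orbit ?q b} \<union> (cyc A p - {orbit p a, orbit p b})"
    show "C \<in> cyc A ?q"
    proof (cases "C \<in> {orbit ?q a, orbit ?q b}")
      case True thus ?thesis using assms(3,4) by (auto simp: cyc_def)
    next
      case False
      with C obtain x where x: "x \<in> A" "C = orbit p x" "C \<noteq> orbit p a" "C \<noteq> orbit p b"
        by (auto simp: cyc_def)
      hence "x \<notin> orbit p a \<union> orbit p b" using orbit_eq_of_mem[OF perm] by blast
      thus ?thesis using out[of x] x by (auto simp: cyc_def)
    qed
  qed
qed

text \<open>The product sends a to \<open>p b\<close> and b to \<open>p a\<close>. Leaving a, it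
  runs around the whole cycle of b, arrives at b, and goes on along the cycle of a.\<close>

lemma cyc_merge:
  assumes "finite A" "p permutes A" "a \<in> A" "b \<in> A" "orbit p a \<noteq> orbit p b"
  shows "orbit (p \<circ> transpose a b) a = orbit p a \<union> orbit p b" (is "orbit ?q a = _")
    and "orbit (p \<circ> transpose a b) b = orbit p a \<union> orbit p b"
    and "cyc A (p \<circ> transpose a b) = insert (orbit p a \<union> orbit p b) (cyc A p - {orbit p a, orbit p b})"
    and "orbit p a \<union> orbit p b \<notin> cyc A p - {orbit p a, orbit p b}"
proof -
  have perm: "permutation p" using assms by (intro permutes_permutation)
  have "?q permutes A" using assms by (simp add: permutes_compose permutes_swap_id)
  hence permq: "permutation ?q" using assms by (intro permutes_permutation)
  have disj: "orbit p a \<inter> orbit p b = {}" using orbit_disjoint[OF perm assms(5)] .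
  have self: "x \<in> orbit p x" for x using permutation_self_in_orbit[OF perm] .
  have selfq: "x \<in> orbit ?q x" for x using permutation_self_in_orbit[OF permq] .
  have key: "orbit p d \<subseteq> orbit (p \<circ> transpose c d) c" 
    if cd: "orbit p c \<inter> orbit p d = {}" "permutation (p \<circ> transpose c d)" for c d
  proof -
    define q where "q = p \<circ> transpose c d"
    define k where "k = card (orbit p d)"
    note k = funpow_orbit[OF perm, of d, folded k_def]
    \<comment> \<open>\<open>q\<close> sends c to \<open>p d\<close> and then agrees with
      \<open>p\<close> until d is reached at step k: c is not on this cycle and d does not occur
      earlier.\<close>
    have step: "(q ^^ j) c = (p ^^ j) d" if "1 \<le> j" "j \<le> k" for j
      using that
    proof (induction j)
      case (Suc j)
      show ?case
      proof (cases "j = 0")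
        case False
        hence IH: "(q ^^ j) c = (p ^^ j) d" using Suc.IH Suc.prems by (simp del: o_apply)
        have "(p ^^ j) d \<noteq> (p ^^ 0) d" 
          using k(3) False Suc.prems by (auto dest!: inj_onD[of _ _ j 0])
        moreover have "(p ^^ j) d \<in> orbit p d" by (simp add: funpow_in_orbit self)
        hence "(p ^^ j) d \<noteq> c" using cd self[of c] by auto
        ultimately have "q ((p ^^ j) d) = p ((p ^^ j) d)" by (simp add: q_def)
        thus ?thesis unfolding funpow.simps o_apply IH by simp
      qed (simp add: q_def)
    qed simp
    have "(p ^^ j) d \<in> orbit q c" if "j < k" for j
    proof (cases "j = 0")
      case True
      have "(q ^^ k) c \<in> orbit q c" 
        using permutation_self_in_orbit[OF cd(2)] unfolding q_def[symmetric] by (intro funpow_in_orbit)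
      also have "(q ^^ k) c = d" using step[of k] k by simp
      finally show ?thesis using True by simp
    next
      case False
      have "(q ^^ j) c \<in> orbit q c" 
        using permutation_self_in_orbit[OF cd(2)] unfolding q_def[symmetric] by (intro funpow_in_orbit)
      thus ?thesis using step[of j] False that by simp
    qed
    thus ?thesis using k(2) unfolding q_def by auto
  qed
  have ka: "orbit p b \<subseteq> orbit ?q a" using key disj permq by blast
  have kb: "orbit p a \<subseteq> orbit ?q b" using key[of b a] disj permq by (simp add: transpose_commute Int_commute)
  have eq: "orbit ?q a = orbit ?q b" using orbit_eq_of_mem[OF permq] ka self by blast
  have "orbit ?q a \<subseteq> orbit p a \<union> orbit p b"
  proof
    fix y assume "y \<in> orbit ?q a"
    thus "y \<in> orbit p a \<union> orbit p b"
    proof induction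
      case base
      show ?case by (simp add: orbit.base)
    next
      case (step y)
      thus ?case using orbit.base[of p] orbit.step[of _ p] by (cases "y = a"; cases "y = b") auto
    qed
  qed
  thus 1: "orbit ?q a = orbit p a \<union> orbit p b" using ka kb eq by auto
  thus 2: "orbit ?q b = orbit p a \<union> orbit p b" using eq by simp
  show "cyc A ?q = insert (orbit p a \<union> orbit p b) (cyc A p - {orbit p a, orbit p b})"
    using cyc_transpose[OF assms(1-4)] 1 2 by simp
  show "orbit p a \<union> orbit p b \<notin> cyc A p - {orbit p a, orbit p b}"
  proof
    assume C: "orbit p a \<union> orbit p b \<in> cyc A p - {orbit p a, orbit p b}"
    hence "orbit p a \<union> orbit p b = orbit p a"
      using cyc_eq_orbit[OF perm, of _ A a] self[of a] by blast
    thus False using C by simp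
  qed
qed

text \<open>Number the cycle of a by exponents 0, ..., k - 1, with b at i. The product sends b to 1
  and a to i + 1 (mod k). So 1, ..., i close up to the cycle of b, and 0, i + 1, ..., k - 1 to the
  cycle of a: it is b whose cycle has length i.\<close>

lemma cyc_split:
  assumes "finite A" "p permutes A" "a \<in> A" "0 < i" "i < card (orbit p a)"
  defines "b \<equiv> (p ^^ i) a"
  defines "q \<equiv> p \<circ> transpose a b"
  shows "b \<noteq> a" "b \<in> A" "card (orbit q b) = i" "card (orbit q a) = card (orbit p a) - i"
    "orbit q a \<union> orbit q b = orbit p a" "orbit q a \<inter> orbit q b = {}"
    "cyc A q = {orbit q a, orbit q b} \<union> (cyc A p - {orbit p a})"
    "orbit q a \<notin> cyc A p - {orbit p a}" "orbit q b \<notin> cyc A p - {orbit p a}"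
proof -
  have perm: "permutation p" using assms by (intro permutes_permutation)
  have self: "x \<in> orbit p x" for x using permutation_self_in_orbit[OF perm] .
  define k where "k = card (orbit p a)"
  note k = funpow_orbit[OF perm, of a, folded k_def]
  have ik: "i < k" using assms by (simp add: k_def)
  have inj: "(p ^^ j) a = (p ^^ l) a \<longleftrightarrow> j = l" if "j < k" "l < k" for j l
    using k(3) that by (auto dest: inj_onD)
  show "b \<noteq> a" using inj[of i 0] ik k assms(4) by (simp add: b_def)
  have borb: "b \<in> orbit p a" unfolding b_def by (simp add: funpow_in_orbit self)
  thus bA: "b \<in> A" using permutes_orbit_subset assms(2,3) by fast
  have "q permutes A" unfolding q_def using assms bA by (simp add: permutes_compose permutes_swap_id)
  hence permq: "permutation q" using assms by (intro permutes_permutation)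
  have sb: "(q ^^ j) b = (p ^^ j) a" if "1 \<le> j" "j \<le> i" for j
    using that
  proof (induction j)
    case (Suc j)
    show ?case
    proof (cases "j = 0")
      case False
      hence IH: "(q ^^ j) b = (p ^^ j) a" using Suc by simp
      have "(p ^^ j) a \<noteq> a" using inj[of j 0] False Suc.prems ik by simp
      moreover have "(p ^^ j) a \<noteq> b" using inj[of j i] Suc.prems ik by (simp add: b_def)
      ultimately have "q ((p ^^ j) a) = p ((p ^^ j) a)" by (simp add: q_def)
      thus ?thesis unfolding funpow.simps o_apply IH by simp
    qed (simp add: q_def)
  qed simp
  have sa: "(q ^^ j) a = (p ^^ (i + j)) a" if "1 \<le> j" "j \<le> k - i" for j
    using that
  proof (induction j)
    case (Suc j)
    show ?case
    proof (cases "j = 0")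
      case False
      hence IH: "(q ^^ j) a = (p ^^ (i + j)) a" using Suc by simp
      have "(p ^^ (i + j)) a \<noteq> a" using inj[of "i + j" 0] False Suc.prems ik by simp
      moreover have "(p ^^ (i + j)) a \<noteq> b" using inj[of "i + j" i] False Suc.prems ik by (simp add: b_def)
      ultimately have "q ((p ^^ (i + j)) a) = p ((p ^^ (i + j)) a)" by (simp add: q_def)
      thus ?thesis unfolding funpow.simps o_apply IH by simp
    qed (simp add: q_def b_def)
  qed simp
  have "(q ^^ i) b = b" using sb[of i] assms(4) by (simp add: b_def)
  hence "orbit q b = {(q ^^ m) b |m. m < i}" using assms(4) by (intro orbit_altdef_bounded)
  also have "\<dots> = (\<lambda>j. (q ^^ j) b) ` {..<i}" by auto
  also have "{..<i} = insert 0 {1..<i}" using assms(4) by auto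
  also have "(\<lambda>j. (q ^^ j) b) ` (insert 0 {1..<i}) = insert b ((\<lambda>j. (p ^^ j) a) ` {1..<i})"
    using sb by (auto intro!: image_cong)
  also have "\<dots> = (\<lambda>j. (p ^^ j) a) ` {1..i}"
  proof -
    have "{1..i} = insert i {1..<i}" using assms(4) by auto
    thus ?thesis by (simp add: b_def)
  qed
  finally have ob: "orbit q b = (\<lambda>j. (p ^^ j) a) ` {1..i}" .
  have "(q ^^ (k - i)) a = a" using sa[of "k - i"] k(1) ik by simp
  hence "orbit q a = {(q ^^ m) a |m. m < k - i}" using ik by (intro orbit_altdef_bounded) simp_all
  also have "\<dots> = (\<lambda>j. (q ^^ j) a) ` {..<k - i}" by auto
  also have "{..<k - i} = insert 0 {1..<k - i}" using ik by auto
  also have "(\<lambda>j. (q ^^ j) a) ` (insert 0 {1..<k - i}) = insert a ((\<lambda>j. (p ^^ (i + j)) a) ` {1..<k - i})"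
    using sa by (auto intro!: image_cong simp del: funpow.simps)
  also have "(\<lambda>j. (p ^^ (i + j)) a) ` {1..<k - i} = (\<lambda>j. (p ^^ j) a) ` ((+) i ` {1..<k - i})"
    by (simp only: image_image)
  also have "(+) i ` {1..<k - i} = {i + 1..<k}" using ik by simp
  also have "insert a ((\<lambda>j. (p ^^ j) a) ` {i + 1..<k}) = (\<lambda>j. (p ^^ j) a) ` insert 0 {i + 1..<k}" by simp
  finally have oa: "orbit q a = (\<lambda>j. (p ^^ j) a) ` insert 0 {i + 1..<k}" .
  have "inj_on (\<lambda>j. (p ^^ j) a) {1..i}" "inj_on (\<lambda>j. (p ^^ j) a) (insert 0 {i + 1..<k})"
    using ik by (intro inj_on_subset[OF k(3)]; auto)+
  thus "card (orbit q b) = i" "card (orbit q a) = card (orbit p a) - i"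
    unfolding ob oa using ik by (simp_all add: card_image k_def[symmetric])
  have un: "{..<k} = insert 0 {i + 1..<k} \<union> {1..i}" using ik by auto
  show U: "orbit q a \<union> orbit q b = orbit p a" unfolding ob oa k(2) un by blast
  show D: "orbit q a \<inter> orbit q b = {}" unfolding ob oa
    using ik by (subst inj_on_image_Int[OF k(3), symmetric]) auto
  have obp: "orbit p b = orbit p a" using orbit_eq_of_mem[OF perm borb] .
  show "cyc A q = {orbit q a, orbit q b} \<union> (cyc A p - {orbit p a})"
    using cyc_transpose[OF assms(1-3) bA] U unfolding obp q_def by simp
  show "orbit q a \<notin> cyc A p - {orbit p a}" "orbit q b \<notin> cyc A p - {orbit p a}"
  proof -
    have "orbit q x \<notin> cyc A p - {orbit p a}" if "x \<in> orbit p a" for x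
    proof
      assume "orbit q x \<in> cyc A p - {orbit p a}"
      hence "orbit q x = orbit p x" "orbit q x \<noteq> orbit p a"
        using cyc_eq_orbit[OF perm, of _ A x] permutation_self_in_orbit[OF permq] by auto
      thus False using orbit_eq_of_mem[OF perm that] by simp
    qed
    thus "orbit q a \<notin> cyc A p - {orbit p a}" "orbit q b \<notin> cyc A p - {orbit p a}"
      using self[of a] borb by blast+
  qed
qed

section \<open>Deleting a point from a permutation\<close>

lemma permutes_remove_fixed:
  assumes "p permutes A" "p a = a"
  shows "p permutes (A - {a})"
  using assms unfolding permutes_def by auto

text \<open>Deletion is the split at the predecessor of a, which has exponent k - 1: a is left
  alone, and the other points of its cycle keep their cyclic order.\<close>

lemma orbit_remove:
  assumes "finite A" "p permutes A" "a \<in> A" "p a \<noteq> a"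
  defines "q \<equiv> p \<circ> transpose a (inv p a)"
  shows "q permutes (A - {a})" "q a = a" "cyc (A - {a}) q = insert (orbit p a - {a}) (cyc A p - {orbit p a})"
    "orbit p a - {a} \<notin> cyc A p - {orbit p a}" "card (orbit p a - {a}) = card (orbit p a) - 1"
    "card (orbit p a) \<ge> 2"
    "\<And>x. x \<in> orbit p a \<Longrightarrow> x \<noteq> a \<Longrightarrow> orbit q x = orbit p a - {a}"
proof -
  have perm: "permutation p" using assms by (intro permutes_permutation)
  define k where "k = card (orbit p a)"
  note k = funpow_orbit[OF perm, of a, folded k_def]
  have bij: "bij p" using assms(2) by (rule permutes_bij)
  have "k \<noteq> 1" using k(1) assms(4) by auto
  hence k2: "k \<ge> 2" using k(4) by simp
  thus "card (orbit p a) \<ge> 2" by (simp add: k_def)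
  have "p ((p ^^ (k - 1)) a) = a" using k(1,4) by (cases k) auto
  hence inv: "inv p a = (p ^^ (k - 1)) a" using bij by (metis bij_inv_eq_iff)
  have i: "0 < k - 1" "k - 1 < card (orbit p a)" using k2 by (auto simp: k_def)
  note sp = cyc_split[OF assms(1-3) i, folded inv, folded q_def]
  show qa: "q a = a" using bij by (simp add: q_def bij_is_surj surj_f_inv_f)
  have "q permutes A" unfolding q_def using assms sp(2) by (simp add: permutes_compose permutes_swap_id)
  thus qA: "q permutes (A - {a})" using qa by (rule permutes_remove_fixed)
  have permq: "permutation q" using qA assms(1) by (intro permutes_permutation[of "A - {a}"]) auto
  have oa: "orbit q a = {a}" using qa by (simp add: orbit_eq_singleton_iff)
  have ob: "orbit q (inv p a) = orbit p a - {a}" using sp(5,6) unfolding oa by auto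
  show "\<And>x. x \<in> orbit p a \<Longrightarrow> x \<noteq> a \<Longrightarrow> orbit q x = orbit p a - {a}"
    using orbit_eq_of_mem[OF permq] ob by blast
  have "cyc (A - {a}) q = cyc A q - {{a}}"
  proof -
    have "A = insert a (A - {a})" using assms(3) by auto
    hence "cyc A q = insert {a} (cyc (A - {a}) q)" using oa unfolding cyc_def by (metis image_insert)
    moreover have "{a} \<notin> cyc (A - {a}) q" using cyc_subset[OF qA] by blast
    ultimately show ?thesis by auto
  qed
  also have "\<dots> = insert (orbit p a - {a}) (cyc A p - {orbit p a})"
  proof -
    have "orbit p a - {a} \<noteq> {a}" by auto
    moreover have "{a} \<notin> cyc A p - {orbit p a}" using sp(8) oa by simp
    ultimately show ?thesis using sp(7) unfolding oa ob by auto
  qed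
  finally show "cyc (A - {a}) q = insert (orbit p a - {a}) (cyc A p - {orbit p a})" .
  show "orbit p a - {a} \<notin> cyc A p - {orbit p a}" using sp(9) ob by simp
  show "card (orbit p a - {a}) = card (orbit p a) - 1"
    using permutation_self_in_orbit[OF perm] by simp
qed

lemma cyc_fixed:
  assumes "finite A" "p permutes A" "a \<in> A" "p a = a"
  shows "p permutes (A - {a})" "cyc (A - {a}) p = cyc A p - {{a}}" "{a} \<in> cyc A p" "orbit p a = {a}"
proof -
  show P: "p permutes (A - {a})" using assms(2,4) by (rule permutes_remove_fixed)
  show oa: "orbit p a = {a}" using assms by (simp add: orbit_eq_singleton_iff)
  have "A = insert a (A - {a})" using assms(3) by auto
  hence 1: "cyc A p = insert {a} (cyc (A - {a}) p)" using oa unfolding cyc_def by (metis image_insert)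
  moreover have "{a} \<notin> cyc (A - {a}) p" using cyc_subset[OF P] by blast
  ultimately show "cyc (A - {a}) p = cyc A p - {{a}}" "{a} \<in> cyc A p" by auto
qed

lemma card_cyc_remove:
  assumes "finite A" "p permutes A" "a \<in> A" "p a \<noteq> a"
  shows "card (cyc (A - {a}) (p \<circ> transpose a (inv p a))) = card (cyc A p)"
proof -
  note r = orbit_remove[OF assms]
  have "orbit p a \<in> cyc A p" using assms(3) by (simp add: cyc_def)
  moreover have "finite (cyc A p)" using assms by simp
  ultimately show ?thesis unfolding r(3) using r(4)
    by (subst card_insert_disjoint) (simp_all add: card_Suc_Diff1 del: card_Diff_insert)
qed

lemma card_cyc_fixed:
  assumes "finite A" "p permutes A" "a \<in> A" "p a = a"
  shows "card (cyc A p) = Suc (card (cyc (A - {a}) p))"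
  unfolding cyc_fixed(2)[OF assms] using cyc_fixed(3)[OF assms] assms(1)
  by (simp add: card_Suc_Diff1 del: card_Diff_insert card_Diff_singleton)

section \<open>Sums over long cycles\<close>

text \<open>Conjugation by q turns \<open>p \<circ> q\<close> into \<open>q \<circ> p\<close>, hence
  carries cycles to cycles of the same length. This allows a transposition to be moved from the left
  end of a product to the right.\<close>

lemma orbit_image_comm:
  assumes "finite A" "p permutes A" "q permutes A"
  shows "q ` orbit (p \<circ> q) x = orbit (q \<circ> p) (q x)"
proof (rule orbit_inverse)
  have "(p \<circ> q) permutes A" using assms by (simp add: permutes_compose)
  thus "x \<in> orbit (p \<circ> q) x"
    by (intro permutation_self_in_orbit permutes_permutation[OF assms(1)])
qed simp

lemma cyc_comm:
  assumes "finite A" "p permutes A" "q permutes A"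
  shows "cyc A (q \<circ> p) = (`) q ` cyc A (p \<circ> q)"
proof -
  have "cyc A (q \<circ> p) = orbit (q \<circ> p) ` q ` A"
    unfolding cyc_def using permutes_image[OF assms(3)] by simp
  thus ?thesis unfolding cyc_def image_image orbit_image_comm[OF assms] .
qed

lemma cycle_type_comm:
  assumes "finite A" "p permutes A" "q permutes A"
  shows "image_mset card (mset_set (cyc A (q \<circ> p))) = image_mset card (mset_set (cyc A (p \<circ> q)))"
proof -
  have inj: "inj q" using assms(3) by (rule permutes_inj)
  have "image_mset card (mset_set (cyc A (q \<circ> p))) =
      image_mset card (image_mset ((`) q) (mset_set (cyc A (p \<circ> q))))"
    unfolding cyc_comm[OF assms]
    by (subst image_mset_mset_set[of "(`) q"]) (auto intro!: inj_onI simp: inj_image_eq_iff[OF inj])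
  also have "\<dots> = image_mset card (mset_set (cyc A (p \<circ> q)))"
    using inj by (simp add: image_mset.compositionality o_def card_image inj_on_def)
  finally show ?thesis .
qed

lemma card_cyc_comm:
  assumes "finite A" "p permutes A" "q permutes A"
  shows "card (cyc A (q \<circ> p)) = card (cyc A (p \<circ> q))"
  using arg_cong[OF cycle_type_comm[OF assms], of size] by simp

text \<open>A rotation of the list changes its head but not its cycle. Hence for each cycle the head
  is equally often each point of B, and it may be replaced by a free point b.\<close>

lemma sum_hd_permutations_of_set:
  fixes F :: "'a \<Rightarrow> ('a \<Rightarrow> 'a) \<Rightarrow> 'b :: comm_semiring_1"
  assumes "finite B"
  shows "of_nat (card B) * (\<Sum>ys\<in>permutations_of_set B. F (hd ys) (cycle_of_list ys)) =
         (\<Sum>b\<in>B. \<Sum>ys\<in>permutations_of_set B. F b (cycle_of_list ys))"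
proof -
  let ?S = "permutations_of_set B"
  have len: "length ys = card B" if "ys \<in> ?S" for ys 
    using that by (simp add: length_finite_permutations_of_set)
  have rot: "(\<Sum>ys\<in>?S. F (ys ! r) (cycle_of_list ys)) = (\<Sum>ys\<in>?S. F (hd ys) (cycle_of_list ys))"
    if r: "r < card B" for r
  proof -
    have inj: "inj_on (rotate r) ?S"
      by (rule inj_on_subset[OF inj_fn[OF inj_rotate1, of r], folded rotate_def]) simp
    have sub: "rotate r ` ?S \<subseteq> ?S" by (auto simp: permutations_of_set_def)
    have bij: "rotate r ` ?S = ?S" using endo_inj_surj[OF _ sub inj] by simp
    have "(\<Sum>ys\<in>?S. F (hd ys) (cycle_of_list ys)) = (\<Sum>ys\<in>rotate r ` ?S. F (hd ys) (cycle_of_list ys))"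
      using bij by simp
    also have "\<dots> = (\<Sum>ys\<in>?S. F (hd (rotate r ys)) (cycle_of_list (rotate r ys)))"
      using inj by (simp add: sum.reindex)
    also have "\<dots> = (\<Sum>ys\<in>?S. F (ys ! r) (cycle_of_list ys))"
    proof (rule sum.cong)
      fix ys assume ys: "ys \<in> ?S"
      hence "distinct ys" by (simp add: permutations_of_set_def)
      moreover have "ys \<noteq> []" "r mod length ys = r" using len[OF ys] r by auto
      ultimately show "F (hd (rotate r ys)) (cycle_of_list (rotate r ys)) = F (ys ! r) (cycle_of_list ys)"
        using cycle_of_list_rotate_independent[of ys r] hd_rotate_conv_nth[of ys r] by simp
    qed simp
    finally show ?thesis ..
  qed
  have "(\<Sum>b\<in>B. \<Sum>ys\<in>?S. F b (cycle_of_list ys)) = (\<Sum>ys\<in>?S. \<Sum>b\<in>B. F b (cycle_of_list ys))"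
    by (rule sum.swap[of "\<lambda>b ys. F b (cycle_of_list ys)" ?S B])
  also have "\<dots> = (\<Sum>ys\<in>?S. \<Sum>r<card B. F (ys ! r) (cycle_of_list ys))"
  proof (rule sum.cong)
    fix ys assume ys: "ys \<in> ?S"
    hence "distinct ys" "B = set ys" by (auto simp: permutations_of_set_def)
    hence "bij_betw ((!) ys) {..<card B} B" 
      by (intro bij_betw_nth) (auto simp: len[OF ys])
    thus "(\<Sum>b\<in>B. F b (cycle_of_list ys)) = (\<Sum>r<card B. F (ys ! r) (cycle_of_list ys))"
      by (rule sum.reindex_bij_betw[symmetric])
  qed simp
  also have "\<dots> = (\<Sum>r<card B. \<Sum>ys\<in>?S. F (ys ! r) (cycle_of_list ys))"
    by (rule sum.swap[of "\<lambda>ys r. F (ys ! r) (cycle_of_list ys)" "{..<card B}" ?S])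
  also have "\<dots> = of_nat (card B) * (\<Sum>ys\<in>?S. F (hd ys) (cycle_of_list ys))"
    using rot by simp
  finally show ?thesis ..
qed

lemma sum_permutations_of_set_Cons:
  assumes "finite A" "A \<noteq> {}"
  shows "(\<Sum>xs\<in>permutations_of_set A. F xs) = (\<Sum>a\<in>A. \<Sum>ys\<in>permutations_of_set (A - {a}). F (a # ys))"
proof -
  have "permutations_of_set A = (\<Union>a\<in>A. (#) a ` permutations_of_set (A - {a}))"
    using permutations_of_set_nonempty[OF assms(2)] .
  hence "(\<Sum>xs\<in>permutations_of_set A. F xs) = (\<Sum>a\<in>A. sum F ((#) a ` permutations_of_set (A - {a})))"
    using assms(1) by (simp only:) (subst sum.UNION_disjoint, auto)
  thus ?thesis by (simp add: sum.reindex)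
qed

section \<open>Generating functions of powers and sums over long cycles\<close>

text \<open>The polylogarithm series of order -k. Laurent series are used because they form a field:
  later computations divide by z, 1 - z and 1 - z^k.\<close>

definition power_gf :: "nat \<Rightarrow> complex fls" where
  "power_gf k = fps_to_fls (Abs_fps (\<lambda>N. of_nat N ^ k))"

definition theta :: "complex fls \<Rightarrow> complex fls" where
  "theta f = fls_X * fls_deriv f"

lemma power_gf_Suc: "power_gf (Suc k) = theta (power_gf k)"
proof -
  have "Abs_fps (\<lambda>N. of_nat N ^ Suc k) = fps_X * fps_deriv (Abs_fps (\<lambda>N. of_nat N ^ k :: complex))"
    by (rule fps_ext) (auto split: nat.splits)
  thus ?thesis unfolding power_gf_def theta_def by (simp add: fls_deriv_fps_to_fls fls_times_fps_to_fls)
qed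

lemma theta_sum: "theta (\<Sum>x\<in>S. f x) = (\<Sum>x\<in>S. theta (f x))"
  by (simp add: theta_def fls_deriv_sum sum_distrib_left)

definition long_cycle_sum :: "'a set \<Rightarrow> ('a \<Rightarrow> 'a) \<Rightarrow> complex fls" where
  "long_cycle_sum A p = (\<Sum>ys\<in>permutations_of_set A. power_gf (card (cyc A (cycle_of_list ys \<circ> p))))"

lemma cycle_of_list_permutes: "ys \<in> permutations_of_set A \<Longrightarrow> cycle_of_list ys permutes A"
  using cycle_permutes[of ys] by (simp add: permutations_of_set_def)

text \<open>The cycles in L fix a. If q fixes a too, then a is a cycle of the product and its
  removal costs one \<open>theta\<close>. Otherwise a has the same predecessor in the product as in
  q, so deleting a from the product is deleting it from q. The family L is arbitrary so that a
  second point can be deleted in the same way.\<close>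

lemma sum_power_gf_remove:
  assumes "finite A" "q permutes A" "a \<in> A" and L: "\<And>ys. ys \<in> L \<Longrightarrow> cycle_of_list ys permutes (A - {a})"
  shows "(\<Sum>ys\<in>L. power_gf (card (cyc A (cycle_of_list ys \<circ> q)))) =
    (if q a = a then theta (\<Sum>ys\<in>L. power_gf (card (cyc (A - {a}) (cycle_of_list ys \<circ> q))))
     else (\<Sum>ys\<in>L. power_gf (card (cyc (A - {a}) (cycle_of_list ys \<circ> (q \<circ> transpose a (inv q a)))))))"
proof -
  have perm: "(cycle_of_list ys \<circ> q) permutes A" "cycle_of_list ys a = a" "inj (cycle_of_list ys)"
    if "ys \<in> L" for ys
  proof -
    have c: "cycle_of_list ys permutes (A - {a})" using L[OF that] .
    hence "cycle_of_list ys permutes A" by (rule permutes_subset) auto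
    thus "(cycle_of_list ys \<circ> q) permutes A" using assms by (simp add: permutes_compose)
    show "cycle_of_list ys a = a" using c by (simp add: permutes_def)
    show "inj (cycle_of_list ys)" using c by (rule permutes_inj)
  qed
  show ?thesis
  proof (cases "q a = a")
    case True
    have "card (cyc A (cycle_of_list ys \<circ> q)) = Suc (card (cyc (A - {a}) (cycle_of_list ys \<circ> q)))"
      if "ys \<in> L" for ys
      using perm[OF that] True assms by (intro card_cyc_fixed) auto
    thus ?thesis using True by (simp add: theta_sum power_gf_Suc)
  next
    case False
    have "card (cyc A (cycle_of_list ys \<circ> q)) = 
        card (cyc (A - {a}) (cycle_of_list ys \<circ> (q \<circ> transpose a (inv q a))))"
      if ys: "ys \<in> L" for ys
    proof -
      let ?c = "cycle_of_list ys"
      have q: "bij q" using assms(2) by (rule permutes_bij)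
      have "(?c \<circ> q) (inv q a) = a" using q perm(2)[OF ys] by (simp add: bij_is_surj surj_f_inv_f)
      hence "inv (?c \<circ> q) a = inv q a"
        using permutes_inj[OF perm(1)[OF ys]] by (metis inv_f_f)
      moreover have "(?c \<circ> q) a \<noteq> a" using False perm(2,3)[OF ys] by (metis comp_apply injD)
      ultimately show ?thesis using card_cyc_remove[OF assms(1) perm(1)[OF ys] assms(3)] by (simp add: o_assoc)
    qed
    thus ?thesis using False by simp
  qed
qed

lemma long_cycle_sum_remove:
  assumes "finite A" "q permutes A" "a \<in> A"
  shows "(\<Sum>ys\<in>permutations_of_set (A - {a}). power_gf (card (cyc A (cycle_of_list ys \<circ> q)))) =
    (if q a = a then theta (long_cycle_sum (A - {a}) q) else long_cycle_sum (A - {a}) (q \<circ> transpose a (inv q a)))"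
  unfolding long_cycle_sum_def by (rule sum_power_gf_remove[OF assms cycle_of_list_permutes])

text \<open>A long cycle through a, b, ... is (a b) times the cycle with a left out, and (a b) can
  be moved to the right of p. Averaging over rotations of the shorter list frees b; each of its
  \<open>card A - 1\<close> entries serves as head once, whence the factor.\<close>

lemma long_cycle_sum_rec:
  fixes A :: "'a set"
  assumes "finite A" "p permutes A" "card A \<ge> 2"
  shows "of_nat (card A - 1) * long_cycle_sum A p = (\<Sum>a\<in>A. \<Sum>b\<in>A - {a}. 
     \<Sum>ys\<in>permutations_of_set (A - {a}). power_gf (card (cyc A (cycle_of_list ys \<circ> (p \<circ> transpose a b)))))"
proof -
  have ne: "A \<noteq> {}" using assms(3) by auto
  have "of_nat (card A - 1) * long_cycle_sum A p = (\<Sum>a\<in>A. of_nat (card (A - {a})) * 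
     (\<Sum>ys\<in>permutations_of_set (A - {a}). power_gf (card (cyc A (cycle_of_list (a # ys) \<circ> p)))))"
    unfolding long_cycle_sum_def sum_permutations_of_set_Cons[OF assms(1) ne] sum_distrib_left
    by (intro sum.cong) (use assms(1) in simp_all)
  also have "\<dots> = (\<Sum>a\<in>A. \<Sum>b\<in>A - {a}. 
     \<Sum>ys\<in>permutations_of_set (A - {a}). power_gf (card (cyc A (cycle_of_list ys \<circ> (p \<circ> transpose a b)))))"
  proof (rule sum.cong)
    fix a assume a: "a \<in> A"
    define F where "F b c = power_gf (card (cyc A (c \<circ> (p \<circ> transpose a b))))" for b and c :: "'a \<Rightarrow> 'a"
    have "power_gf (card (cyc A (cycle_of_list (a # ys) \<circ> p))) = F (hd ys) (cycle_of_list ys)"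
      if ys: "ys \<in> permutations_of_set (A - {a})" for ys
    proof -
      have "card (A - {a}) \<ge> 1" using a assms by simp
      hence "length ys \<ge> 1" using length_finite_permutations_of_set[OF ys] by simp
      then obtain b zs where yz: "ys = b # zs" by (cases ys) auto
      have "b \<in> A" using ys yz by (auto simp: permutations_of_set_def)
      hence t: "transpose a b permutes A" using a by (simp add: permutes_swap_id)
      have "cycle_of_list ys permutes A"
        using cycle_of_list_permutes[OF ys] by (rule permutes_subset) auto
      hence c: "(cycle_of_list ys \<circ> p) permutes A" using assms(2) by (simp add: permutes_compose)
      have "cycle_of_list (a # ys) \<circ> p = transpose a b \<circ> (cycle_of_list ys \<circ> p)" by (simp add: yz o_assoc)
      thus ?thesis using card_cyc_comm[OF assms(1) c t] yz by (simp add: F_def o_assoc)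
    qed
    thus "of_nat (card (A - {a})) * (\<Sum>ys\<in>permutations_of_set (A - {a}). power_gf (card (cyc A (cycle_of_list (a # ys) \<circ> p)))) 
       = (\<Sum>b\<in>A - {a}. \<Sum>ys\<in>permutations_of_set (A - {a}). power_gf (card (cyc A (cycle_of_list ys \<circ> (p \<circ> transpose a b)))))"
      using sum_hd_permutations_of_set[of "A - {a}" F] assms(1) by (simp add: F_def)
  qed simp
  finally show ?thesis .
qed

text \<open>Sorts the transpositions (a b) by their effect on p. Two cycles C, C' are merged by
  \<open>card C * card C'\<close> ordered pairs (a, b), and a cycle C is split at distance i by
  \<open>card C\<close> of them.\<close>

lemma sum_pairs_cyc:
  fixes F :: "'a \<Rightarrow> 'a \<Rightarrow> 'b::comm_semiring_1"
  assumes "finite A" "p permutes A"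
    and M: "\<And>a b. a \<in> A \<Longrightarrow> b \<in> A \<Longrightarrow> orbit p a \<noteq> orbit p b \<Longrightarrow> F a b = M (orbit p a) (orbit p b)"
    and S: "\<And>a i. a \<in> A \<Longrightarrow> 0 < i \<Longrightarrow> i < card (orbit p a) \<Longrightarrow> F a ((p ^^ i) a) = S (orbit p a) i"
  shows "(\<Sum>a\<in>A. \<Sum>b\<in>A - {a}. F a b) =
     (\<Sum>C\<in>cyc A p. \<Sum>C'\<in>cyc A p - {C}. of_nat (card C) * of_nat (card C') * M C C')
     + (\<Sum>C\<in>cyc A p. of_nat (card C) * (\<Sum>i=1..<card C. S C i))"
proof -
  have perm: "permutation p" using assms by (intro permutes_permutation)
  have self: "x \<in> orbit p x" for x using permutation_self_in_orbit[OF perm] .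
  have inner: "(\<Sum>b\<in>A - {a}. F a b) = (\<Sum>C'\<in>cyc A p - {orbit p a}. of_nat (card C') * M (orbit p a) C')
      + (\<Sum>i=1..<card (orbit p a). S (orbit p a) i)" if a: "a \<in> A" for a
  proof -
    define C where "C = orbit p a"
    have CA: "C \<in> cyc A p" using a by (simp add: cyc_def C_def)
    have "(\<Sum>b\<in>A - {a}. F a b) = (\<Sum>b\<in>A. if b = a then 0 else F a b)"
      using assms(1) a by (simp add: sum.remove[of A a])
    also have "\<dots> = (\<Sum>C'\<in>cyc A p. \<Sum>b\<in>C'. if b = a then 0 else F a b)"
      by (rule sum_over_cyc[OF assms(1,2)])
    also have "\<dots> = (\<Sum>b\<in>C. if b = a then 0 else F a b) + (\<Sum>C'\<in>cyc A p - {C}. \<Sum>b\<in>C'. if b = a then 0 else F a b)"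
      using CA assms(1) by (subst sum.remove[of _ C]) auto
    also have "(\<Sum>C'\<in>cyc A p - {C}. \<Sum>b\<in>C'. if b = a then 0 else F a b) = 
        (\<Sum>C'\<in>cyc A p - {C}. of_nat (card C') * M C C')"
    proof (rule sum.cong)
      fix C' assume C': "C' \<in> cyc A p - {C}"
      have "(if b = a then 0 else F a b) = M C C'" if b: "b \<in> C'" for b
      proof -
        have ob: "orbit p b = C'" using cyc_eq_orbit[OF perm _ b, of A] C' by auto
        moreover have "b \<in> A" using cyc_subset[OF assms(2), of C'] C' b by auto
        moreover have "b \<noteq> a" using ob C' C_def by auto
        ultimately show ?thesis using M[OF a, of b] C' by (auto simp: C_def)
      qed
      thus "(\<Sum>b\<in>C'. if b = a then 0 else F a b) = of_nat (card C') * M C C'" by simp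
    qed simp
    also have "(\<Sum>b\<in>C. if b = a then 0 else F a b) = (\<Sum>i=1..<card C. S C i)"
    proof -
      note k = funpow_orbit[OF perm, of a, folded C_def]
      have "(\<Sum>b\<in>C. if b = a then 0 else F a b) = (\<Sum>i<card C. if (p ^^ i) a = a then 0 else F a ((p ^^ i) a))"
        by (subst (1) k(2), subst sum.reindex[OF k(3)]) simp
      also have "{..<card C} = insert 0 {1..<card C}" using k(4) by auto
      also have "(\<Sum>i\<in>insert 0 {1..<card C}. if (p ^^ i) a = a then 0 else F a ((p ^^ i) a)) =
        (\<Sum>i=1..<card C. if (p ^^ i) a = a then 0 else F a ((p ^^ i) a))" by simp
      also have "\<dots> = (\<Sum>i=1..<card C. S C i)"
      proof (rule sum.cong)
        fix i assume i: "i \<in> {1..<card C}"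
        hence "(p ^^ i) a \<noteq> (p ^^ 0) a" using k(3) by (auto dest!: inj_onD[of _ _ i 0])
        thus "(if (p ^^ i) a = a then 0 else F a ((p ^^ i) a)) = S C i"
          using S[OF a, of i] i by (simp add: C_def)
      qed simp
      finally show ?thesis .
    qed
    finally show ?thesis by (simp add: C_def add.commute)
  qed
  have "(\<Sum>a\<in>A. \<Sum>b\<in>A - {a}. F a b) = (\<Sum>C\<in>cyc A p. \<Sum>a\<in>C. 
     (\<Sum>C'\<in>cyc A p - {orbit p a}. of_nat (card C') * M (orbit p a) C')
      + (\<Sum>i=1..<card (orbit p a). S (orbit p a) i))"
    by (subst sum_over_cyc[OF assms(1,2), symmetric]) (rule sum.cong[OF refl inner])
  also have "\<dots> = (\<Sum>C\<in>cyc A p. \<Sum>a\<in>C. 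
     (\<Sum>C'\<in>cyc A p - {C}. of_nat (card C') * M C C') + (\<Sum>i=1..<card C. S C i))"
  proof (intro sum.cong refl)
    fix C a assume "C \<in> cyc A p" "a \<in> C"
    thus "(\<Sum>C'\<in>cyc A p - {orbit p a}. of_nat (card C') * M (orbit p a) C')
      + (\<Sum>i=1..<card (orbit p a). S (orbit p a) i) =
      (\<Sum>C'\<in>cyc A p - {C}. of_nat (card C') * M C C') + (\<Sum>i=1..<card C. S C i)"
      using cyc_eq_orbit[OF perm, of C A a] by simp
  qed
  also have "\<dots> = (\<Sum>C\<in>cyc A p. \<Sum>C'\<in>cyc A p - {C}. of_nat (card C) * of_nat (card C') * M C C')
     + (\<Sum>C\<in>cyc A p. of_nat (card C) * (\<Sum>i=1..<card C. S C i))"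
    by (simp add: sum.distrib sum_distrib_left mult.assoc distrib_left)
  finally show ?thesis .
qed

section \<open>Logarithmic derivatives of cycle products\<close>

lemma fls_deriv_divide:
  fixes f h :: "'a :: field fls"
  assumes "h \<noteq> 0"
  shows "fls_deriv (f / h) = (fls_deriv f * h - f * fls_deriv h) / h ^ 2"
proof -
  have "fls_deriv f = fls_deriv (f / h * h)" using assms by simp
  also have "\<dots> = fls_deriv (f / h) * h + f / h * fls_deriv h"
    unfolding fls_deriv_mult by (simp only: ac_simps)
  finally have "fls_deriv f * h = fls_deriv (f / h) * h ^ 2 + f * fls_deriv h"
    using assms by (simp add: power2_eq_square algebra_simps)
  thus ?thesis using assms by simp
qed

lemma fls_deriv_power':
  fixes f :: "'a :: field fls"
  assumes "f \<noteq> 0"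
  shows "fls_deriv (f ^ k) = of_nat k * f ^ k / f * fls_deriv f"
proof -
  have "of_nat k * f ^ (k - 1) = of_nat k * f ^ k / f"
    using assms by (cases k) simp_all
  thus ?thesis by (simp only: fls_deriv_power)
qed

lemma fls_deriv_X_power':
  "fls_deriv (fls_X ^ k :: 'a :: field fls) = of_nat k * fls_X ^ k / fls_X"
  by (subst fls_deriv_power') simp_all

lemma one_minus_fls_X_power_nonzero:
  assumes "k \<noteq> 0"
  shows "1 - fls_X ^ k \<noteq> (0 :: 'a :: field fls)"
proof
  assume "1 - fls_X ^ k = (0 :: 'a fls)"
  hence "fls_nth (fls_X ^ k :: 'a fls) 0 = fls_nth 1 0" by simp
  thus False using assms by (simp add: fls_X_power_nth)
qed

lemma one_minus_fls_X_nonzero: "1 - fls_X \<noteq> (0 :: 'a :: field fls)"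
  using one_minus_fls_X_power_nonzero[of 1] by simp

section \<open>The factor of one cycle\<close>

text \<open>The contribution of a cycle of length k to Stanley's formula. The denominators multiply
  to (1 - z)^n over all cycles, and a fixed point has factor 1.\<close>

definition cyc_gf :: "nat \<Rightarrow> complex fls" where
  "cyc_gf k = (1 - fls_X ^ k) / (1 - fls_X) ^ k"

text \<open>This is k / (1 - z) - k z^(k-1) / (1 - z^k) over a common denominator.\<close>

definition cyc_gf_log_deriv :: "nat \<Rightarrow> complex fls" where
  "cyc_gf_log_deriv k = of_nat k * (fls_X - fls_X ^ k) / (fls_X * (1 - fls_X) * (1 - fls_X ^ k))"

text \<open>
  Since \<^term>\<open>cyc_gf 0\<close> vanishes, the terms for an empty cycle may be added to a sum over splits. The
  removal of a fixed point is not of this form: it multiplies by \<open>x\<close>, that is, applies \<^const>\<open>theta\<close>.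
\<close>

lemma cyc_gf_0 [simp]: "cyc_gf 0 = 0"
  by (simp add: cyc_gf_def)

lemma cyc_gf_nonzero: "k \<noteq> 0 \<Longrightarrow> cyc_gf k \<noteq> 0"
  by (simp add: cyc_gf_def one_minus_fls_X_power_nonzero one_minus_fls_X_nonzero del: right_minus_eq)

lemma fls_deriv_cyc_gf:
  assumes "k \<noteq> 0"
  shows "fls_deriv (cyc_gf k) = cyc_gf k * cyc_gf_log_deriv k"
proof -
  note nz = one_minus_fls_X_power_nonzero[OF assms, where 'a = complex] 
    one_minus_fls_X_nonzero[where 'a = complex]
  define z y u :: "complex fls" where "z = fls_X" and "y = fls_X ^ k" and "u = (1 - fls_X) ^ k"
  have z: "z \<noteq> 0" "1 - z \<noteq> 0" "1 - y \<noteq> 0" "u \<noteq> 0" using nz by (auto simp: z_def y_def u_def)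
  have Dy: "fls_deriv y = of_nat k * y / z" by (simp add: y_def z_def fls_deriv_X_power')
  have Du: "fls_deriv u = - of_nat k * u / (1 - z)"
    unfolding u_def z_def by (subst fls_deriv_power'[OF nz(2)]) simp
  have "fls_deriv (cyc_gf k) = fls_deriv ((1 - y) / u)" by (simp add: cyc_gf_def y_def u_def)
  also have "\<dots> = (fls_deriv (1 - y) * u - (1 - y) * fls_deriv u) / u ^ 2"
    using z by (intro fls_deriv_divide)
  also have "\<dots> = (1 - y) / u * (of_nat k * (z - y) / (z * (1 - z) * (1 - y)))"
    unfolding fls_deriv_sub Dy Du using z by (simp add: divide_simps) (simp add: algebra_simps power2_eq_square)
  finally show ?thesis by (simp add: cyc_gf_def cyc_gf_log_deriv_def z_def y_def u_def)
qed

lemma fls_deriv_prod_cyc_gf: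
  assumes "finite S" "\<And>C. C \<in> S \<Longrightarrow> w C \<noteq> (0::nat)"
  shows "fls_deriv (\<Prod>C\<in>S. cyc_gf (w C)) = (\<Prod>C\<in>S. cyc_gf (w C)) * (\<Sum>C\<in>S. cyc_gf_log_deriv (w C))"
  using assms
proof (induction S)
  case (insert C S)
  thus ?case by (simp add: fls_deriv_cyc_gf algebra_simps)
qed simp

text \<open>Dividing by the old factor leaves the product over all cycles as a common factor of
  every term, whatever cycles a transposition touches.\<close>

lemma cyc_gf_ratio1:
  assumes "k \<noteq> 0"
  shows "cyc_gf (k - 1) / cyc_gf k = (1 - fls_X) * (fls_X - fls_X ^ k) / (fls_X * (1 - fls_X ^ k))"
proof (cases k)
  case (Suc l)
  thus ?thesis unfolding cyc_gf_def
    using one_minus_fls_X_power_nonzero[OF assms, where 'a = complex] one_minus_fls_X_nonzero[where 'a = complex]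
    by (simp add: divide_simps) (simp add: algebra_simps)
qed (use assms in simp)

lemma cyc_gf_ratio_merge1:
  assumes "k \<noteq> 0" "l \<noteq> 0"
  shows "cyc_gf (k + l - 1) / (cyc_gf k * cyc_gf l) = (1 - fls_X) * (fls_X - fls_X ^ k * fls_X ^ l) / (fls_X * (1 - fls_X ^ k) * (1 - fls_X ^ l))"
proof -
  obtain k' where k': "k = Suc k'" using assms by (cases k) auto
  have e: "k + l - 1 = k' + l" by (simp add: k')
  show ?thesis unfolding cyc_gf_def e
    using one_minus_fls_X_power_nonzero[OF assms(1), where 'a = complex] one_minus_fls_X_nonzero[where 'a = complex]
      one_minus_fls_X_power_nonzero[OF assms(2), where 'a = complex]
    by (simp add: k' power_add divide_simps) (simp add: algebra_simps)
qed

text \<open>For an ordered pair of cycles: the first term is their merge, the second is what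
  \<open>theta\<close>, from a split of the first cycle that isolates a, produces on the factor of
  the second. Everything but k l cancels.\<close>

lemma cross_identity1:
  assumes "k \<noteq> 0" "l \<noteq> 0"
  shows "of_nat k * of_nat l * (cyc_gf (k + l - 1) / (cyc_gf k * cyc_gf l)) + fls_X * cyc_gf_log_deriv l * (of_nat k * (cyc_gf (k - 1) / cyc_gf k)) = of_nat k * of_nat l"
proof -
  define z y w :: "complex fls" where "z = fls_X" and "y = fls_X ^ k" and "w = fls_X ^ l"
  have z: "z \<noteq> 0" "1 - z \<noteq> 0" "1 - y \<noteq> 0" "1 - w \<noteq> 0" 
    using one_minus_fls_X_power_nonzero[OF assms(1), where 'a = complex] one_minus_fls_X_nonzero[where 'a = complex]
      one_minus_fls_X_power_nonzero[OF assms(2), where 'a = complex] by (auto simp: z_def y_def w_def)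
  have "(1 - z) * (z - y * w) / (z * (1 - y) * (1 - w)) + z * ((z - w) / (z * (1 - z) * (1 - w))) * ((1 - z) * (z - y) / (z * (1 - y))) = 1"
    using z by (simp add: divide_simps) (simp add: algebra_simps)
  hence "of_nat k * of_nat l * ((1 - z) * (z - y * w) / (z * (1 - y) * (1 - w)) + z * ((z - w) / (z * (1 - z) * (1 - w))) * ((1 - z) * (z - y) / (z * (1 - y)))) = of_nat k * of_nat l"
    by simp
  thus ?thesis unfolding cyc_gf_ratio1[OF assms(1)] cyc_gf_ratio_merge1[OF assms] cyc_gf_log_deriv_def z_def y_def w_def
    by (simp add: algebra_simps)
qed

text \<open>Expanding gives constants and two geometric sums. The exponents i start at 1 but the
  exponents k - 1 - i end at 0, so the sums differ by a factor z; this is the origin of 1 +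
  z.\<close>

lemma sum_split1:
  assumes "k \<noteq> 0"
  shows "(\<Sum>i=1..<k. (1 - fls_X ^ i) * (1 - fls_X ^ (k - 1 - i))) =
    of_nat (k - 1) * (1 + fls_X ^ (k - 1)) - (1 + fls_X) * (1 - fls_X ^ (k - 1)) / (1 - fls_X :: complex fls)"
proof -
  obtain l where l: "k = Suc l" using assms by (cases k) auto
  have nz: "1 - fls_X \<noteq> (0 :: complex fls)" by (rule one_minus_fls_X_nonzero)
  have geo: "(\<Sum>i<l. fls_X ^ i) = (1 - fls_X ^ l) / (1 - fls_X :: complex fls)"
    using sum_gp_strict[of "fls_X :: complex fls" l] nz by auto
  have "(\<Sum>i=1..<k. (1 - fls_X ^ i) * (1 - fls_X ^ (k - 1 - i))) =
     (\<Sum>i<l. (1 - fls_X ^ Suc i) * (1 - fls_X ^ (l - Suc i) :: complex fls))"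
    unfolding l by (rule sum.reindex_bij_witness[of _ Suc "\<lambda>i. i - 1"]) auto
  also have "\<dots> = (\<Sum>i<l. 1 + fls_X ^ l - fls_X * fls_X ^ i - fls_X ^ (l - Suc i))"
  proof (rule sum.cong)
    fix i assume "i \<in> {..<l}"
    hence "fls_X ^ l = fls_X ^ Suc i * (fls_X ^ (l - Suc i) :: complex fls)"
      by (subst power_add[symmetric]) simp
    thus "(1 - fls_X ^ Suc i) * (1 - fls_X ^ (l - Suc i)) = 1 + fls_X ^ l - fls_X * fls_X ^ i - (fls_X ^ (l - Suc i) :: complex fls)"
      by (simp add: algebra_simps)
  qed simp
  also have "\<dots> = of_nat l * (1 + fls_X ^ l) - fls_X * (\<Sum>i<l. fls_X ^ i) - (\<Sum>i<l. fls_X ^ (l - Suc i))"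
    by (simp add: sum_subtractf sum_distrib_left)
  also have "(\<Sum>i<l. fls_X ^ (l - Suc i)) = (\<Sum>i<l. fls_X ^ i :: complex fls)"
    by (rule sum.nat_diff_reindex)
  finally have E: "(\<Sum>i=1..<k. (1 - fls_X ^ i) * (1 - fls_X ^ (k - 1 - i))) = 
     of_nat l * (1 + fls_X ^ l) - fls_X * ((1 - fls_X ^ l) / (1 - fls_X)) - (1 - fls_X ^ l) / (1 - fls_X :: complex fls)"
    unfolding geo .
  show ?thesis unfolding E using l
    by (simp add: diff_divide_distrib[symmetric] add_divide_distrib[symmetric] algebra_simps)
qed

lemma cyc_gf_split1:
  assumes "k \<noteq> 0"
  shows "(\<Sum>i=1..<k. cyc_gf i * cyc_gf (k - 1 - i) / cyc_gf k) = (1 - fls_X) / (1 - fls_X ^ k) *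
    (of_nat (k - 1) * (1 + fls_X ^ (k - 1)) - (1 + fls_X) * (1 - fls_X ^ (k - 1)) / (1 - fls_X))"
proof -
  have "cyc_gf i * cyc_gf (k - 1 - i) / cyc_gf k = (1 - fls_X) / (1 - fls_X ^ k) * ((1 - fls_X ^ i) * (1 - fls_X ^ (k - 1 - i)))"
    if "i \<in> {1..<k}" for i
  proof -
    define j where "j = k - 1 - i"
    have k: "k = Suc (i + j)" using that by (simp add: j_def)
    show ?thesis unfolding j_def[symmetric] unfolding cyc_gf_def k
      using one_minus_fls_X_power_nonzero[OF assms, where 'a = complex] one_minus_fls_X_nonzero[where 'a = complex]
      by (simp add: k power_add divide_simps)
  qed
  thus ?thesis unfolding sum_split1[OF assms, symmetric] sum_distrib_left by simp
qed

text \<open>With y for z^k, and k as a scalar, the identity holds for independent variables, so that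
  it is a matter of clearing denominators.\<close>

lemma single_identity1_aux:
  fixes z y k :: "'a :: field"
  assumes "z \<noteq> 0" "1 - z \<noteq> 0" "1 - y \<noteq> 0"
  shows "k * ((1 - z) / (1 - y) * ((k - 1) * (1 + y / z) - (1 + z) * (1 - y / z) / (1 - z))) +
    k * (1 - z) * (z - y) / (z * (1 - y)) * (1 + z) / (1 - z) +
    z * ((k * ((1 - z) * (1 - k * y / z) - (z - y)) * (z * (1 - y)) - k * (1 - z) * (z - y) * (1 - y - k * y)) / (z * (1 - y)) ^ 2) +
    z * (k * (z - y) / (z * (1 - z) * (1 - y))) * (k * (1 - z) * (z - y) / (z * (1 - y))) = k * (k - 1)"
proof -
  \<comment> \<open>t stands for z^(k-1); writing y = t z removes the nested quotient y / z before
    denominators are cleared.\<close>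
  define t where "t = y / z"
  have y: "y = t * z" using assms by (simp add: t_def)
  have 1: "(z - t * z) = z * (1 - t)" by (simp add: algebra_simps)
  show ?thesis using assms unfolding y 1
    by (simp add: divide_simps) (simp add: algebra_simps power2_eq_square power3_eq_cube)
qed

text \<open>The contributions of one cycle by itself: its splits, and \<open>theta\<close> acting on
  \<open>base_gf\<close>, on the ratio r and on the cycle's own factor.\<close>

lemma single_identity1:
  assumes "k \<noteq> 0"
  defines "r \<equiv> of_nat k * (cyc_gf (k - 1) / cyc_gf k)"
  shows "of_nat k * (\<Sum>i=1..<k. cyc_gf i * cyc_gf (k - 1 - i) / cyc_gf k) + r * (1 + fls_X) / (1 - fls_X)
     + fls_X * fls_deriv r + fls_X * cyc_gf_log_deriv k * r = of_nat k * (of_nat k - 1)"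
proof -
  define z y :: "complex fls" where "z = fls_X" and "y = fls_X ^ k"
  have z: "z \<noteq> 0" "1 - z \<noteq> 0" "1 - y \<noteq> 0" 
    using one_minus_fls_X_power_nonzero[OF assms(1), where 'a = complex] one_minus_fls_X_nonzero[where 'a = complex]
     by (auto simp: z_def y_def)
  have Dy: "fls_deriv y = of_nat k * y / z" by (simp add: y_def z_def fls_deriv_X_power')
  have Dz: "fls_deriv z = 1" by (simp add: z_def)
  have yk: "fls_X ^ (k - 1) = y / z" "of_nat (k - 1) = (of_nat k - 1 :: complex fls)" 
    using assms by (auto simp: y_def z_def power_diff of_nat_diff)
  have r: "r = of_nat k * (1 - z) * (z - y) / (z * (1 - y))"
    unfolding r_def cyc_gf_ratio1[OF assms(1)] by (simp add: z_def y_def)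
  have "fls_deriv r = (fls_deriv (of_nat k * (1 - z) * (z - y)) * (z * (1 - y)) - of_nat k * (1 - z) * (z - y) * fls_deriv (z * (1 - y))) / (z * (1 - y)) ^ 2"
    unfolding r using z by (intro fls_deriv_divide) simp
  also have "fls_deriv (of_nat k * (1 - z) * (z - y)) = of_nat k * ((1 - z) * (1 - of_nat k * y / z) - (z - y))"
  proof -
    have "(of_nat k * (1 - z)) * (1 - c) + (of_nat k * (0 - 1) + 0 * (1 - z)) * (z - y) = of_nat k * ((1 - z) * (1 - c) - (z - y))"
      for c :: "complex fls" by (simp add: algebra_simps)
    thus ?thesis unfolding fls_deriv_mult fls_deriv_sub Dz Dy fls_deriv_of_nat fls_deriv_one .
  qed
  also have "fls_deriv (z * (1 - y)) = 1 - y - of_nat k * y"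
    using z(1) by (simp add: Dz Dy)
  finally have Dr: "fls_deriv r = (of_nat k * ((1 - z) * (1 - of_nat k * y / z) - (z - y)) * (z * (1 - y)) - of_nat k * (1 - z) * (z - y) * (1 - y - of_nat k * y)) / (z * (1 - y)) ^ 2" .
  show ?thesis
    unfolding cyc_gf_split1[OF assms(1)] yk Dr cyc_gf_log_deriv_def
    unfolding r y_def[symmetric] unfolding z_def[symmetric]
    by (rule single_identity1_aux[OF z])
qed

definition cycles_gf :: "'a set set \<Rightarrow> complex fls" where
  "cycles_gf S = (\<Prod>C\<in>S. cyc_gf (card C))"

lemma theta_base_gf:
  "fls_X * fls_deriv (fls_X / (1 - fls_X) ^ 2) = fls_X / (1 - fls_X) ^ 2 * ((1 + fls_X) / (1 - fls_X :: complex fls))"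
proof -
  have nz: "1 - fls_X \<noteq> (0 :: complex fls)" by (rule one_minus_fls_X_nonzero)
  have "fls_deriv (fls_X / (1 - fls_X) ^ 2) = ((1 - fls_X) ^ 2 + 2 * fls_X * (1 - fls_X)) / ((1 - fls_X :: complex fls) ^ 2) ^ 2"
    using nz by (subst fls_deriv_divide) (simp_all add: fls_deriv_power algebra_simps)
  also have "\<dots> = (1 + fls_X) / (1 - fls_X) ^ 3"
  proof -
    have "(u ^ 2 + 2 * (1 - u) * u) / (u ^ 2) ^ 2 = (1 + (1 - u)) / u ^ 3" if "u \<noteq> 0" for u :: "complex fls"
      using that by (simp add: field_simps power2_eq_square power3_eq_cube)
    from this[OF nz] show ?thesis by simp
  qed
  finally have "fls_deriv (fls_X / (1 - fls_X) ^ 2) = (1 + fls_X) / (1 - fls_X :: complex fls) ^ 3" .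
  thus ?thesis by (simp add: power2_eq_square power3_eq_cube)
qed

text \<open>The product rule for \<open>theta\<close> yields the logarithmic derivatives of all
  factors of P. The cycle's own one belongs to \<open>single_identity1\<close>, each other one to
  \<open>cross_identity1\<close>. There remain k l for each ordered pair and k (k - 1) for each
  cycle, in total n (n - 1).\<close>

lemma sum_pairs_identity1:
  fixes S :: "'a set set"
  assumes fin: "finite S" and pos: "\<And>C. C \<in> S \<Longrightarrow> card C \<noteq> 0"
  defines "W \<equiv> fls_X / (1 - fls_X) ^ 2 :: complex fls"
  defines "P \<equiv> cycles_gf S"
  shows "(\<Sum>C\<in>S. \<Sum>C'\<in>S - {C}. of_nat (card C) * of_nat (card C') *
            (W * P * (cyc_gf (card C + card C' - 1) / (cyc_gf (card C) * cyc_gf (card C')))))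
       + (\<Sum>C\<in>S. of_nat (card C) * (\<Sum>i=1..<card C. W * P * (cyc_gf i * cyc_gf (card C - 1 - i) / cyc_gf (card C)))
            + theta (W * P * (of_nat (card C) * (cyc_gf (card C - 1) / cyc_gf (card C)))))
      = W * P * of_nat (\<Sum>C\<in>S. card C) * (of_nat (\<Sum>C\<in>S. card C) - 1)"
proof -
  define k where "k = (\<lambda>C :: 'a set. of_nat (card C) :: complex fls)"
  define v where "v = (\<lambda>(C :: 'a set) (C' :: 'a set). cyc_gf (card C + card C' - 1) / (cyc_gf (card C) * cyc_gf (card C')))"
  define r where "r = (\<lambda>C :: 'a set. k C * (cyc_gf (card C - 1) / cyc_gf (card C)))"
  define s where "s = (\<lambda>C :: 'a set. k C * (\<Sum>i=1..<card C. cyc_gf i * cyc_gf (card C - 1 - i) / cyc_gf (card C)))"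
  define m where "m = (\<lambda>C :: 'a set. cyc_gf_log_deriv (card C))"
  define q :: "complex fls" where "q = (1 + fls_X) / (1 - fls_X)"
  have nz: "1 - fls_X \<noteq> (0 :: complex fls)" by (rule one_minus_fls_X_nonzero)
  have DW: "fls_X * fls_deriv W = W * q" unfolding W_def q_def by (rule theta_base_gf)
  have DP: "fls_deriv P = P * (\<Sum>C\<in>S. m C)"
    unfolding P_def cycles_gf_def m_def by (rule fls_deriv_prod_cyc_gf[OF fin pos])
  have th: "theta (W * P * r C) = W * P * (r C * q + fls_X * fls_deriv (r C) + fls_X * (\<Sum>C'\<in>S. m C') * r C)" for C
    unfolding theta_def fls_deriv_mult DP
    using DW by (simp add: algebra_simps) 
  have single: "s C + r C * q + fls_X * fls_deriv (r C) + fls_X * m C * r C = k C * (k C - 1)" if "C \<in> S" for C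
    using single_identity1[OF pos[OF that]] unfolding s_def r_def k_def m_def q_def by simp
  have cross: "k C * k C' * v C C' + fls_X * m C' * r C = k C * k C'" if "C \<in> S" "C' \<in> S" for C C'
    using cross_identity1[OF pos[OF that(1)] pos[OF that(2)]] unfolding r_def k_def m_def v_def .
  have "(\<Sum>C\<in>S. \<Sum>C'\<in>S - {C}. k C * k C' * (W * P * v C C'))
       + (\<Sum>C\<in>S. k C * (\<Sum>i=1..<card C. W * P * (cyc_gf i * cyc_gf (card C - 1 - i) / cyc_gf (card C)))
            + theta (W * P * r C))
      = W * P * (\<Sum>C\<in>S. (\<Sum>C'\<in>S - {C}. k C * k C' * v C C') + 
           (s C + r C * q + fls_X * fls_deriv (r C) + fls_X * (\<Sum>C'\<in>S. m C') * r C))"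
    unfolding th s_def sum_distrib_left sum.distrib distrib_left by (simp add: algebra_simps)
  also have "(\<Sum>C\<in>S. (\<Sum>C'\<in>S - {C}. k C * k C' * v C C') + 
           (s C + r C * q + fls_X * fls_deriv (r C) + fls_X * (\<Sum>C'\<in>S. m C') * r C))
        = (\<Sum>C\<in>S. (\<Sum>C'\<in>S. k C * k C') - k C)"
  proof (rule sum.cong)
    fix C assume C: "C \<in> S"
    have "(\<Sum>C'\<in>S - {C}. k C * k C' * v C C') + (s C + r C * q + fls_X * fls_deriv (r C) + fls_X * (\<Sum>C'\<in>S. m C') * r C)
      = (\<Sum>C'\<in>S - {C}. k C * k C' * v C C' + fls_X * m C' * r C) + (s C + r C * q + fls_X * fls_deriv (r C) + fls_X * m C * r C)"
      unfolding sum.remove[OF fin C, of m] sum.distrib by (simp add: algebra_simps sum_distrib_left sum_distrib_right)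
    also have "(\<Sum>C'\<in>S - {C}. k C * k C' * v C C' + fls_X * m C' * r C) = (\<Sum>C'\<in>S - {C}. k C * k C')"
      using cross C by (intro sum.cong) auto
    finally show "(\<Sum>C'\<in>S - {C}. k C * k C' * v C C') + (s C + r C * q + fls_X * fls_deriv (r C) + fls_X * (\<Sum>C'\<in>S. m C') * r C)
      = (\<Sum>C'\<in>S. k C * k C') - k C"
      unfolding single[OF C] sum.remove[OF fin C, of "\<lambda>C'. k C * k C'"] by (simp add: algebra_simps)
  qed simp
  also have "\<dots> = (\<Sum>C\<in>S. k C) * ((\<Sum>C\<in>S. k C) - 1)"
    by (simp add: sum_subtractf sum_distrib_left sum_distrib_right algebra_simps)
  also have "(\<Sum>C\<in>S. k C) = of_nat (\<Sum>C\<in>S. card C)" by (simp add: k_def)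
  finally show ?thesis unfolding k_def v_def r_def by (simp add: mult.assoc)
qed

lemma cycles_gf_remove:
  assumes "finite S" "C \<in> S" "card C \<noteq> 0"
  shows "cycles_gf (S - {C}) = cycles_gf S / cyc_gf (card C)"
  unfolding cycles_gf_def using assms by (simp add: prod.remove[of S C] cyc_gf_nonzero)

section \<open>Ratios and identities for two deleted points\<close>

lemma cyc_gf_ratio2:
  assumes "k \<ge> 2"
  shows "cyc_gf (k - 2) / cyc_gf k = (1 - fls_X) ^ 2 * (fls_X ^ 2 - fls_X ^ k) / (fls_X ^ 2 * (1 - fls_X ^ k))"
proof -
  define l where "l = k - 2"
  have l: "k = Suc (Suc l)" using assms by (simp add: l_def)
  have "k \<noteq> 0" using assms by simp
  from one_minus_fls_X_power_nonzero[OF this, where 'a = complex] one_minus_fls_X_nonzero[where 'a = complex]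
  show ?thesis unfolding cyc_gf_def l
    by (simp add: divide_simps power2_eq_square) (simp add: algebra_simps)
qed

lemma cyc_gf_ratio_merge2:
  assumes "k \<noteq> 0" "l \<noteq> 0"
  shows "cyc_gf (k + l - 2) / (cyc_gf k * cyc_gf l) = 
    (1 - fls_X) ^ 2 * (fls_X ^ 2 - fls_X ^ k * fls_X ^ l) / (fls_X ^ 2 * (1 - fls_X ^ k) * (1 - fls_X ^ l))"
proof -
  obtain k' l' where k': "k = Suc k'" "l = Suc l'" using assms by (cases k; cases l) auto
  have e: "k + l - 2 = k' + l'" by (simp add: k')
  show ?thesis unfolding cyc_gf_def e
    using one_minus_fls_X_power_nonzero[OF assms(1), where 'a = complex] one_minus_fls_X_nonzero[where 'a = complex]
      one_minus_fls_X_power_nonzero[OF assms(2), where 'a = complex]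
    by (simp add: k' power_add divide_simps power2_eq_square) (simp add: algebra_simps)
qed

text \<open>A cycle has two splits that isolate one of a and b, so its \<open>theta\<close> term is
  doubled; the two copies are shared between the pairs (k, l) and (l, k), which makes the left side
  symmetric. The right side is a mixed term of the squared logarithmic derivative, that is, of a
  second derivative.\<close>

lemma cross_identity2:
  assumes "k \<ge> 2" "l \<ge> 2"
  shows "of_nat k * of_nat l * (cyc_gf (k + l - 2) / (cyc_gf k * cyc_gf l)) 
     + fls_X * (cyc_gf_log_deriv l * (of_nat k * (cyc_gf (k - 2) / cyc_gf k)) + cyc_gf_log_deriv k * (of_nat l * (cyc_gf (l - 2) / cyc_gf l)))
     = (1 + fls_X) * (1 - fls_X) ^ 3 * cyc_gf_log_deriv k * cyc_gf_log_deriv l"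
proof -
  have k0: "k \<noteq> 0" "l \<noteq> 0" using assms by auto
  define z y w :: "complex fls" where "z = fls_X" and "y = fls_X ^ k" and "w = fls_X ^ l"
  have z: "z \<noteq> 0" "1 - z \<noteq> 0" "1 - y \<noteq> 0" "1 - w \<noteq> 0" 
    using one_minus_fls_X_power_nonzero[OF k0(1), where 'a = complex] one_minus_fls_X_nonzero[where 'a = complex]
      one_minus_fls_X_power_nonzero[OF k0(2), where 'a = complex] by (auto simp: z_def y_def w_def)
  have "(1 - z) ^ 2 * (z ^ 2 - y * w) / (z ^ 2 * (1 - y) * (1 - w)) 
     + z * ((z - w) / (z * (1 - z) * (1 - w)) * ((1 - z) ^ 2 * (z ^ 2 - y) / (z ^ 2 * (1 - y)))
          + (z - y) / (z * (1 - z) * (1 - y)) * ((1 - z) ^ 2 * (z ^ 2 - w) / (z ^ 2 * (1 - w))))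
     = (1 + z) * (1 - z) ^ 3 * ((z - y) / (z * (1 - z) * (1 - y))) * ((z - w) / (z * (1 - z) * (1 - w)))"
    using z by (simp add: divide_simps) (simp add: algebra_simps power2_eq_square power3_eq_cube)
  hence "of_nat k * of_nat l * ((1 - z) ^ 2 * (z ^ 2 - y * w) / (z ^ 2 * (1 - y) * (1 - w)) 
     + z * ((z - w) / (z * (1 - z) * (1 - w)) * ((1 - z) ^ 2 * (z ^ 2 - y) / (z ^ 2 * (1 - y)))
          + (z - y) / (z * (1 - z) * (1 - y)) * ((1 - z) ^ 2 * (z ^ 2 - w) / (z ^ 2 * (1 - w)))))
     = of_nat k * of_nat l * ((1 + z) * (1 - z) ^ 3 * ((z - y) / (z * (1 - z) * (1 - y))) * ((z - w) / (z * (1 - z) * (1 - w))))"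
    by (simp only:)
  thus ?thesis unfolding cyc_gf_ratio2[OF assms(1)] cyc_gf_ratio2[OF assms(2)] cyc_gf_ratio_merge2[OF k0] cyc_gf_log_deriv_def z_def y_def w_def
    by (simp only: distrib_left mult.assoc times_divide_eq_left times_divide_eq_right mult.left_commute)
qed

text \<open>Both pieces lose a point, which accounts for (1 - z)^2. Now both exponents run through
  0, ..., k - 2, so the two geometric sums agree and 2 replaces 1 + z.\<close>

lemma cyc_gf_split2:
  assumes "k \<ge> 2"
  shows "(\<Sum>i=1..<k. cyc_gf (i - 1) * cyc_gf (k - 1 - i) / cyc_gf k) = (1 - fls_X) ^ 2 / (1 - fls_X ^ k) *
    (of_nat (k - 1) * (1 + fls_X ^ (k - 2)) - 2 * (1 - fls_X ^ (k - 1)) / (1 - fls_X))"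
proof -
  obtain l where l: "k = Suc l" "l \<noteq> 0" using assms by (cases k) auto
  have k0: "k \<noteq> 0" using l by simp
  have nz: "1 - fls_X \<noteq> (0 :: complex fls)" by (rule one_minus_fls_X_nonzero)
  note nzk = one_minus_fls_X_power_nonzero[OF k0, where 'a = complex]
  have geo: "(\<Sum>i<l. fls_X ^ i) = (1 - fls_X ^ l) / (1 - fls_X :: complex fls)"
    using sum_gp_strict[of "fls_X :: complex fls" l] nz by auto
  have "(\<Sum>i=1..<k. cyc_gf (i - 1) * cyc_gf (k - 1 - i) / cyc_gf k) = (\<Sum>i<l. cyc_gf i * cyc_gf (l - Suc i) / cyc_gf k)"
    unfolding l by (rule sum.reindex_bij_witness[of _ Suc "\<lambda>i. i - 1"]) auto
  also have "\<dots> = (\<Sum>i<l. (1 - fls_X) ^ 2 / (1 - fls_X ^ k) * (1 + fls_X ^ (k - 2) - fls_X ^ i - fls_X ^ (l - Suc i)))"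
  proof (rule sum.cong)
    fix i assume "i \<in> {..<l}"
    define j where "j = l - Suc i"
    have k: "k = Suc (Suc (i + j))" using l \<open>i \<in> {..<l}\<close> by (simp add: j_def)
    have "cyc_gf i * cyc_gf j / cyc_gf k = (1 - fls_X) ^ 2 / (1 - fls_X ^ k) * ((1 - fls_X ^ i) * (1 - fls_X ^ j))"
      using nz nzk by (simp add: cyc_gf_def k power_add power2_eq_square divide_simps)
    also have "fls_X ^ (k - 2) = fls_X ^ i * (fls_X ^ j :: complex fls)"
      by (simp add: k power_add)
    hence "(1 - fls_X ^ i) * (1 - fls_X ^ j) = 1 + fls_X ^ (k - 2) - fls_X ^ i - (fls_X ^ j :: complex fls)"
      by (simp add: algebra_simps)
    finally show "cyc_gf i * cyc_gf (l - Suc i) / cyc_gf k = (1 - fls_X) ^ 2 / (1 - fls_X ^ k) * (1 + fls_X ^ (k - 2) - fls_X ^ i - fls_X ^ (l - Suc i))"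
      unfolding j_def .
  qed simp
  also have "\<dots> = (1 - fls_X) ^ 2 / (1 - fls_X ^ k) * (of_nat l * (1 + fls_X ^ (k - 2)) - (\<Sum>i<l. fls_X ^ i) - (\<Sum>i<l. fls_X ^ (l - Suc i)))"
    unfolding sum_distrib_left[symmetric] by (simp add: sum_subtractf)
  also have "(\<Sum>i<l. fls_X ^ (l - Suc i)) = (\<Sum>i<l. fls_X ^ i :: complex fls)"
    by (rule sum.nat_diff_reindex)
  finally show ?thesis unfolding geo using l by (simp add: algebra_simps)
qed

lemma single_identity2_aux:
  fixes z y k :: "'a :: field"
  assumes "z \<noteq> 0" "1 - z \<noteq> 0" "1 - y \<noteq> 0"
  shows "k * ((1 - z) ^ 2 / (1 - y) * ((k - 1) * (1 + y / z ^ 2) - 2 * (1 - y / z) / (1 - z))) +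
    2 * (k * ((1 - z) ^ 2 * (z ^ 2 - y) / (z ^ 2 * (1 - y))) * (1 + z) / (1 - z) +
    z * (k * (((1 - z) ^ 2 * (2 * z - k * y / z) - 2 * (1 - z) * (z ^ 2 - y)) * (z ^ 2 * (1 - y)) 
        - (1 - z) ^ 2 * (z ^ 2 - y) * (2 * z * (1 - y) - z ^ 2 * (k * y / z))) / (z ^ 2 * (1 - y)) ^ 2) +
    z * (k * (z - y) / (z * (1 - z) * (1 - y))) * (k * ((1 - z) ^ 2 * (z ^ 2 - y) / (z ^ 2 * (1 - y))))) =
    (1 + z) * (1 - z) ^ 2 * ((1 - z) * ((k * (z - y) / (z * (1 - z) * (1 - y))) ^ 2
       + k * ((1 - k * y / z) * (z * (1 - z) * (1 - y)) - (z - y) * ((1 - 2 * z) * (1 - y) - z * (1 - z) * (k * y / z))) / (z * (1 - z) * (1 - y)) ^ 2)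
       - 2 * (k * (z - y) / (z * (1 - z) * (1 - y))))"
proof -
  \<comment> \<open>Both z^(k-1) and z^(k-2) occur now; t stands for the smaller power, so that
    neither leaves a quotient.\<close>
  define t where "t = y / z ^ 2"
  have y: "y = t * z ^ 2" using assms by (simp add: t_def)
  have 1: "z - t * z ^ 2 = z * (1 - t * z)" "z ^ 2 - t * z ^ 2 = z ^ 2 * (1 - t)" "t * z ^ 2 / z = t * z" 
    "k * (t * z ^ 2) / z = k * t * z" "t * z ^ 2 / z ^ 2 = t"
    using assms(1) by (simp_all add: algebra_simps power2_eq_square)
  have tz: "1 - t * z ^ 2 \<noteq> 0" using assms y by simp
  show ?thesis using assms(1,2) tz unfolding y 1
    by (simp add: divide_simps) (simp add: algebra_simps power2_eq_square power3_eq_cube power4_eq_xxxx)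
qed

text \<open>With m = f'/f for f = \<open>cyc_gf k\<close>, the bracket on the right is ((1 - z) f)''
  / f: m^2 + m' is f''/f, and -2 m comes from differentiating 1 - z. This is where the second
  derivative appears.\<close>

lemma single_identity2:
  assumes k2: "k \<ge> 2"
  defines "r \<equiv> of_nat k * (cyc_gf (k - 2) / cyc_gf k)"
  shows "of_nat k * (\<Sum>i=1..<k. cyc_gf (i - 1) * cyc_gf (k - 1 - i) / cyc_gf k) + 2 * (r * (1 + fls_X) / (1 - fls_X)
     + fls_X * fls_deriv r + fls_X * cyc_gf_log_deriv k * r)
     = (1 + fls_X) * (1 - fls_X) ^ 2 * ((1 - fls_X) * (cyc_gf_log_deriv k ^ 2 + fls_deriv (cyc_gf_log_deriv k)) - 2 * cyc_gf_log_deriv k)"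
proof -
  have k0: "k \<noteq> 0" using assms by simp
  define z y :: "complex fls" where "z = fls_X" and "y = fls_X ^ k"
  define K :: "complex fls" where "K = of_nat k"
  have z: "z \<noteq> 0" "1 - z \<noteq> 0" "1 - y \<noteq> 0" 
    using one_minus_fls_X_power_nonzero[OF k0, where 'a = complex] one_minus_fls_X_nonzero[where 'a = complex]
     by (auto simp: z_def y_def)
  have Dy: "fls_deriv y = K * y / z" by (simp add: y_def z_def K_def fls_deriv_X_power')
  have Dz: "fls_deriv z = 1" by (simp add: z_def)
  have DK: "fls_deriv K = 0" by (simp add: K_def)
  have yk: "fls_X ^ (k - 1) = y / z" "fls_X ^ (k - 2) = y / z ^ 2" "of_nat (k - 1) = (K - 1 :: complex fls)" 
    using k2 by (auto simp: y_def z_def power_diff of_nat_diff K_def)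
  have r: "r = K * ((1 - z) ^ 2 * (z ^ 2 - y) / (z ^ 2 * (1 - y)))"
    unfolding r_def cyc_gf_ratio2[OF k2] by (simp add: z_def y_def K_def)
  have Dr: "fls_deriv r = K * (((1 - z) ^ 2 * (2 * z - K * y / z) - 2 * (1 - z) * (z ^ 2 - y)) * (z ^ 2 * (1 - y)) 
        - (1 - z) ^ 2 * (z ^ 2 - y) * (2 * z * (1 - y) - z ^ 2 * (K * y / z))) / (z ^ 2 * (1 - y)) ^ 2"
  proof -
    have "fls_deriv ((1 - z) ^ 2 * (z ^ 2 - y)) = (1 - z) ^ 2 * (2 * z - K * y / z) - 2 * (1 - z) * (z ^ 2 - y)"
      by (simp add: fls_deriv_power Dz Dy) (simp add: algebra_simps)
    moreover have "fls_deriv (z ^ 2 * (1 - y)) = 2 * z * (1 - y) - z ^ 2 * (K * y / z)"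
      by (simp add: fls_deriv_power Dz Dy)
    ultimately show ?thesis unfolding r fls_deriv_mult DK using z by (subst fls_deriv_divide) simp_all
  qed
  have m: "cyc_gf_log_deriv k = K * (z - y) / (z * (1 - z) * (1 - y))" by (simp add: cyc_gf_log_deriv_def z_def y_def K_def)
  have Dm: "fls_deriv (cyc_gf_log_deriv k) = K * ((1 - K * y / z) * (z * (1 - z) * (1 - y)) - (z - y) * ((1 - 2 * z) * (1 - y) - z * (1 - z) * (K * y / z))) / (z * (1 - z) * (1 - y)) ^ 2"
  proof -
    have e: "cyc_gf_log_deriv k = K * ((z - y) / (z * (1 - z) * (1 - y)))" by (simp add: m)
    have a: "fls_deriv (z - y) = 1 - K * y / z" by (simp add: Dz Dy)
    have "z * (1 - z) * - c + (z * (0 - 1) + 1 * (1 - z)) * (1 - y) = (1 - 2 * z) * (1 - y) - z * (1 - z) * c" for c :: "complex fls"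
      by (simp add: algebra_simps)
    from this[of "K * y / z"]
    have b: "fls_deriv (z * (1 - z) * (1 - y)) = (1 - 2 * z) * (1 - y) - z * (1 - z) * (K * y / z)"
      unfolding fls_deriv_mult fls_deriv_sub Dz Dy fls_deriv_one by simp
    show ?thesis unfolding e fls_deriv_mult DK using z a b by (subst fls_deriv_divide) simp_all
  qed
  show ?thesis
    unfolding cyc_gf_split2[OF k2] yk Dm Dr unfolding m 
    unfolding r y_def[symmetric] K_def[symmetric] unfolding z_def[symmetric]
    using single_identity2_aux[OF z, of K] by (simp only: mult.assoc)
qed

text \<open>Let M be the sum of the logarithmic derivatives m. Then P''/P = M^2 + M', and
  \<open>cross_identity2\<close> supplies the mixed products in M^2, \<open>single_identity2\<close>
  the squares, M' and -2 M. The common factor (1 + z)(1 - z)^2 meets W = z / (1 - z)^2 and leaves z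
  (1 + z).\<close>

lemma sum_pairs_identity2:
  fixes S :: "'a set set"
  assumes fin: "finite S" and pos: "\<And>C. C \<in> S \<Longrightarrow> card C \<ge> 2"
  defines "W \<equiv> fls_X / (1 - fls_X) ^ 2 :: complex fls"
  defines "P \<equiv> cycles_gf S"
  shows "(\<Sum>C\<in>S. \<Sum>C'\<in>S - {C}. of_nat (card C) * of_nat (card C') *
            (W * P * (cyc_gf (card C + card C' - 2) / (cyc_gf (card C) * cyc_gf (card C')))))
       + (\<Sum>C\<in>S. of_nat (card C) * (\<Sum>i=1..<card C. W * P * (cyc_gf (i - 1) * cyc_gf (card C - 1 - i) / cyc_gf (card C)))
            + 2 * theta (W * P * (of_nat (card C) * (cyc_gf (card C - 2) / cyc_gf (card C)))))
      = fls_X * (1 + fls_X) * fls_deriv (fls_deriv ((1 - fls_X) * P))"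
proof -
  define k where "k = (\<lambda>C :: 'a set. of_nat (card C) :: complex fls)"
  define v where "v = (\<lambda>(C :: 'a set) (C' :: 'a set). cyc_gf (card C + card C' - 2) / (cyc_gf (card C) * cyc_gf (card C')))"
  define r where "r = (\<lambda>C :: 'a set. k C * (cyc_gf (card C - 2) / cyc_gf (card C)))"
  define s where "s = (\<lambda>C :: 'a set. k C * (\<Sum>i=1..<card C. cyc_gf (i - 1) * cyc_gf (card C - 1 - i) / cyc_gf (card C)))"
  define m where "m = (\<lambda>C :: 'a set. cyc_gf_log_deriv (card C))"
  define q :: "complex fls" where "q = (1 + fls_X) / (1 - fls_X)"
  define c :: "complex fls" where "c = (1 + fls_X) * (1 - fls_X) ^ 2"
  define M where "M = (\<Sum>C\<in>S. m C)"
  define R where "R = (\<Sum>C\<in>S. r C)"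
  have nz: "1 - fls_X \<noteq> (0 :: complex fls)" by (rule one_minus_fls_X_nonzero)
  have DW: "fls_X * fls_deriv W = W * q" unfolding W_def q_def by (rule theta_base_gf)
  have pos0: "card C \<noteq> 0" if "C \<in> S" for C using pos[OF that] by simp
  have DP: "fls_deriv P = P * M"
    unfolding P_def cycles_gf_def m_def M_def by (rule fls_deriv_prod_cyc_gf[OF fin pos0])
  have th: "theta (W * P * r C) = W * P * (r C * q + fls_X * fls_deriv (r C) + fls_X * M * r C)" for C
    unfolding theta_def fls_deriv_mult DP
    using DW by (simp add: algebra_simps) 
  have single: "s C + 2 * (r C * q + fls_X * fls_deriv (r C) + fls_X * m C * r C) = c * ((1 - fls_X) * (m C ^ 2 + fls_deriv (m C)) - 2 * m C)" if "C \<in> S" for C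
    using single_identity2[OF pos[OF that]] unfolding s_def r_def k_def m_def q_def c_def by simp
  have cross: "k C * k C' * v C C' = c * (1 - fls_X) * m C * m C' - fls_X * (m C' * r C + m C * r C')" if "C \<in> S" "C' \<in> S" for C C'
    using cross_identity2[OF pos[OF that(1)] pos[OF that(2)]] unfolding r_def k_def m_def v_def c_def
    by (simp add: algebra_simps power2_eq_square power3_eq_cube)
  have "(\<Sum>C\<in>S. \<Sum>C'\<in>S - {C}. k C * k C' * (W * P * v C C'))
       + (\<Sum>C\<in>S. k C * (\<Sum>i=1..<card C. W * P * (cyc_gf (i - 1) * cyc_gf (card C - 1 - i) / cyc_gf (card C)))
            + 2 * theta (W * P * r C))
      = W * P * ((\<Sum>C\<in>S. (\<Sum>C'\<in>S - {C}. k C * k C' * v C C')) + 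
           (\<Sum>C\<in>S. s C + 2 * (r C * q + fls_X * fls_deriv (r C) + fls_X * M * r C)))"
    unfolding th s_def sum_distrib_left sum.distrib distrib_left by (simp add: algebra_simps)
  also have "(\<Sum>C\<in>S. (\<Sum>C'\<in>S - {C}. k C * k C' * v C C')) = 
     c * (1 - fls_X) * M * M - 2 * fls_X * M * R - (\<Sum>C\<in>S. c * (1 - fls_X) * m C ^ 2 - 2 * fls_X * m C * r C)"
  proof -
    have "(\<Sum>C\<in>S. (\<Sum>C'\<in>S - {C}. k C * k C' * v C C')) = (\<Sum>C\<in>S. (\<Sum>C'\<in>S. k C * k C' * v C C') - k C * k C * v C C)"
      by (intro sum.cong refl) (simp add: sum.remove[OF fin])
    also have "\<dots> = (\<Sum>C\<in>S. (\<Sum>C'\<in>S. c * (1 - fls_X) * m C * m C' - fls_X * (m C' * r C + m C * r C')) - 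
        (c * (1 - fls_X) * m C ^ 2 - 2 * fls_X * m C * r C))"
    proof (rule sum.cong)
      fix C assume C: "C \<in> S"
      \<comment> \<open>\<open>v C C\<close> belongs to no merge. The algebraic identity is used on
        the diagonal as well, because the double sum factors only when the diagonal is filled in and
        then subtracted.\<close>
      have "k C * k C * v C C = c * (1 - fls_X) * m C ^ 2 - 2 * fls_X * m C * r C"
        unfolding cross[OF C C] by (simp add: power2_eq_square algebra_simps)
      thus "(\<Sum>C'\<in>S. k C * k C' * v C C') - k C * k C * v C C = (\<Sum>C'\<in>S. c * (1 - fls_X) * m C * m C' - fls_X * (m C' * r C + m C * r C')) - 
        (c * (1 - fls_X) * m C ^ 2 - 2 * fls_X * m C * r C)"
        using cross[OF C] by simp
    qed simp
    also have "\<dots> = (\<Sum>C\<in>S. \<Sum>C'\<in>S. c * (1 - fls_X) * m C * m C' - fls_X * (m C' * r C + m C * r C')) - 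
        (\<Sum>C\<in>S. c * (1 - fls_X) * m C ^ 2 - 2 * fls_X * m C * r C)"
      by (simp add: sum_subtractf)
    also have "(\<Sum>C\<in>S. \<Sum>C'\<in>S. c * (1 - fls_X) * m C * m C' - fls_X * (m C' * r C + m C * r C')) =
       (\<Sum>C\<in>S. c * (1 - fls_X) * m C * M - fls_X * (M * r C + m C * R))"
      unfolding M_def R_def sum_subtractf sum.distrib sum_distrib_left sum_distrib_right distrib_left ..
    also have "\<dots> = c * (1 - fls_X) * M * M - 2 * fls_X * M * R"
    proof -
      have "(\<Sum>C\<in>S. c * (1 - fls_X) * m C * M - fls_X * (M * r C + m C * R)) = (\<Sum>C\<in>S. m C * (c * (1 - fls_X) * M - fls_X * R) - fls_X * M * r C)"
        by (simp add: algebra_simps)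
      also have "\<dots> = M * (c * (1 - fls_X) * M - fls_X * R) - fls_X * M * R"
        unfolding sum_subtractf by (simp only: sum_distrib_left[symmetric] sum_distrib_right[symmetric] M_def[symmetric] R_def[symmetric])
      finally show ?thesis by (simp add: algebra_simps)
    qed
    finally show ?thesis .
  qed
  also have "(\<Sum>C\<in>S. s C + 2 * (r C * q + fls_X * fls_deriv (r C) + fls_X * M * r C)) = 
      (\<Sum>C\<in>S. c * ((1 - fls_X) * (m C ^ 2 + fls_deriv (m C)) - 2 * m C) - 2 * fls_X * m C * r C) + 2 * fls_X * M * R"
  proof -
    have "s C + 2 * (r C * q + fls_X * fls_deriv (r C) + fls_X * M * r C) = 
      (c * ((1 - fls_X) * (m C ^ 2 + fls_deriv (m C)) - 2 * m C) - 2 * fls_X * m C * r C) + 2 * fls_X * M * r C" if "C \<in> S" for C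
      using single[OF that] by (simp add: algebra_simps)
    hence "(\<Sum>C\<in>S. s C + 2 * (r C * q + fls_X * fls_deriv (r C) + fls_X * M * r C)) = 
      (\<Sum>C\<in>S. (c * ((1 - fls_X) * (m C ^ 2 + fls_deriv (m C)) - 2 * m C) - 2 * fls_X * m C * r C) + 2 * fls_X * M * r C)"
      by (rule sum.cong[OF refl])
    thus ?thesis unfolding sum.distrib[of _ "\<lambda>C. 2 * fls_X * M * r C"] sum_distrib_left[symmetric] R_def .
  qed
  also have "c * (1 - fls_X) * M * M - 2 * fls_X * M * R - (\<Sum>C\<in>S. c * (1 - fls_X) * m C ^ 2 - 2 * fls_X * m C * r C)
     + ((\<Sum>C\<in>S. c * ((1 - fls_X) * (m C ^ 2 + fls_deriv (m C)) - 2 * m C) - 2 * fls_X * m C * r C) + 2 * fls_X * M * R) =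
     c * (1 - fls_X) * M * M + (\<Sum>C\<in>S. c * (1 - fls_X) * fls_deriv (m C) - 2 * c * m C)"
    by (simp add: sum_subtractf sum.distrib algebra_simps)
  also have "(\<Sum>C\<in>S. c * (1 - fls_X) * fls_deriv (m C) - 2 * c * m C) = c * (1 - fls_X) * fls_deriv M - 2 * c * M"
    by (simp add: sum_subtractf M_def fls_deriv_sum sum_distrib_left)
  also have "W * P * (c * (1 - fls_X) * M * M + (c * (1 - fls_X) * fls_deriv M - 2 * c * M)) = 
      fls_X * (1 + fls_X) * fls_deriv (fls_deriv ((1 - fls_X) * P))"
  proof -
    have Wc: "W * c = fls_X * (1 + fls_X)" using nz by (simp add: W_def c_def)
    have "fls_deriv ((1 - fls_X) * P) = P * ((1 - fls_X) * M - 1)"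
      by (simp add: DP algebra_simps)
    hence "fls_deriv (fls_deriv ((1 - fls_X) * P)) = P * ((1 - fls_X) * M * M + (1 - fls_X) * fls_deriv M - 2 * M)"
      by (simp add: DP algebra_simps)
    moreover have "W * P * (c * (1 - fls_X) * M * M + (c * (1 - fls_X) * fls_deriv M - 2 * c * M)) = 
       (W * c) * (P * ((1 - fls_X) * M * M + (1 - fls_X) * fls_deriv M - 2 * M))"
      by (simp add: algebra_simps)
    ultimately show ?thesis unfolding Wc by simp
  qed
  finally show ?thesis unfolding k_def v_def r_def by (simp add: mult.assoc)
qed

section \<open>Stanley's formula\<close>

definition base_gf :: "complex fls" where
  "base_gf = fls_X / (1 - fls_X) ^ 2"

lemma power_gf_1: "power_gf 1 = base_gf"
proof -
  have nz: "1 - fls_X \<noteq> (0 :: complex fls)" by (rule one_minus_fls_X_nonzero)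
  have "Abs_fps (\<lambda>N. 1 :: complex) * (1 - fps_X) = 1"
    by (rule fps_ext) (auto simp: algebra_simps)
  hence "fps_to_fls (Abs_fps (\<lambda>N. 1 :: complex) * (1 - fps_X)) = 1" by simp
  hence "power_gf 0 * (1 - fls_X) = 1" unfolding power_gf_def fls_times_fps_to_fls by simp
  hence "power_gf 0 = 1 / (1 - fls_X)" using nz by (simp add: eq_divide_eq)
  hence "power_gf 1 = theta (1 / (1 - fls_X))" using power_gf_Suc[of 0] by simp
  also have "\<dots> = base_gf" unfolding theta_def using nz by (subst fls_deriv_divide) (simp_all add: base_gf_def)
  finally show ?thesis .
qed

lemma theta_of_nat: "theta (of_nat k * f) = of_nat k * theta f"
  by (simp add: theta_def mult.left_commute)

lemma cycles_gf_insert: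
  assumes "finite S" "C \<notin> S"
  shows "cycles_gf (insert C S) = cyc_gf (card C) * cycles_gf S"
  using assms by (simp add: cycles_gf_def)

text \<open>The formula on the smaller set is a hypothesis because this step serves both inside the
  induction that proves Stanley's formula and after it.\<close>

lemma sum_power_gf_remove_eq:
  assumes "finite A" "q permutes A" "a \<in> A"
    and IH: "\<And>p. p permutes (A - {a}) \<Longrightarrow> long_cycle_sum (A - {a}) p = c * base_gf * cycles_gf (cyc (A - {a}) p)"
  shows "(\<Sum>ys\<in>permutations_of_set (A - {a}). power_gf (card (cyc A (cycle_of_list ys \<circ> q)))) =
    (if card (orbit q a) = 1 then theta (c * base_gf * cycles_gf (cyc A q - {orbit q a}))
     else c * base_gf * (cycles_gf (cyc A q - {orbit q a}) * cyc_gf (card (orbit q a) - 1)))"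
proof (cases "q a = a")
  case True
  note f = cyc_fixed[OF assms(1-3) True]
  show ?thesis unfolding long_cycle_sum_remove[OF assms(1-3)] using True IH[OF f(1)] unfolding f(2,4) by simp
next
  case False
  note r = orbit_remove[OF assms(1-3) False]
  have "long_cycle_sum (A - {a}) (q \<circ> transpose a (inv q a)) = c * base_gf * (cycles_gf (cyc A q - {orbit q a}) * cyc_gf (card (orbit q a) - 1))"
    unfolding IH[OF r(1)] r(3) using assms(1) r(4,5) by (simp add: cycles_gf_insert)
  thus ?thesis unfolding long_cycle_sum_remove[OF assms(1-3)] using False r(6) by simp
qed

lemma cycles_gf_remove2:
  assumes "finite S" "C \<in> S" "D \<in> S" "C \<noteq> D" "card C \<noteq> 0" "card D \<noteq> 0"
  shows "cycles_gf (S - {C, D}) = cycles_gf S / (cyc_gf (card C) * cyc_gf (card D))"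
proof -
  have "S - {C, D} = (S - {C}) - {D}" by auto
  thus ?thesis using assms by (simp add: cycles_gf_remove)
qed

text \<open>Averaged over the orderings, the series is z prod (1 - z^k) / (1 - z)^(n+2) with k
  running over the cycle lengths of p. The recursion expresses n - 1 times the sum by merges and
  splits on n - 1 points; by \<open>sum_pairs_identity1\<close> they contribute n (n - 1) (n - 1)!
  times this series, which is (n - 1) n! times it.\<close>

theorem long_cycle_sum_eq:
  assumes "finite A" "p permutes A" "A \<noteq> {}"
  shows "long_cycle_sum A p = fact (card A) * base_gf * cycles_gf (cyc A p)"
  using assms
proof (induction "card A" arbitrary: A p rule: less_induct)
  case (less A p)
  note fin = less.prems(1) and perm = less.prems(2)
  have permn: "permutation p" using fin perm by (rule permutes_permutation)
  show ?case
  proof (cases "card A = 1")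
    case True
    then obtain a where A: "A = {a}" by (auto simp: card_1_singleton_iff)
    have "p a = a" using permutes_in_image[OF perm, of a] A by simp
    hence "orbit p a = {a}" by (simp add: orbit_eq_singleton_iff)
    hence c: "cyc A p = {{a}}" by (simp add: cyc_def A)
    have "cyc_gf 1 = 1" using one_minus_fls_X_nonzero[where 'a = complex] by (simp add: cyc_gf_def)
    thus ?thesis using power_gf_1 c by (simp add: long_cycle_sum_def cycles_gf_def A)
  next
    case False
    moreover have "card A \<noteq> 0" using less.prems by simp
    ultimately have m2: "card A \<ge> 2" by linarith
    define c :: "complex fls" where "c = fact (card A - 1)"
    define S where "S = cyc A p"
    define P where "P = cycles_gf S"
    have finS: "finite S" using fin by (simp add: S_def)
    have posS: "card C \<noteq> 0" if "C \<in> S" for C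
      using card_cyc_pos(2)[OF fin perm, of C] that by (simp add: S_def)
    have IH: "long_cycle_sum (A - {a}) q = c * base_gf * cycles_gf (cyc (A - {a}) q)" if "a \<in> A" "q permutes (A - {a})" for a q
    proof -
      have "card (A - {a}) = card A - 1" using that fin by simp
      moreover have "A - {a} \<noteq> {}" using \<open>card (A - {a}) = _\<close> m2 by force
      ultimately show ?thesis using less.hyps[of "A - {a}" q] that fin m2 by (simp add: c_def)
    qed
    define F where "F = (\<lambda>a b. \<Sum>ys\<in>permutations_of_set (A - {a}). power_gf (card (cyc A (cycle_of_list ys \<circ> (p \<circ> transpose a b)))))"
    have Feq: "F a b = (if card (orbit q a) = 1 then theta (c * base_gf * cycles_gf (cyc A q - {orbit q a}))
         else c * base_gf * (cycles_gf (cyc A q - {orbit q a}) * cyc_gf (card (orbit q a) - 1)))"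
      if "a \<in> A" "b \<in> A" "q = p \<circ> transpose a b" for a b q
    proof -
      have "q permutes A" using that perm by (simp add: permutes_compose permutes_swap_id)
      thus ?thesis unfolding F_def that(3)[symmetric] by (intro sum_power_gf_remove_eq fin that(1) IH)
    qed
    have pos_orb: "card (orbit p a) \<noteq> 0" "orbit p a \<in> S" if "a \<in> A" for a
      using posS that by (auto simp: S_def cyc_def)
    have "of_nat (card A - 1) * long_cycle_sum A p = (\<Sum>a\<in>A. \<Sum>b\<in>A - {a}. F a b)"
      unfolding F_def by (rule long_cycle_sum_rec[OF fin perm m2])
    also have "\<dots> = (\<Sum>C\<in>S. \<Sum>C'\<in>S - {C}. of_nat (card C) * of_nat (card C') * 
          (c * (base_gf * P * (cyc_gf (card C + card C' - 1) / (cyc_gf (card C) * cyc_gf (card C'))))))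
     + (\<Sum>C\<in>S. of_nat (card C) * (\<Sum>i=1..<card C. 
           if i = card C - 1 then theta (c * (base_gf * P * (cyc_gf (card C - 1) / cyc_gf (card C))))
           else c * (base_gf * P * (cyc_gf i * cyc_gf (card C - 1 - i) / cyc_gf (card C)))))"
      unfolding S_def
    proof (rule sum_pairs_cyc[OF fin perm])
      fix a b assume ab: "a \<in> A" "b \<in> A" "orbit p a \<noteq> orbit p b"
      note mg = cyc_merge[OF fin perm ab]
      have disj: "orbit p a \<inter> orbit p b = {}" by (rule orbit_disjoint[OF permn ab(3)])
      have crd: "card (orbit p a \<union> orbit p b) = card (orbit p a) + card (orbit p b)"
        using pos_orb[OF ab(1)] pos_orb[OF ab(2)] disj by (intro card_Un_disjoint) (auto intro: card_ge_0_finite)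
      have "cyc A (p \<circ> transpose a b) - {orbit p a \<union> orbit p b} = S - {orbit p a, orbit p b}"
        using mg(3,4) by (auto simp: S_def)
      hence "F a b = c * base_gf * (cycles_gf (S - {orbit p a, orbit p b}) * cyc_gf (card (orbit p a) + card (orbit p b) - 1))"
        unfolding Feq[OF ab(1,2) refl] mg(1) crd using pos_orb[OF ab(1)] pos_orb[OF ab(2)] by simp
      also have "cycles_gf (S - {orbit p a, orbit p b}) = P / (cyc_gf (card (orbit p a)) * cyc_gf (card (orbit p b)))"
        unfolding P_def using pos_orb[OF ab(1)] pos_orb[OF ab(2)] ab(3) finS by (intro cycles_gf_remove2)
      finally show "F a b = c * (base_gf * P * (cyc_gf (card (orbit p a) + card (orbit p b) - 1) / (cyc_gf (card (orbit p a)) * cyc_gf (card (orbit p b)))))"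
        by simp
    next
      fix a i assume a: "a \<in> A" and i: "0 < i" "i < card (orbit p a)"
      define q where "q = p \<circ> transpose a ((p ^^ i) a)"
      define k where "k = card (orbit p a)"
      note sp = cyc_split[OF fin perm a i, folded q_def, folded k_def]
      have ne: "orbit q a \<noteq> orbit q ((p ^^ i) a)" using sp(6) orbit_nonempty[of q] by auto
      have "cyc A q - {orbit q a} = insert (orbit q ((p ^^ i) a)) (S - {orbit p a})"
        using sp(7,8) ne by (auto simp: S_def)
      hence Pi: "cycles_gf (cyc A q - {orbit q a}) = cyc_gf i * (P / cyc_gf k)"
        using sp(9,3) finS pos_orb[OF a] by (simp add: cycles_gf_insert S_def[symmetric] cycles_gf_remove P_def k_def)
      have "F a ((p ^^ i) a) = (if k - i = 1 then theta (c * base_gf * (cyc_gf i * (P / cyc_gf k))) else c * base_gf * (cyc_gf i * (P / cyc_gf k) * cyc_gf (k - i - 1)))"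
        unfolding Feq[OF a sp(2) q_def] Pi sp(4) ..
      also have "\<dots> = (if i = k - 1 then theta (c * (base_gf * P * (cyc_gf (k - 1) / cyc_gf k))) else c * (base_gf * P * (cyc_gf i * cyc_gf (k - 1 - i) / cyc_gf k)))"
        using i by (auto simp: k_def[symmetric] mult_ac diff_commute)
      finally show "F a ((p ^^ i) a) = (if i = card (orbit p a) - 1 then theta (c * (base_gf * P * (cyc_gf (card (orbit p a) - 1) / cyc_gf (card (orbit p a))))) 
        else c * (base_gf * P * (cyc_gf i * cyc_gf (card (orbit p a) - 1 - i) / cyc_gf (card (orbit p a)))))"
        unfolding k_def .
    qed
    also have "(\<Sum>C\<in>S. of_nat (card C) * (\<Sum>i=1..<card C. 
           if i = card C - 1 then theta (c * (base_gf * P * (cyc_gf (card C - 1) / cyc_gf (card C))))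
           else c * (base_gf * P * (cyc_gf i * cyc_gf (card C - 1 - i) / cyc_gf (card C))))) = 
       (\<Sum>C\<in>S. c * (of_nat (card C) * (\<Sum>i=1..<card C. base_gf * P * (cyc_gf i * cyc_gf (card C - 1 - i) / cyc_gf (card C)))
            + theta (base_gf * P * (of_nat (card C) * (cyc_gf (card C - 1) / cyc_gf (card C))))))"
    proof (rule sum.cong)
      fix C assume "C \<in> S"
      define k where "k = card C"
      have k0: "k \<noteq> 0" using posS[OF \<open>C \<in> S\<close>] by (simp add: k_def)
      have thc: "theta (c * f) = c * theta f" for f
        unfolding c_def using theta_of_nat[of "fact (card A - 1)"] by simp
      \<comment> \<open>At i = k - 1 the split isolates a. The regular summand is zero there, so it
        can be added, and the \<open>theta\<close> term stands beside a complete sum over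
        splits.\<close>
      have "(\<Sum>i=1..<k. if i = k - 1 then theta (c * (base_gf * P * (cyc_gf (k - 1) / cyc_gf k))) else c * (base_gf * P * (cyc_gf i * cyc_gf (k - 1 - i) / cyc_gf k)))
        = (\<Sum>i=1..<k. (if i = k - 1 then theta (c * (base_gf * P * (cyc_gf (k - 1) / cyc_gf k))) else 0) + c * (base_gf * P * (cyc_gf i * cyc_gf (k - 1 - i) / cyc_gf k)))"
        by (intro sum.cong) auto
      also have "\<dots> = (if k \<ge> 2 then theta (c * (base_gf * P * (cyc_gf (k - 1) / cyc_gf k))) else 0) + (\<Sum>i=1..<k. c * (base_gf * P * (cyc_gf i * cyc_gf (k - 1 - i) / cyc_gf k)))"
        unfolding sum.distrib by (subst sum.delta) auto
      \<comment> \<open>A fixed point of p has no split, but for k = 1 the \<open>theta\<close> term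
        is zero as well, since it contains \<open>cyc_gf 0\<close>.\<close>
      also have "(if k \<ge> 2 then theta (c * (base_gf * P * (cyc_gf (k - 1) / cyc_gf k))) else 0) = theta (c * (base_gf * P * (cyc_gf (k - 1) / cyc_gf k)))"
      proof (cases "k \<ge> 2")
        case False
        hence "k = 1" using k0 by simp
        thus ?thesis by (simp add: theta_def)
      qed simp
      finally have E: "(\<Sum>i=1..<k. if i = k - 1 then theta (c * (base_gf * P * (cyc_gf (k - 1) / cyc_gf k))) else c * (base_gf * P * (cyc_gf i * cyc_gf (k - 1 - i) / cyc_gf k))) = 
          theta (c * (base_gf * P * (cyc_gf (k - 1) / cyc_gf k))) + (\<Sum>i=1..<k. c * (base_gf * P * (cyc_gf i * cyc_gf (k - 1 - i) / cyc_gf k)))" .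
      have th2: "theta (base_gf * P * (of_nat k * (cyc_gf (k - 1) / cyc_gf k))) = of_nat k * theta (base_gf * P * (cyc_gf (k - 1) / cyc_gf k))"
        unfolding theta_of_nat[symmetric] by (simp only: mult_ac)
      show "of_nat (card C) * (\<Sum>i=1..<card C. 
           if i = card C - 1 then theta (c * (base_gf * P * (cyc_gf (card C - 1) / cyc_gf (card C))))
           else c * (base_gf * P * (cyc_gf i * cyc_gf (card C - 1 - i) / cyc_gf (card C)))) =
         c * (of_nat (card C) * (\<Sum>i=1..<card C. base_gf * P * (cyc_gf i * cyc_gf (card C - 1 - i) / cyc_gf (card C)))
            + theta (base_gf * P * (of_nat (card C) * (cyc_gf (card C - 1) / cyc_gf (card C)))))"
        unfolding k_def[symmetric] E th2 unfolding thc sum_distrib_left[symmetric]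
        by (simp only: distrib_left mult_ac add_ac)
    qed simp
    also have "(\<Sum>C\<in>S. \<Sum>C'\<in>S - {C}. of_nat (card C) * of_nat (card C') * 
          (c * (base_gf * P * (cyc_gf (card C + card C' - 1) / (cyc_gf (card C) * cyc_gf (card C')))))) = 
        c * (\<Sum>C\<in>S. \<Sum>C'\<in>S - {C}. of_nat (card C) * of_nat (card C') * 
          (base_gf * P * (cyc_gf (card C + card C' - 1) / (cyc_gf (card C) * cyc_gf (card C')))))"
      unfolding sum_distrib_left by (intro sum.cong refl) (simp only: mult_ac)
    also have "c * (\<Sum>C\<in>S. \<Sum>C'\<in>S - {C}. of_nat (card C) * of_nat (card C') * 
          (base_gf * P * (cyc_gf (card C + card C' - 1) / (cyc_gf (card C) * cyc_gf (card C'))))) + 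
         (\<Sum>C\<in>S. c * (of_nat (card C) * (\<Sum>i=1..<card C. base_gf * P * (cyc_gf i * cyc_gf (card C - 1 - i) / cyc_gf (card C)))
            + theta (base_gf * P * (of_nat (card C) * (cyc_gf (card C - 1) / cyc_gf (card C)))))) =
        c * (base_gf * P * of_nat (card A) * (of_nat (card A) - 1))"
      using sum_pairs_identity1[OF finS posS, folded base_gf_def P_def] sum_card_cyc[OF fin perm, folded S_def]
      unfolding sum_distrib_left[symmetric] distrib_left[symmetric] by simp
    also have "\<dots> = of_nat (card A - 1) * (fact (card A) * base_gf * P)"
    proof -
      have "fact (card A) = of_nat (card A) * c" 
        using m2 unfolding c_def by (intro fact_reduce) simp
      thus ?thesis using m2 by (simp add: of_nat_diff mult_ac)
    qed
    finally have "of_nat (card A - 1) * long_cycle_sum A p = of_nat (card A - 1) * (fact (card A) * base_gf * P)" .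
    moreover have "(of_nat (card A - 1) :: complex fls) \<noteq> 0" 
      using m2 by (simp only: of_nat_eq_0_iff)
    ultimately show ?thesis unfolding P_def S_def by (simp only: mult_cancel_left) simp
  qed
qed

section \<open>Products of a transposition and a long cycle\<close>

text \<open>Deletes a and then b. The condition \<open>ord\<close> excludes that b is fixed when a
  was already fixed, and that a 2-cycle (a b) shrinks to a fixed point b; so at most one
  \<open>theta\<close> is applied.\<close>

lemma sum_power_gf_remove2:
  assumes fin: "finite A" and q: "q permutes A" and ab: "a \<in> A" "b \<in> A" "a \<noteq> b" and A2: "card A \<ge> 3"
    and ord: "if orbit q a = orbit q b then card (orbit q a) \<ge> 3 else card (orbit q a) \<ge> 2 \<or> card (orbit q b) \<ge> 2"
  defines "c \<equiv> fact (card A - 2) :: complex fls"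
  shows "(\<Sum>ys\<in>permutations_of_set (A - {a, b}). power_gf (card (cyc A (cycle_of_list ys \<circ> q)))) =
    (if orbit q a = orbit q b then c * base_gf * (cycles_gf (cyc A q - {orbit q a}) * cyc_gf (card (orbit q a) - 2))
     else if card (orbit q a) = 1 then theta (c * base_gf * (cycles_gf (cyc A q - {orbit q a, orbit q b}) * cyc_gf (card (orbit q b) - 1)))
     else if card (orbit q b) = 1 then theta (c * base_gf * (cycles_gf (cyc A q - {orbit q a, orbit q b}) * cyc_gf (card (orbit q a) - 1)))
     else c * base_gf * (cycles_gf (cyc A q - {orbit q a, orbit q b}) * cyc_gf (card (orbit q a) - 1) * cyc_gf (card (orbit q b) - 1)))"
    (is "?lhs = ?rhs")
proof -
  let ?L = "permutations_of_set (A - {a} - {b})"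
  have AL: "A - {a, b} = A - {a} - {b}" by auto
  have permq: "permutation q" using fin q by (rule permutes_permutation)
  have orb: "orbit q a \<in> cyc A q" "orbit q b \<in> cyc A q" using ab by (simp_all add: cyc_def)
  have self: "x \<in> orbit q x" for x using permutation_self_in_orbit[OF permq] .
  have L: "cycle_of_list ys permutes (A - {a})" if "ys \<in> ?L" for ys
    using cycle_of_list_permutes[OF that] by (rule permutes_subset) auto
  have crd: "card (A - {a} - {b}) = card A - 2" using fin ab by simp
  have fin': "finite (A - {a})" using fin by simp
  have bA: "b \<in> A - {a}" using ab by simp
  have IH: "long_cycle_sum (A - {a} - {b}) p = c * base_gf * cycles_gf (cyc (A - {a} - {b}) p)" if "p permutes (A - {a} - {b})" for p
  proof -
    \<comment> \<open>Stanley's formula is for nonempty ground sets, so a third point must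
      exist.\<close>
    have "A - {a} - {b} \<noteq> {}" using crd A2 by (metis card.empty diff_is_0_eq not_less_eq_eq numeral_2_eq_2 numeral_3_eq_3)
    thus ?thesis using long_cycle_sum_eq[OF _ that] fin crd by (simp add: c_def)
  qed
  note step2 = sum_power_gf_remove_eq[OF fin' _ bA IH]
  show ?thesis
  proof (cases "q a = a")
    case True
    note f = cyc_fixed[OF fin q ab(1) True]
    have ob: "orbit q b \<noteq> {a}" using self[of b] ab by auto
    hence "card (orbit q b) \<ge> 2" using ord f(4) by (auto split: if_splits)
    moreover have "cyc A q - {{a}} - {orbit q b} = cyc A q - {{a}, orbit q b}" by auto
    moreover have "?lhs = theta (\<Sum>ys\<in>?L. power_gf (card (cyc (A - {a}) (cycle_of_list ys \<circ> q))))"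
      unfolding AL using sum_power_gf_remove[OF fin q ab(1) L] True by simp
    ultimately show ?thesis using step2[OF f(1)] ob unfolding f(2,4) by simp
  next
    case False
    define q' where "q' = q \<circ> transpose a (inv q a)"
    note r = orbit_remove[OF fin q ab(1) False, folded q'_def]
    have lhs: "?lhs = (if card (orbit q' b) = 1 then theta (c * base_gf * cycles_gf (cyc (A - {a}) q' - {orbit q' b}))
     else c * base_gf * (cycles_gf (cyc (A - {a}) q' - {orbit q' b}) * cyc_gf (card (orbit q' b) - 1)))"
    proof -
      have "?lhs = (\<Sum>ys\<in>?L. power_gf (card (cyc (A - {a}) (cycle_of_list ys \<circ> q'))))"
        unfolding AL using sum_power_gf_remove[OF fin q ab(1) L] False by (simp add: q'_def)
      also have "\<dots> = (if card (orbit q' b) = 1 then theta (c * base_gf * cycles_gf (cyc (A - {a}) q' - {orbit q' b}))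
          else c * base_gf * (cycles_gf (cyc (A - {a}) q' - {orbit q' b}) * cyc_gf (card (orbit q' b) - 1)))"
        by (rule step2[OF r(1)])
      finally show ?thesis .
    qed
    show ?thesis
    proof (cases "orbit q a = orbit q b")
      case True
      have "b \<in> orbit q a" using self[of b] True by simp
      hence ob: "orbit q' b = orbit q a - {a}" using r(7) ab by blast
      have crd1: "card (orbit q' b) = card (orbit q a) - 1" using r(5) ob by simp
      have "cyc (A - {a}) q' - {orbit q' b} = cyc A q - {orbit q a}"
        unfolding r(3) ob using r(4) by auto
      moreover have "card (orbit q a) \<ge> 3" using ord True by simp
      ultimately show ?thesis unfolding lhs crd1 using True by (simp add: numeral_2_eq_2)
    next
      case ne: False
      \<comment> \<open>Deleting a multiplies q by the transposition of a and its predecessor. Both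
        lie on the cycle of a, so the cycle of b is untouched.\<close>
      have "inv q a \<in> orbit q a"
      proof -
        have "q (inv q a) = a" using permutes_bij[OF q] by (simp add: bij_is_surj surj_f_inv_f)
        thus ?thesis using permutation_orbit_step[OF permq, of "inv q a"] self[of "inv q a"] by simp
      qed
      hence oi: "orbit q (inv q a) = orbit q a" using orbit_eq_of_mem[OF permq] by blast
      have "b \<notin> orbit q a" using orbit_eq_of_mem[OF permq, of b a] ne by auto
      hence ob: "orbit q' b = orbit q b" unfolding q'_def using oi by (intro orbit_transpose_other[OF permq]) auto
      have ne2: "orbit q b \<noteq> orbit q a - {a}" using self[of b] \<open>b \<notin> orbit q a\<close> by auto
      have "cyc (A - {a}) q' - {orbit q' b} = insert (orbit q a - {a}) (cyc A q - {orbit q a, orbit q b})"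
        unfolding r(3) ob using ne2 by auto
      hence "cycles_gf (cyc (A - {a}) q' - {orbit q' b}) = cyc_gf (card (orbit q a) - 1) * cycles_gf (cyc A q - {orbit q a, orbit q b})"
        using r(4,5) fin by (simp add: cycles_gf_insert)
      thus ?thesis unfolding lhs ob using ne r(6) by (simp add: mult_ac)
    qed
  qed
qed

text \<open>For cycles of length at least 3 the splits at i = 1 and at i = k - 1 are different; the
  first isolates b, the second a, and none isolates both. For k = 2 both points would become fixed
  at once and \<open>theta\<close> would act twice, which \<open>sum_pairs_identity2\<close> does
  not describe.\<close>

theorem sum_two_cycles:
  assumes fin: "finite A" and perm: "p permutes A" and ne: "A \<noteq> {}"
    and big: "\<And>C. C \<in> cyc A p \<Longrightarrow> card C \<ge> 3"
  shows "(\<Sum>a\<in>A. \<Sum>b\<in>A - {a}. \<Sum>ys\<in>permutations_of_set (A - {a, b}). 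
     power_gf (card (cyc A (cycle_of_list ys \<circ> (p \<circ> transpose a b)))))
    = fact (card A - 2) * (fls_X * (1 + fls_X) * fls_deriv (fls_deriv ((1 - fls_X) * cycles_gf (cyc A p))))"
proof -
  define c :: "complex fls" where "c = fact (card A - 2)"
  define S where "S = cyc A p"
  define P where "P = cycles_gf S"
  have permn: "permutation p" using fin perm by (rule permutes_permutation)
  have finS: "finite S" using fin by (simp add: S_def)
  have posS: "card C \<ge> 3" if "C \<in> S" for C using big that by (simp add: S_def)
  have pos_orb: "card (orbit p a) \<ge> 3" "orbit p a \<in> S" if "a \<in> A" for a
    using posS that by (auto simp: S_def cyc_def)
  have A3: "card A \<ge> 3"
  proof -
    obtain a where a: "a \<in> A" using ne by auto
    have "card (orbit p a) \<le> card A" using cyc_subset[OF perm] pos_orb(2)[OF a] fin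
      by (intro card_mono) (auto simp: S_def)
    thus ?thesis using pos_orb(1)[OF a] by simp
  qed
  define F where "F = (\<lambda>a b. \<Sum>ys\<in>permutations_of_set (A - {a, b}). power_gf (card (cyc A (cycle_of_list ys \<circ> (p \<circ> transpose a b)))))"
  have permq: "(p \<circ> transpose a b) permutes A" if "a \<in> A" "b \<in> A" for a b
    using that perm by (simp add: permutes_compose permutes_swap_id)
  have "(\<Sum>a\<in>A. \<Sum>b\<in>A - {a}. F a b) = (\<Sum>C\<in>S. \<Sum>C'\<in>S - {C}. of_nat (card C) * of_nat (card C') * 
          (c * (base_gf * P * (cyc_gf (card C + card C' - 2) / (cyc_gf (card C) * cyc_gf (card C'))))))
     + (\<Sum>C\<in>S. of_nat (card C) * (\<Sum>i=1..<card C. 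
           if i = 1 \<or> i = card C - 1 then theta (c * (base_gf * P * (cyc_gf (card C - 2) / cyc_gf (card C))))
           else c * (base_gf * P * (cyc_gf (i - 1) * cyc_gf (card C - 1 - i) / cyc_gf (card C)))))"
    unfolding S_def
  proof (rule sum_pairs_cyc[OF fin perm])
    fix a b assume ab: "a \<in> A" "b \<in> A" "orbit p a \<noteq> orbit p b"
    note mg = cyc_merge[OF fin perm ab]
    have "a \<noteq> b" using ab(3) by auto
    have disj: "orbit p a \<inter> orbit p b = {}" by (rule orbit_disjoint[OF permn ab(3)])
    have crd: "card (orbit p a \<union> orbit p b) = card (orbit p a) + card (orbit p b)"
      using pos_orb[OF ab(1)] pos_orb[OF ab(2)] disj by (intro card_Un_disjoint) (auto intro: card_ge_0_finite)
    have "cyc A (p \<circ> transpose a b) - {orbit p a \<union> orbit p b} = S - {orbit p a, orbit p b}"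
      using mg(3,4) by (auto simp: S_def)
    hence "F a b = c * base_gf * (cycles_gf (S - {orbit p a, orbit p b}) * cyc_gf (card (orbit p a) + card (orbit p b) - 2))"
      using sum_power_gf_remove2[OF fin permq[OF ab(1,2)] ab(1,2) \<open>a \<noteq> b\<close> A3] pos_orb[OF ab(1)] pos_orb[OF ab(2)]
      unfolding F_def mg(1,2) crd c_def by simp
    also have "cycles_gf (S - {orbit p a, orbit p b}) = P / (cyc_gf (card (orbit p a)) * cyc_gf (card (orbit p b)))"
      unfolding P_def using pos_orb[OF ab(1)] pos_orb[OF ab(2)] ab(3) finS by (intro cycles_gf_remove2) auto
    finally show "F a b = c * (base_gf * P * (cyc_gf (card (orbit p a) + card (orbit p b) - 2) / (cyc_gf (card (orbit p a)) * cyc_gf (card (orbit p b)))))"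
      by simp
  next
    fix a i assume a: "a \<in> A" and i: "0 < i" "i < card (orbit p a)"
    define b where "b = (p ^^ i) a"
    define q where "q = p \<circ> transpose a b"
    define k where "k = card (orbit p a)"
    have k3: "k \<ge> 3" using pos_orb[OF a] by (simp add: k_def)
    note sp = cyc_split[OF fin perm a i, folded b_def, folded q_def, folded k_def]
    have ne: "orbit q a \<noteq> orbit q b" using sp(6) orbit_nonempty[of q] by auto
    have "cyc A q - {orbit q a, orbit q b} = S - {orbit p a}"
      using sp(7,8,9) by (auto simp: S_def)
    hence Pi: "cycles_gf (cyc A q - {orbit q a, orbit q b}) = P / cyc_gf k"
      using finS pos_orb[OF a] by (simp add: cycles_gf_remove P_def k_def)
    have "F a b = (if card (orbit q a) = 1 then theta (c * base_gf * (P / cyc_gf k * cyc_gf (card (orbit q b) - 1)))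
       else if card (orbit q b) = 1 then theta (c * base_gf * (P / cyc_gf k * cyc_gf (card (orbit q a) - 1)))
       else c * base_gf * (P / cyc_gf k * cyc_gf (card (orbit q a) - 1) * cyc_gf (card (orbit q b) - 1)))"
      using sum_power_gf_remove2[OF fin permq[OF a sp(2)] a sp(2) sp(1)[symmetric] A3, folded q_def] ne k3 i
      unfolding F_def q_def[symmetric] c_def Pi sp(3,4) by (auto simp: k_def[symmetric])
    also have "\<dots> = (if i = 1 \<or> i = k - 1 then theta (c * (base_gf * P * (cyc_gf (k - 2) / cyc_gf k))) else c * (base_gf * P * (cyc_gf (i - 1) * cyc_gf (k - 1 - i) / cyc_gf k)))"
    proof -
      have "k - i = 1 \<longleftrightarrow> i = k - 1" using i by (auto simp: k_def[symmetric])
      moreover have "k - 1 - 1 = k - 2" "k - i - 1 = k - 1 - i" by simp_all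
      ultimately show ?thesis unfolding sp(3,4) by (auto simp: mult_ac)
    qed
    finally show "F a ((p ^^ i) a) = (if i = 1 \<or> i = card (orbit p a) - 1 then theta (c * (base_gf * P * (cyc_gf (card (orbit p a) - 2) / cyc_gf (card (orbit p a))))) 
      else c * (base_gf * P * (cyc_gf (i - 1) * cyc_gf (card (orbit p a) - 1 - i) / cyc_gf (card (orbit p a)))))"
      unfolding k_def b_def .
  qed
  also have "(\<Sum>C\<in>S. of_nat (card C) * (\<Sum>i=1..<card C. 
         if i = 1 \<or> i = card C - 1 then theta (c * (base_gf * P * (cyc_gf (card C - 2) / cyc_gf (card C))))
         else c * (base_gf * P * (cyc_gf (i - 1) * cyc_gf (card C - 1 - i) / cyc_gf (card C))))) = 
     (\<Sum>C\<in>S. c * (of_nat (card C) * (\<Sum>i=1..<card C. base_gf * P * (cyc_gf (i - 1) * cyc_gf (card C - 1 - i) / cyc_gf (card C)))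
          + 2 * theta (base_gf * P * (of_nat (card C) * (cyc_gf (card C - 2) / cyc_gf (card C))))))"
  proof (rule sum.cong)
    fix C assume "C \<in> S"
    define k where "k = card C"
    define t where "t = theta (c * (base_gf * P * (cyc_gf (k - 2) / cyc_gf k)))"
    have k3: "k \<ge> 3" using posS[OF \<open>C \<in> S\<close>] by (simp add: k_def)
    have thc: "theta (c * f) = c * theta f" for f
      unfolding c_def using theta_of_nat[of "fact (card A - 2)"] by simp
    \<comment> \<open>At both ends the regular summand contains \<open>cyc_gf 0\<close> and
      vanishes. Since k is at least 3 the ends are distinct, and the two equal \<open>theta\<close>
      terms give 2 t.\<close>
    have "(\<Sum>i=1..<k. if i = 1 \<or> i = k - 1 then t else c * (base_gf * P * (cyc_gf (i - 1) * cyc_gf (k - 1 - i) / cyc_gf k)))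
      = (\<Sum>i=1..<k. (if i = 1 then t else 0) + (if i = k - 1 then t else 0) + c * (base_gf * P * (cyc_gf (i - 1) * cyc_gf (k - 1 - i) / cyc_gf k)))"
      using k3 by (intro sum.cong) auto
    also have "\<dots> = 2 * t + (\<Sum>i=1..<k. c * (base_gf * P * (cyc_gf (i - 1) * cyc_gf (k - 1 - i) / cyc_gf k)))"
      unfolding sum.distrib sum.delta[OF finite_atLeastLessThan] using k3 by auto
    finally have E: "(\<Sum>i=1..<k. if i = 1 \<or> i = k - 1 then t else c * (base_gf * P * (cyc_gf (i - 1) * cyc_gf (k - 1 - i) / cyc_gf k))) = 
        2 * t + (\<Sum>i=1..<k. c * (base_gf * P * (cyc_gf (i - 1) * cyc_gf (k - 1 - i) / cyc_gf k)))" .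
    have th2: "theta (base_gf * P * (of_nat k * (cyc_gf (k - 2) / cyc_gf k))) = of_nat k * theta (base_gf * P * (cyc_gf (k - 2) / cyc_gf k))"
      unfolding theta_of_nat[symmetric] by (simp only: mult_ac)
    show "of_nat (card C) * (\<Sum>i=1..<card C. 
         if i = 1 \<or> i = card C - 1 then theta (c * (base_gf * P * (cyc_gf (card C - 2) / cyc_gf (card C))))
         else c * (base_gf * P * (cyc_gf (i - 1) * cyc_gf (card C - 1 - i) / cyc_gf (card C)))) =
       c * (of_nat (card C) * (\<Sum>i=1..<card C. base_gf * P * (cyc_gf (i - 1) * cyc_gf (card C - 1 - i) / cyc_gf (card C)))
          + 2 * theta (base_gf * P * (of_nat (card C) * (cyc_gf (card C - 2) / cyc_gf (card C)))))"
      unfolding k_def[symmetric] t_def[symmetric] E th2 unfolding t_def thc sum_distrib_left[symmetric]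
      by (simp only: distrib_left mult_ac add_ac)
  qed simp
  also have "(\<Sum>C\<in>S. \<Sum>C'\<in>S - {C}. of_nat (card C) * of_nat (card C') * 
        (c * (base_gf * P * (cyc_gf (card C + card C' - 2) / (cyc_gf (card C) * cyc_gf (card C')))))) = 
      c * (\<Sum>C\<in>S. \<Sum>C'\<in>S - {C}. of_nat (card C) * of_nat (card C') * 
        (base_gf * P * (cyc_gf (card C + card C' - 2) / (cyc_gf (card C) * cyc_gf (card C')))))"
    unfolding sum_distrib_left by (intro sum.cong refl) (simp only: mult_ac)
  also have "c * (\<Sum>C\<in>S. \<Sum>C'\<in>S - {C}. of_nat (card C) * of_nat (card C') * 
        (base_gf * P * (cyc_gf (card C + card C' - 2) / (cyc_gf (card C) * cyc_gf (card C'))))) + 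
       (\<Sum>C\<in>S. c * (of_nat (card C) * (\<Sum>i=1..<card C. base_gf * P * (cyc_gf (i - 1) * cyc_gf (card C - 1 - i) / cyc_gf (card C)))
          + 2 * theta (base_gf * P * (of_nat (card C) * (cyc_gf (card C - 2) / cyc_gf (card C)))))) =
      c * (fls_X * (1 + fls_X) * fls_deriv (fls_deriv ((1 - fls_X) * P)))"
  proof -
    have "card C \<ge> 2" if "C \<in> S" for C using posS[OF that] by simp
    from sum_pairs_identity2[OF finS this, folded base_gf_def P_def] show ?thesis
      unfolding sum_distrib_left[symmetric] distrib_left[symmetric] by simp
  qed
  finally show ?thesis unfolding F_def c_def P_def S_def .
qed

section \<open>Zeros on vertical lines\<close>

lemma norm_less_norm_iff: "norm a < norm b \<longleftrightarrow> Re a ^ 2 + Im a ^ 2 < Re b ^ 2 + Im b ^ 2"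
  by (simp add: cmod_def)

lemma norm_diff_1_less_iff: "norm (w - 1) < norm w \<longleftrightarrow> Re w > 1 / 2"
  unfolding norm_less_norm_iff by (simp add: power2_eq_square algebra_simps) 

lemma norm_less_diff_1_iff: "norm w < norm (w - 1) \<longleftrightarrow> Re w < 1 / 2"
  unfolding norm_less_norm_iff by (simp add: power2_eq_square algebra_simps)

text \<open>Compares the distances of w to 0 and to -r; their perpendicular bisector is Re w =
  -r/2.\<close>

lemma norm_less_norm_add_of_real_iff:
  assumes "r > 0"
  shows "norm w < norm (w + of_real r) \<longleftrightarrow> Re w > - r / 2"
    and "norm (w + of_real r) < norm w \<longleftrightarrow> Re w < - r / 2"
proof -
  have "Re (w + of_real r) ^ 2 + Im (w + of_real r) ^ 2 = Re w ^ 2 + Im w ^ 2 + r * (2 * Re w + r)"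
    by (simp add: power2_eq_square algebra_simps)
  moreover have "r * (2 * Re w + r) > 0 \<longleftrightarrow> 2 * Re w + r > 0" "r * (2 * Re w + r) < 0 \<longleftrightarrow> 2 * Re w + r < 0"
    using assms by (simp_all add: zero_less_mult_iff mult_less_0_iff)
  ultimately show "norm w < norm (w + of_real r) \<longleftrightarrow> Re w > - r / 2"
    and "norm (w + of_real r) < norm w \<longleftrightarrow> Re w < - r / 2"
    unfolding norm_less_norm_iff by auto
qed

text \<open>A nonzero constant satisfies this for every c, which is how the inductions below
  start.\<close>

definition roots_on_line :: "real \<Rightarrow> complex poly \<Rightarrow> bool" where
  "roots_on_line c A \<longleftrightarrow> A \<noteq> 0 \<and> (\<forall>x. poly A x = 0 \<longrightarrow> Re x = c)"

lemma poly_eq_prod_roots: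
  fixes A :: "complex poly"
  obtains rs where "A = smult (lead_coeff A) (\<Prod>r\<leftarrow>rs. [:-r, 1:])" "length rs = degree A"
    "A \<noteq> 0 \<longrightarrow> set rs = {r. poly A r = 0}"
proof -
  obtain rs where rs: "mset rs = proots A" by (metis ex_mset)
  have "(\<Prod>r\<leftarrow>rs. [:-r, 1:]) = (\<Prod>r\<in>#proots A. [:-r, 1:])"
    unfolding rs[symmetric] by (simp add: prod_mset_prod_list flip: mset_map)
  hence 1: "A = smult (lead_coeff A) (\<Prod>r\<leftarrow>rs. [:-r, 1:])"
    using complex_poly_decompose_multiset[of A] by simp
  have 2: "length rs = degree A"
  proof (cases "A = 0")
    case False
    have "degree (\<Prod>r\<leftarrow>xs. [:-r, 1:]) = length xs \<and> (\<Prod>r\<leftarrow>xs. [:-r, 1:]) \<noteq> 0" for xs :: "complex list"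
      by (induction xs) (simp_all add: degree_mult_eq del: mult_pCons_left)
    moreover have "degree A = degree (\<Prod>r\<leftarrow>rs. [:-r, 1:])" 
      using False by (subst 1) simp
    ultimately show ?thesis by simp
  next
    case True
    hence "mset rs = {#}" using rs by simp
    thus ?thesis using True by simp
  qed
  have "set rs = {r. poly A r = 0}" if "A \<noteq> 0"
    using arg_cong[OF rs, of set_mset] that by simp
  thus ?thesis using that 1 2 by blast
qed

lemma norm_prod_list_less:
  assumes "\<And>r. r \<in> set rs \<Longrightarrow> norm (f r :: complex) < norm (h r :: complex)"
  shows "norm (\<Prod>r\<leftarrow>rs. f r) \<le> norm (\<Prod>r\<leftarrow>rs. h r)"
    and "rs \<noteq> [] \<Longrightarrow> norm (\<Prod>r\<leftarrow>rs. f r) < norm (\<Prod>r\<leftarrow>rs. h r)"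
    and "(\<Prod>r\<leftarrow>rs. h r) \<noteq> 0"
proof -
  have "norm (\<Prod>r\<leftarrow>rs. f r) \<le> norm (\<Prod>r\<leftarrow>rs. h r) \<and> (rs \<noteq> [] \<longrightarrow> norm (\<Prod>r\<leftarrow>rs. f r) < norm (\<Prod>r\<leftarrow>rs. h r)) \<and> (\<Prod>r\<leftarrow>rs. h r) \<noteq> 0"
    using assms
  proof (induction rs)
    case (Cons r rs)
    have IH: "norm (\<Prod>r\<leftarrow>rs. f r) \<le> norm (\<Prod>r\<leftarrow>rs. h r)" "(\<Prod>r\<leftarrow>rs. h r) \<noteq> 0" using Cons by auto
    have fh: "norm (f r) < norm (h r)" using Cons.prems by simp
    have "norm (f r) * norm (\<Prod>r\<leftarrow>rs. f r) \<le> norm (f r) * norm (\<Prod>r\<leftarrow>rs. h r)"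
      using IH(1) by (intro mult_left_mono) auto
    also have "\<dots> < norm (h r) * norm (\<Prod>r\<leftarrow>rs. h r)"
      using IH(2) fh by (intro mult_strict_right_mono) auto
    finally have lt: "norm (f r) * norm (\<Prod>r\<leftarrow>rs. f r) < norm (h r) * norm (\<Prod>r\<leftarrow>rs. h r)" .
    moreover have "h r * (\<Prod>r\<leftarrow>rs. h r) \<noteq> 0" using fh IH(2) by auto
    ultimately show ?case using IH(2) less_imp_le[OF lt]
      unfolding list.map prod_list.Cons norm_mult by blast
  qed simp
  thus "norm (\<Prod>r\<leftarrow>rs. f r) \<le> norm (\<Prod>r\<leftarrow>rs. h r)"
    and "rs \<noteq> [] \<Longrightarrow> norm (\<Prod>r\<leftarrow>rs. f r) < norm (\<Prod>r\<leftarrow>rs. h r)"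
    and "(\<Prod>r\<leftarrow>rs. h r) \<noteq> 0" by auto
qed

text \<open>The comparison holds factor by factor: for a root r with real part c, the distances from
  r to x and x - 1 agree exactly when Re x = c + 1/2. The weak versions cover constant
  polynomials.\<close>

lemma roots_on_line_shift:
  assumes "roots_on_line c A"
  shows "Re x > c + 1 / 2 \<Longrightarrow> norm (poly A (x - 1)) \<le> norm (poly A x)"
    and "Re x > c + 1 / 2 \<Longrightarrow> degree A > 0 \<Longrightarrow> norm (poly A (x - 1)) < norm (poly A x)"
    and "Re x < c + 1 / 2 \<Longrightarrow> norm (poly A x) \<le> norm (poly A (x - 1))"
    and "Re x < c + 1 / 2 \<Longrightarrow> degree A > 0 \<Longrightarrow> norm (poly A x) < norm (poly A (x - 1))"
proof -
  obtain rs where rs: "A = smult (lead_coeff A) (\<Prod>r\<leftarrow>rs. [:-r, 1:])" "length rs = degree A"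
      "A \<noteq> 0 \<longrightarrow> set rs = {r. poly A r = 0}"
    by (rule poly_eq_prod_roots[of A])
  have Re: "Re r = c" if "r \<in> set rs" for r
    using rs(3) assms that by (auto simp: roots_on_line_def)
  have "poly (\<Prod>r\<leftarrow>rs. [:-r, 1:]) y = (\<Prod>r\<leftarrow>rs. y - r)" for y
    by (induction rs) (simp_all add: algebra_simps)
  hence A: "norm (poly A y) = norm (lead_coeff A) * norm (\<Prod>r\<leftarrow>rs. y - r)" for y
    by (subst rs(1)) (simp add: norm_mult)
  have rs_ne: "degree A > 0 \<Longrightarrow> rs \<noteq> []" using rs(2) by auto
  have lc: "norm (lead_coeff A) > 0" using assms by (simp add: roots_on_line_def)
  {
    assume "Re x > c + 1 / 2"
    hence "norm (x - 1 - r) < norm (x - r)" if "r \<in> set rs" for r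
      using norm_diff_1_less_iff[of "x - r"] Re[OF that] by (simp add: algebra_simps)
    note cmp = norm_prod_list_less[of rs "\<lambda>r. x - 1 - r" "\<lambda>r. x - r", OF this]
    show "norm (poly A (x - 1)) \<le> norm (poly A x)" 
      unfolding A using cmp(1) lc by (intro mult_left_mono) auto
    show "norm (poly A (x - 1)) < norm (poly A x)" if "degree A > 0"
      unfolding A using cmp(2) rs_ne[OF that] lc by (intro mult_strict_left_mono) auto
  }
  {
    assume "Re x < c + 1 / 2"
    hence "norm (x - r) < norm (x - 1 - r)" if "r \<in> set rs" for r
      using norm_less_diff_1_iff[of "x - r"] Re[OF that] by (simp add: algebra_simps)
    note cmp = norm_prod_list_less[of rs "\<lambda>r. x - r" "\<lambda>r. x - 1 - r", OF this]
    show "norm (poly A x) \<le> norm (poly A (x - 1))" 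
      unfolding A using cmp(1) lc by (intro mult_left_mono) auto
    show "norm (poly A x) < norm (poly A (x - 1))" if "degree A > 0"
      unfolding A using cmp(2) rs_ne[OF that] lc by (intro mult_strict_left_mono) auto
  }
qed

section \<open>Shift operators and rising products\<close>

text \<open>On the generating function of the values at the natural numbers this is multiplication
  by z - rho, up to initial coefficients.\<close>

definition shift_op :: "complex \<Rightarrow> complex poly \<Rightarrow> complex poly" where
  "shift_op \<rho> A = pcompose A [:-1, 1:] - smult \<rho> A"

lemma poly_shift_op: "poly (shift_op \<rho> A) x = poly A (x - 1) - \<rho> * poly A x"
  by (simp add: shift_op_def poly_pcompose algebra_simps)

text \<open>This is r! times the binomial coefficient (x + r choose r), so its values have the
  generating function r! / (1 - z)^(r+1).\<close>

definition rise :: "nat \<Rightarrow> complex poly" where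
  "rise r = (\<Prod>i=1..r. [:of_nat i, 1:])"

lemma rise_0 [simp]: "rise 0 = 1"
  by (simp add: rise_def)

lemma poly_rise: "poly (rise r) x = (\<Prod>i=1..r. x + of_nat i)"
  by (simp add: rise_def poly_prod add.commute)

lemma rise_Suc: "rise (Suc r) = [:of_nat (Suc r), 1:] * rise r"
  by (simp add: rise_def mult.commute)

lemma poly_rise_Suc_minus_1: "poly (rise (Suc r)) (x - 1) = x * poly (rise r) x"
proof (induction r)
  case (Suc r)
  have "poly (rise (Suc (Suc r))) (x - 1) = (of_nat (Suc (Suc r)) + (x - 1)) * poly (rise (Suc r)) (x - 1)"
    by (simp add: rise_Suc[of "Suc r"] algebra_simps)
  thus ?case unfolding Suc.IH by (simp add: rise_Suc algebra_simps)
qed (simp add: rise_Suc)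

lemma shift_op_0 [simp]: "shift_op \<rho> 0 = 0"
  by (simp add: shift_op_def)

text \<open>At a zero, A(x - 1) and A(x) have equal absolute value, which for nonconstant A happens
  only on the line moved by 1/2. For constant A the result is a nonzero constant.\<close>

lemma shift_op_line:
  assumes "roots_on_line c A" "norm \<rho> = 1" "shift_op \<rho> A \<noteq> 0"
  shows "roots_on_line (c + 1 / 2) (shift_op \<rho> A)"
  unfolding roots_on_line_def
proof (intro conjI allI impI)
  show "shift_op \<rho> A \<noteq> 0" by fact
  fix x assume x: "poly (shift_op \<rho> A) x = 0"
  hence eq: "norm (poly A (x - 1)) = norm (poly A x)"
    using assms(2) by (simp add: poly_shift_op norm_mult)
  show "Re x = c + 1 / 2"
  proof (cases "degree A = 0")
    case True
    then obtain a where "A = [:a:]" by (rule degree_eq_zeroE)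
    hence "shift_op \<rho> A = [:a - \<rho> * a:]" by (simp add: shift_op_def)
    thus ?thesis using x assms(3) by simp
  next
    case False
    thus ?thesis using roots_on_line_shift(2,4)[OF assms(1), of x] eq by linarith
  qed
qed

text \<open>The zeros -1, ..., -r of a rising product lie on no vertical line, so they are kept as a
  separate factor that loses one zero per step: the values at x - 1 and x share
  \<open>rise r\<close>, leaving the factors x and x + r + 1. The distances from x to 0 and to -(r +
  1) agree on Re x = -(r + 1)/2, the very line to which the zeros of A move, so both comparisons
  point the same way.\<close>

lemma shift_op_rise:
  fixes A :: "complex poly"
  assumes "roots_on_line (- (real r + 2) / 2) A" "norm \<rho> = 1"
  defines "B \<equiv> [:0, 1:] * pcompose A [:-1, 1:] - smult \<rho> ([:of_nat (Suc r), 1:] * A)"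
  shows "shift_op \<rho> (rise (Suc r) * A) = rise r * B"
    and "B \<noteq> 0 \<Longrightarrow> roots_on_line (- (real r + 1) / 2) B"
proof -
  have "poly (shift_op \<rho> (rise (Suc r) * A)) x = poly (rise r * B) x" for x
    unfolding poly_shift_op poly_mult poly_rise_Suc_minus_1 B_def
    by (simp add: rise_Suc poly_pcompose algebra_simps)
  thus "shift_op \<rho> (rise (Suc r) * A) = rise r * B" by (simp add: poly_eq_poly_eq_iff[symmetric] fun_eq_iff)
  assume "B \<noteq> 0"
  show "roots_on_line (- (real r + 1) / 2) B"
    unfolding roots_on_line_def
  proof (intro conjI allI impI)
    show "B \<noteq> 0" by fact
    fix x assume x: "poly B x = 0"
    hence "norm (x * poly A (x - 1)) = norm (\<rho> * ((x + of_real (real (Suc r))) * poly A x))"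
      by (simp add: B_def poly_pcompose algebra_simps)
    hence eq: "norm x * norm (poly A (x - 1)) = norm (x + of_real (real (Suc r))) * norm (poly A x)"
      using assms(2) by (simp only: norm_mult mult_1_left)
    note cmp = norm_less_norm_add_of_real_iff[of "real (Suc r)" x]
    have nzA: "poly A y \<noteq> 0" if "Re y \<noteq> - (real r + 2) / 2" for y
      using assms(1) that by (auto simp: roots_on_line_def)
    show "Re x = - (real r + 1) / 2"
    proof (rule linorder_cases[of "Re x" "- (real r + 1) / 2"])
      assume g: "Re x > - (real r + 1) / 2"
      have "norm x * norm (poly A (x - 1)) \<le> norm x * norm (poly A x)"
        using g by (intro mult_left_mono roots_on_line_shift(1)[OF assms(1)]) (auto simp: field_simps)
      also have "\<dots> < norm (x + of_real (real (Suc r))) * norm (poly A x)"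
        using g cmp(1) nzA[of x] by (intro mult_strict_right_mono) (auto simp: field_simps)
      finally show ?thesis using eq by simp
    next
      assume g: "Re x < - (real r + 1) / 2"
      have "norm (x + of_real (real (Suc r))) * norm (poly A x) \<le> norm (x + of_real (real (Suc r))) * norm (poly A (x - 1))"
        using g by (intro mult_left_mono roots_on_line_shift(3)[OF assms(1)]) (auto simp: field_simps)
      also have "\<dots> < norm x * norm (poly A (x - 1))"
        using g cmp(2) nzA[of "x - 1"] by (intro mult_strict_right_mono) (auto simp: field_simps)
      finally show ?thesis using eq by simp
    qed
  qed
qed

text \<open>Once the separate zeros are used up, the truncated difference is 0 and the remaining
  steps are those of \<open>shift_op_line\<close>. The alternative A = 0 stays because a shift may
  cancel completely; it is ruled out only for the final polynomial.\<close>

lemma foldr_shift_op_rise: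
  assumes "\<And>\<rho>. \<rho> \<in> set rs \<Longrightarrow> norm \<rho> = 1"
  shows "\<exists>A. foldr shift_op rs (rise r) = rise (r - length rs) * A \<and>
     (A = 0 \<or> roots_on_line ((real (length rs) - real r - 1) / 2) A)"
  using assms
proof (induction rs)
  case Nil
  show ?case by (intro exI[of _ 1]) (simp add: roots_on_line_def)
next
  case (Cons \<rho> rs)
  define l where "l = length rs"
  obtain A where A: "foldr shift_op rs (rise r) = rise (r - l) * A"
     "A = 0 \<or> roots_on_line ((real l - real r - 1) / 2) A"
    using Cons unfolding l_def by auto
  have \<rho>: "norm \<rho> = 1" using Cons.prems by simp
  show ?case
  proof (cases "A = 0")
    case True
    thus ?thesis using A by (intro exI[of _ 0]) simp
  next
    case False
    hence line: "roots_on_line ((real l - real r - 1) / 2) A" using A by simp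
    show ?thesis
    proof (cases "r \<le> l")
      case True
      thus ?thesis using A(1) shift_op_line[OF line \<rho>]
        by (intro exI[of _ "shift_op \<rho> A"]) (auto simp: l_def field_simps)
    next
      case False
      define s where "s = r - Suc l"
      have s: "r - l = Suc s" "r - Suc l = s" "real l - real r - 1 = - (real s + 2)" "real (Suc l) - real r - 1 = - (real s + 1)"
        using False by (auto simp: s_def)
      note st = shift_op_rise[OF line[unfolded s] \<rho>]
      define B where "B = [:0, 1:] * pcompose A [:-1, 1:] - smult \<rho> ([:of_nat (Suc s), 1:] * A)"
      have "foldr shift_op (\<rho> # rs) (rise r) = rise s * B"
        using st(1) by (simp only: foldr.simps o_apply A(1) s(1) B_def)
      moreover have "B = 0 \<or> roots_on_line (- (real s + 1) / 2) B" using st(2) unfolding B_def by blast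
      moreover have "r - length (\<rho> # rs) = s" "real (length (\<rho> # rs)) - real r - 1 = - (real s + 1)"
        using s(2,4) by (simp_all add: l_def)
      ultimately show ?thesis by (intro exI[of _ B]) (simp only:)
    qed
  qed
qed

text \<open>Each factor z - rho looks back one coefficient. The bound on N keeps all these indices
  nonnegative, where coefficients are polynomial values.\<close>

lemma foldr_shift_op_coeff:
  assumes F: "\<And>N. fps_nth F N = poly P (of_nat N)" and "N \<ge> length rs"
  shows "poly (foldr shift_op rs P) (of_nat N) = fps_nth (fps_of_poly (\<Prod>\<rho>\<leftarrow>rs. [:-\<rho>, 1:]) * F) N"
  using assms(2)
proof (induction rs arbitrary: N)
  case (Cons \<rho> rs)
  define H where "H = fps_of_poly (\<Prod>\<rho>\<leftarrow>rs. [:-\<rho>, 1:]) * F"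
  obtain M where N: "N = Suc M" using Cons.prems by (cases N) auto
  have p: "fps_of_poly [:-\<rho>, 1:] = fps_X - fps_const \<rho>"
    by (rule fps_ext) (auto simp: coeff_pCons split: nat.splits)
  have "fps_of_poly (\<Prod>\<rho>\<leftarrow>\<rho> # rs. [:-\<rho>, 1:]) * F = (fps_X - fps_const \<rho>) * H"
    by (simp only: list.map prod_list.Cons fps_of_poly_mult H_def p mult.assoc)
  also have "fps_nth \<dots> N = fps_nth H M - \<rho> * fps_nth H N"
    by (simp add: left_diff_distrib N)
  also have "\<dots> = poly (foldr shift_op rs P) (of_nat N - 1) - \<rho> * poly (foldr shift_op rs P) (of_nat N)"
    using Cons.IH[of M] Cons.IH[of N] Cons.prems N by (simp add: H_def)
  finally show ?case by (simp add: poly_shift_op)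
qed (simp add: F)

section \<open>Generating function of a rising product\<close>

definition rise_fps :: "nat \<Rightarrow> complex fps" where
  "rise_fps r = Abs_fps (\<lambda>N. poly (rise r) (of_nat N))"

text \<open>Multiplication by 1 - z is the backward difference. It is correct at N = 0 too, since
  \<open>rise (Suc r)\<close> vanishes at -1.\<close>

lemma rise_fps_Suc: "(1 - fps_X) * rise_fps (Suc r) = of_nat (Suc r) * rise_fps r"
proof (rule fps_ext)
  fix N
  show "fps_nth ((1 - fps_X) * rise_fps (Suc r)) N = fps_nth (of_nat (Suc r) * rise_fps r) N"
  proof (cases N)
    case 0
    thus ?thesis by (simp add: rise_fps_def left_diff_distrib rise_Suc)
  next
    case (Suc M)
    have "fps_nth ((1 - fps_X) * rise_fps (Suc r)) N = poly (rise (Suc r)) (of_nat N) - poly (rise (Suc r)) (of_nat N - 1)"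
      by (simp add: left_diff_distrib rise_fps_def Suc)
    also have "\<dots> = of_nat (Suc r) * poly (rise r) (of_nat N)"
      unfolding poly_rise_Suc_minus_1 by (simp add: rise_Suc algebra_simps)
    finally show ?thesis by (simp add: rise_fps_def del: of_nat_Suc flip: fps_of_nat)
  qed
qed

lemma rise_fps_eq: "(1 - fps_X) ^ Suc r * rise_fps r = fact r"
proof (induction r)
  case 0
  show ?case by (rule fps_ext) (auto simp: rise_fps_def algebra_simps)
next
  case (Suc r)
  have "(1 - fps_X) ^ Suc (Suc r) * rise_fps (Suc r) = (1 - fps_X) ^ Suc r * ((1 - fps_X) * rise_fps (Suc r))"
    by (simp only: power_Suc2 mult.assoc)
  also have "\<dots> = of_nat (Suc r) * ((1 - fps_X) ^ Suc r * rise_fps r)"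
    unfolding rise_fps_Suc by (simp only: mult_ac)
  finally show ?case unfolding Suc.IH by simp
qed

text \<open>For Re z > 0, z + 1 is larger than z - 1 in absolute value, and Q is at least as large
  at z + 1 as at z, since its zeros lie on Re = 1/2. For Re z < 0 both comparisons are
  reversed.\<close>

lemma shift_sum_root_imaginary:
  assumes "roots_on_line (1 / 2) Q" "(z + 1) * poly Q (z + 1) + (z - 1) * poly Q z = 0"
  shows "Re z = 0"
proof -
  have eq: "norm (z + 1) * norm (poly Q (z + 1)) = norm (z - 1) * norm (poly Q z)"
    using assms(2) by (metis add_eq_0_iff norm_minus_cancel norm_mult)
  have nz: "poly Q y \<noteq> 0" if "Re y \<noteq> 1 / 2" for y
    using assms(1) that by (auto simp: roots_on_line_def)
  have c: "norm (z - 1) < norm (z + 1) \<longleftrightarrow> Re z > 0" "norm (z + 1) < norm (z - 1) \<longleftrightarrow> Re z < 0"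
    using norm_less_norm_add_of_real_iff[of 2 "z - 1"] by (simp_all add: algebra_simps)
  show ?thesis
  proof (rule linorder_cases[of "Re z" 0])
    assume g: "Re z > 0"
    have "norm (z - 1) * norm (poly Q z) \<le> norm (z - 1) * norm (poly Q (z + 1))"
      using g roots_on_line_shift(1)[OF assms(1), of "z + 1"] by (intro mult_left_mono) auto
    also have "\<dots> < norm (z + 1) * norm (poly Q (z + 1))"
      using g c(1) nz[of "z + 1"] by (intro mult_strict_right_mono) auto
    finally show ?thesis using eq by simp
  next
    assume g: "Re z < 0"
    have "norm (z + 1) * norm (poly Q (z + 1)) \<le> norm (z + 1) * norm (poly Q z)"
      using g roots_on_line_shift(3)[OF assms(1), of "z + 1"] by (intro mult_left_mono) auto
    also have "\<dots> < norm (z - 1) * norm (poly Q z)"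
      using g c(2) nz[of "z"] by (intro mult_strict_right_mono) auto
    finally show ?thesis using eq by simp
  qed
qed

section \<open>Cycle types and conjugation\<close>

lemma perm_cycles_eq_cyc: "perm_cycles n p = cyc {1..n} p"
  by (simp add: perm_cycles_def cyc_def)

lemma exists_permutes_map:
  assumes "finite A" "xs \<in> permutations_of_set A" "ys \<in> permutations_of_set A"
  shows "\<exists>\<sigma>. \<sigma> permutes A \<and> map \<sigma> xs = ys"
proof -
  define m where "m = card A"
  have xs: "length xs = m" "distinct xs" "set xs = A" and ys: "length ys = m" "distinct ys" "set ys = A"
    using assms length_finite_permutations_of_set by (auto simp: m_def permutations_of_set_def)
  have b1: "bij_betw ((!) xs) {..<m} A" and b2: "bij_betw ((!) ys) {..<m} A"
    using xs ys by (auto intro!: bij_betw_nth)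
  define \<sigma> where "\<sigma> x = (if x \<in> A then ys ! inv_into {..<m} ((!) xs) x else x)" for x
  have "bij_betw (((!) ys) \<circ> inv_into {..<m} ((!) xs)) A A"
    using b1 b2 bij_betw_inv_into bij_betw_trans by blast
  hence "bij_betw \<sigma> A A" by (rule bij_betw_cong[THEN iffD1, rotated]) (simp add: \<sigma>_def)
  hence "\<sigma> permutes A" by (rule bij_imp_permutes) (simp add: \<sigma>_def)
  moreover have "map \<sigma> xs = ys"
  proof (rule nth_equalityI)
    fix i assume "i < length (map \<sigma> xs)"
    hence i: "i < m" using xs by simp
    have "inv_into {..<m} ((!) xs) (xs ! i) = i"
      using b1 i by (intro inv_into_f_f) (auto simp: bij_betw_def)
    moreover have "xs ! i \<in> A" using xs i by auto
    ultimately show "map \<sigma> xs ! i = ys ! i" using i xs by (simp add: \<sigma>_def)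
  qed (use xs ys in simp)
  ultimately show ?thesis by blast
qed

text \<open>Conjugation relabels the entries of cycle lists. So a sum over all conjugates of a
  permutation given by lists becomes a sum over all orderings of A.\<close>

lemma sum_permutes_map:
  assumes "finite A" "xs \<in> permutations_of_set A"
  shows "(\<Sum>\<sigma> | \<sigma> permutes A. f (map \<sigma> xs)) = (\<Sum>ys\<in>permutations_of_set A. f ys)"
proof (rule sum.reindex_bij_betw)
  have set: "set xs = A" and dist: "distinct xs" using assms(2) by (auto simp: permutations_of_set_def)
  show "bij_betw (\<lambda>\<sigma>. map \<sigma> xs) {\<sigma>. \<sigma> permutes A} (permutations_of_set A)"
    unfolding bij_betw_def
  proof
    show "inj_on (\<lambda>\<sigma>. map \<sigma> xs) {\<sigma>. \<sigma> permutes A}"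
    proof (rule inj_onI)
      fix \<sigma> \<tau> assume st: "\<sigma> \<in> {\<sigma>. \<sigma> permutes A}" "\<tau> \<in> {\<sigma>. \<sigma> permutes A}" "map \<sigma> xs = map \<tau> xs"
      show "\<sigma> = \<tau>"
      proof
        fix x show "\<sigma> x = \<tau> x"
        proof (cases "x \<in> A")
          case True
          thus ?thesis using st(3) set by simp
        next
          case False
          thus ?thesis using st(1,2) by (simp add: permutes_def)
        qed
      qed
    qed
    show "(\<lambda>\<sigma>. map \<sigma> xs) ` {\<sigma>. \<sigma> permutes A} = permutations_of_set A"
    proof (intro equalityI subsetI)
      fix ys assume "ys \<in> (\<lambda>\<sigma>. map \<sigma> xs) ` {\<sigma>. \<sigma> permutes A}"
      then obtain \<sigma> where s: "\<sigma> permutes A" "ys = map \<sigma> xs" by auto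
      have "set ys = A" using permutes_image[OF s(1)] s(2) set by simp
      moreover have "distinct ys" using dist s permutes_inj_on[OF s(1)] by (simp add: distinct_map)
      ultimately show "ys \<in> permutations_of_set A" by (simp add: permutations_of_set_def)
    next
      fix ys assume "ys \<in> permutations_of_set A"
      thus "ys \<in> (\<lambda>\<sigma>. map \<sigma> xs) ` {\<sigma>. \<sigma> permutes A}"
        using exists_permutes_map[OF assms] by force
    qed
  qed
qed

lemma orbit_list:
  assumes "permutation p"
  obtains cs where "distinct cs" "set cs = orbit p x" "\<And>y. y \<in> orbit p x \<Longrightarrow> cycle_of_list cs y = p y"
proof
  show "distinct (support p x)" by (rule cycle_of_permutation[OF assms])
  have s: "set (support p x) = orbit p x"
    unfolding support_set[OF assms] orbit_altdef_permutation[OF assms] by auto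
  show "set (support p x) = orbit p x" by (rule s)
  show "cycle_of_list (support p x) y = p y" if "y \<in> orbit p x" for y
    using cycle_restrict[OF assms, of y x] that s by simp
qed

lemma two_cycles:
  assumes "finite A" "p permutes A" "image_mset card (mset_set (cyc A p)) = {#k, l#}"
  obtains C D where "cyc A p = {C, D}" "C \<noteq> D" "card C = k" "card D = l"
proof -
  have fin: "finite (cyc A p)" using assms(1) by simp
  have "card (cyc A p) = 2" using arg_cong[OF assms(3), of size] fin by simp
  then obtain C D where CD: "cyc A p = {C, D}" "C \<noteq> D" by (auto simp: card_2_iff)
  hence "{#card C, card D#} = {#k, l#}" using assms(3) by simp
  hence "card C = k \<and> card D = l \<or> card C = l \<and> card D = k"
    by (auto simp: add_eq_conv_ex)
  thus ?thesis using that[of C D] that[of D C] CD by (auto simp: insert_commute)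
qed

text \<open>The two lists are concatenated to one ordering of A so that a single relabelling
  conjugates both cycles at once.\<close>

lemma two_cycles_lists:
  assumes "finite A" "p permutes A" "image_mset card (mset_set (cyc A p)) = {#k, l#}"
  obtains cs ds where "p = cycle_of_list cs \<circ> cycle_of_list ds" "cs @ ds \<in> permutations_of_set A"
    "length cs = k" "length ds = l"
proof -
  have perm: "permutation p" using assms by (intro permutes_permutation)
  obtain C D where CD: "cyc A p = {C, D}" "C \<noteq> D" "card C = k" "card D = l"
    using two_cycles[OF assms] .
  obtain x y where xy: "C = orbit p x" "D = orbit p y" 
    using CD(1) unfolding cyc_def by (metis imageE insertI1 insertI2)
  obtain cs where cs: "distinct cs" "set cs = C" "\<And>y. y \<in> C \<Longrightarrow> cycle_of_list cs y = p y"
    using orbit_list[OF perm, of x] xy by metis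
  obtain ds where ds: "distinct ds" "set ds = D" "\<And>y. y \<in> D \<Longrightarrow> cycle_of_list ds y = p y"
    using orbit_list[OF perm, of y] xy by metis
  have A: "A = C \<union> D" using Union_cyc[OF assms(1,2)] CD by simp
  have disj: "C \<inter> D = {}" unfolding xy using CD(2) xy by (intro orbit_disjoint[OF perm]) simp
  have clos: "p z \<in> D" if "z \<in> D" for z using that xy by (simp add: orbit.step)
  have "p z = (cycle_of_list cs \<circ> cycle_of_list ds) z" for z
  proof (cases "z \<in> D")
    case True
    have "p z \<notin> set cs" using clos[OF True] disj cs by auto
    thus ?thesis using True ds by (simp add: id_outside_supp)
  next
    case False
    hence "cycle_of_list ds z = z" using ds by (intro id_outside_supp) simp
    moreover have "cycle_of_list cs z = p z"
    proof (cases "z \<in> C")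
      case False
      hence "z \<notin> A" using A \<open>z \<notin> D\<close> by simp
      hence "p z = z" using assms(2) by (simp add: permutes_def)
      thus ?thesis using cs False by (simp add: id_outside_supp)
    qed (use cs in simp)
    ultimately show ?thesis by simp
  qed
  hence "p = cycle_of_list cs \<circ> cycle_of_list ds" by (rule ext)
  moreover have "cs @ ds \<in> permutations_of_set A" using cs ds A disj by (auto simp: permutations_of_set_def)
  moreover have "length cs = k" "length ds = l" using cs ds CD by (auto simp: distinct_card[symmetric])
  ultimately show ?thesis using that by blast
qed

lemma orbit_cycle_of_list:
  assumes "distinct cs" "x \<in> set cs"
  shows "orbit (cycle_of_list cs) x = set cs"
proof
  let ?c = "cycle_of_list cs"
  have perm: "?c permutes set cs" by (rule cycle_permutes)
  show "orbit ?c x \<subseteq> set cs" by (rule permutes_orbit_subset[OF perm assms(2)])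
  show "set cs \<subseteq> orbit ?c x"
  proof
    fix y assume "y \<in> set cs"
    then obtain j where j: "j < length cs" "y = cs ! j" by (auto simp: in_set_conv_nth)
    obtain i where i: "i < length cs" "x = cs ! i" using assms(2) by (auto simp: in_set_conv_nth)
    \<comment> \<open>The number of steps from index i to index j modulo the length, written without
      a negative difference.\<close>
    define k where "k = j + (length cs - i)"
    have "(?c ^^ k) x = map (?c ^^ k) cs ! i" using i by simp
    also have "\<dots> = rotate k cs ! i" using cyclic_rotation[OF assms(1), of k] by simp
    also have "\<dots> = cs ! ((k + i) mod length cs)" using i by (simp add: nth_rotate add.commute)
    also have "(k + i) mod length cs = j" using i j by (simp add: k_def)
    finally have "y = (?c ^^ k) x" using j by simp
    thus "y \<in> orbit ?c x" 
      using permutation_self_in_orbit[OF permutation_of_cycle, of x cs] by (simp add: funpow_in_orbit)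
  qed
qed

text \<open>Makes the class of type beta nonempty, without which the average would be a division by
  0 and the polynomial would be zero.\<close>

lemma cycle_type_exists:
  assumes "finite A" "\<forall>b\<in>#\<beta>. b > 0" "sum_mset \<beta> = card A"
  shows "\<exists>p. p permutes A \<and> image_mset card (mset_set (cyc A p)) = \<beta>"
  using assms
proof (induction \<beta> arbitrary: A)
  case empty
  hence "A = {}" by simp
  thus ?case by (intro exI[of _ id]) (simp add: cyc_def id_def)
next
  case (add b \<beta>)
  have "b \<le> card A" using add.prems by simp
  then obtain B where B: "B \<subseteq> A" "card B = b" "finite B"
    by (rule obtain_subset_with_card_n)
  have "card (A - B) = card A - b" using B add.prems by (simp add: card_Diff_subset)
  then obtain p where p: "p permutes (A - B)" "image_mset card (mset_set (cyc (A - B) p)) = \<beta>"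
    using add.IH[of "A - B"] add.prems by fastforce
  obtain cs where cs: "set cs = B" "distinct cs" using finite_distinct_list[OF B(3)] by auto
  let ?c = "cycle_of_list cs"
  define q where "q = ?c \<circ> p"
  have c: "?c permutes B" using cycle_permutes[of cs] cs by simp
  have "p permutes A" using p(1) by (rule permutes_subset) auto
  moreover have "?c permutes A" using c B(1) by (rule permutes_subset)
  ultimately have q: "q permutes A" unfolding q_def by (rule permutes_compose)
  have qB: "q y = ?c y" if "y \<in> B" for y
    using p(1) that by (simp add: q_def permutes_def)
  have qA: "q y = p y" if "y \<in> A - B" for y
    using c permutes_in_image[OF p(1), of y] that by (simp add: q_def permutes_def)
  have oB: "orbit q x = B" if "x \<in> B" for x
  proof -
    have "orbit q x = orbit ?c x"
      using that qB permutes_in_image[OF c] by (intro orbit_cong0[of x B]) auto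
    thus ?thesis using orbit_cycle_of_list[of cs x] cs that by simp
  qed
  have oA: "orbit q x = orbit p x" if "x \<in> A - B" for x
    using that qA permutes_in_image[OF p(1)] by (intro orbit_cong0[of x "A - B"]) auto
  have "B \<noteq> {}" using B add.prems by auto
  have "cyc A q = orbit q ` B \<union> orbit q ` (A - B)" unfolding cyc_def using B(1) by blast
  also have "orbit q ` B = {B}" using oB \<open>B \<noteq> {}\<close> by auto
  also have "orbit q ` (A - B) = cyc (A - B) p" unfolding cyc_def using oA by (intro image_cong) auto
  finally have "cyc A q = insert B (cyc (A - B) p)" by simp
  moreover have "B \<notin> cyc (A - B) p" using cyc_subset[OF p(1), of B] \<open>B \<noteq> {}\<close> by auto
  ultimately have "image_mset card (mset_set (cyc A q)) = add_mset b \<beta>"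
    using p(2) B add.prems(1) by simp
  thus ?case using q by blast
qed

text \<open>The class is closed under conjugation, so each conjugate of alpha gives the same sum
  over it. Summing over all of them makes the inner sum, for one fixed omega, computable.\<close>

lemma sum_class_conj:
  fixes A :: "'a set" and \<beta> :: "nat multiset"
  assumes "finite A" "\<alpha> permutes A"
  defines "Cl \<equiv> {p. p permutes A \<and> image_mset card (mset_set (cyc A p)) = \<beta>}"
  shows "fact (card A) * (\<Sum>\<omega>\<in>Cl. power_gf (card (cyc A (\<alpha> \<circ> \<omega>)))) =
    (\<Sum>\<omega>\<in>Cl. \<Sum>\<sigma> | \<sigma> permutes A. power_gf (card (cyc A (\<sigma> \<circ> \<alpha> \<circ> inv \<sigma> \<circ> \<omega>))))"
proof -
  have "(\<Sum>\<omega>\<in>Cl. power_gf (card (cyc A (\<sigma> \<circ> \<alpha> \<circ> inv \<sigma> \<circ> \<omega>)))) = (\<Sum>\<omega>\<in>Cl. power_gf (card (cyc A (\<alpha> \<circ> \<omega>))))"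
    if s: "\<sigma> permutes A" for \<sigma>
  proof -
    note sinv = permutes_inv[OF s]
    have inv: "inv \<sigma> \<circ> \<sigma> = id" "\<sigma> \<circ> inv \<sigma> = id" using permutes_inv_o[OF s] by auto
    have mem: "\<tau> \<circ> \<omega> \<circ> inv \<tau> \<in> Cl" if t: "\<tau> permutes A" and w: "\<omega> \<in> Cl" for \<tau> \<omega>
    proof -
      have wA: "\<omega> permutes A" using w by (simp add: Cl_def)
      have p: "(\<tau> \<circ> \<omega>) permutes A" using wA t by (rule permutes_compose)
      have "inv \<tau> \<circ> (\<tau> \<circ> \<omega>) = \<omega>" using permutes_inv_o(2)[OF t] by (simp add: o_assoc)
      hence "image_mset card (mset_set (cyc A (\<tau> \<circ> \<omega> \<circ> inv \<tau>))) = \<beta>"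
        using cycle_type_comm[OF assms(1) p permutes_inv[OF t]] w by (simp add: Cl_def)
      thus ?thesis using permutes_compose[OF permutes_inv[OF t] p] by (simp add: Cl_def)
    qed
    have bij: "bij_betw (\<lambda>\<omega>. inv \<sigma> \<circ> \<omega> \<circ> \<sigma>) Cl Cl"
    proof (rule bij_betwI[where g = "\<lambda>\<omega>. \<sigma> \<circ> \<omega> \<circ> inv \<sigma>"])
      show "(\<lambda>\<omega>. inv \<sigma> \<circ> \<omega> \<circ> \<sigma>) \<in> Cl \<rightarrow> Cl" using mem[OF sinv] permutes_inv_inv[OF s] by auto
      show "(\<lambda>\<omega>. \<sigma> \<circ> \<omega> \<circ> inv \<sigma>) \<in> Cl \<rightarrow> Cl" using mem[OF s] by auto
      show "\<sigma> \<circ> (inv \<sigma> \<circ> \<omega> \<circ> \<sigma>) \<circ> inv \<sigma> = \<omega>" for \<omega>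
        using inv by (metis comp_assoc comp_id id_comp)
      show "inv \<sigma> \<circ> (\<sigma> \<circ> \<omega> \<circ> inv \<sigma>) \<circ> \<sigma> = \<omega>" for \<omega>
        using inv by (metis comp_assoc comp_id id_comp)
    qed
    have "card (cyc A (\<sigma> \<circ> \<alpha> \<circ> inv \<sigma> \<circ> \<omega>)) = card (cyc A (\<alpha> \<circ> (inv \<sigma> \<circ> \<omega> \<circ> \<sigma>)))" if "\<omega> \<in> Cl" for \<omega>
    proof -
      have "(\<alpha> \<circ> (inv \<sigma> \<circ> \<omega>)) permutes A"
        using that assms(2) sinv by (intro permutes_compose) (auto simp: Cl_def)
      from card_cyc_comm[OF assms(1) this s] show ?thesis by (simp add: o_assoc)
    qed
    hence "(\<Sum>\<omega>\<in>Cl. power_gf (card (cyc A (\<sigma> \<circ> \<alpha> \<circ> inv \<sigma> \<circ> \<omega>)))) = (\<Sum>\<omega>\<in>Cl. power_gf (card (cyc A (\<alpha> \<circ> (inv \<sigma> \<circ> \<omega> \<circ> \<sigma>)))))"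
      by simp
    also have "\<dots> = (\<Sum>\<omega>\<in>Cl. power_gf (card (cyc A (\<alpha> \<circ> \<omega>))))"
      by (rule sum.reindex_bij_betw[OF bij])
    finally show ?thesis .
  qed
  hence "(\<Sum>\<sigma> | \<sigma> permutes A. \<Sum>\<omega>\<in>Cl. power_gf (card (cyc A (\<sigma> \<circ> \<alpha> \<circ> inv \<sigma> \<circ> \<omega>)))) = 
     (\<Sum>\<sigma> | \<sigma> permutes A. \<Sum>\<omega>\<in>Cl. power_gf (card (cyc A (\<alpha> \<circ> \<omega>))))" by simp
  also have "\<dots> = fact (card A) * (\<Sum>\<omega>\<in>Cl. power_gf (card (cyc A (\<alpha> \<circ> \<omega>))))"
    using card_permutations[OF refl assms(1)] by simp
  finally show ?thesis by (subst sum.swap) simp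
qed

section \<open>The two families of cycle types\<close>

text \<open>After relabelling, the first two entries of an ordering are the points a, b of the
  transposition and the others form the long cycle. The transposition is then moved next to
  omega.\<close>

lemma sum_conj_eq_sum_lists:
  assumes "finite A" "\<omega> permutes A" "cs @ ds \<in> permutations_of_set A" "length cs = 2"
    and \<alpha>: "\<alpha> = cycle_of_list cs \<circ> cycle_of_list ds"
  shows "(\<Sum>\<sigma> | \<sigma> permutes A. power_gf (card (cyc A (\<sigma> \<circ> \<alpha> \<circ> inv \<sigma> \<circ> \<omega>)))) =
    (\<Sum>a\<in>A. \<Sum>b\<in>A - {a}. \<Sum>ys\<in>permutations_of_set (A - {a, b}). 
       power_gf (card (cyc A (cycle_of_list ys \<circ> (\<omega> \<circ> transpose a b)))))"
proof -
  define f where "f xs = power_gf (card (cyc A (cycle_of_list (take 2 xs) \<circ> cycle_of_list (drop 2 xs) \<circ> \<omega>)))" for xs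
  have dist: "distinct cs" "distinct ds" "set cs \<union> set ds = A" 
    using assms(3) by (auto simp: permutations_of_set_def)
  have "\<sigma> \<circ> \<alpha> \<circ> inv \<sigma> = cycle_of_list (take 2 (map \<sigma> (cs @ ds))) \<circ> cycle_of_list (drop 2 (map \<sigma> (cs @ ds)))"
    if "\<sigma> permutes A" for \<sigma>
  proof -
    have bij: "bij \<sigma>" using that by (rule permutes_bij)
    have "inv \<sigma> \<circ> \<sigma> = id" using permutes_inv_o[OF that] by simp
    hence "\<sigma> \<circ> \<alpha> \<circ> inv \<sigma> = (\<sigma> \<circ> cycle_of_list cs \<circ> inv \<sigma>) \<circ> (\<sigma> \<circ> cycle_of_list ds \<circ> inv \<sigma>)"
      unfolding \<alpha> by (metis comp_assoc comp_id)
    thus ?thesis unfolding conjugation_of_cycle[OF dist(1) bij] conjugation_of_cycle[OF dist(2) bij]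
      using assms(4) by simp
  qed
  hence "(\<Sum>\<sigma> | \<sigma> permutes A. power_gf (card (cyc A (\<sigma> \<circ> \<alpha> \<circ> inv \<sigma> \<circ> \<omega>)))) = (\<Sum>\<sigma> | \<sigma> permutes A. f (map \<sigma> (cs @ ds)))"
    by (simp add: f_def)
  also have "\<dots> = (\<Sum>xs\<in>permutations_of_set A. f xs)"
    by (rule sum_permutes_map[OF assms(1,3)])
  also have "\<dots> = (\<Sum>a\<in>A. \<Sum>ys\<in>permutations_of_set (A - {a}). f (a # ys))"
    using assms(4) dist by (intro sum_permutations_of_set_Cons assms(1)) auto
  also have "\<dots> = (\<Sum>a\<in>A. \<Sum>b\<in>A - {a}. \<Sum>ys\<in>permutations_of_set (A - {a, b}). f (a # b # ys))"
  proof (rule sum.cong)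
    fix a assume a: "a \<in> A"
    have "card A \<ge> 2" using assms(1,4) dist(1) dist(3) by (metis Un_upper1 card_mono distinct_card)
    hence "card (A - {a}) \<noteq> 0" using a assms(1) by simp
    hence "A - {a} \<noteq> {}" by force
    moreover have "A - {a} - {b} = A - {a, b}" for b by auto
    ultimately show "(\<Sum>ys\<in>permutations_of_set (A - {a}). f (a # ys)) = (\<Sum>b\<in>A - {a}. \<Sum>ys\<in>permutations_of_set (A - {a, b}). f (a # b # ys))"
      using sum_permutations_of_set_Cons[of "A - {a}" "\<lambda>ys. f (a # ys)"] assms(1) by simp
  qed simp
  also have "\<dots> = (\<Sum>a\<in>A. \<Sum>b\<in>A - {a}. \<Sum>ys\<in>permutations_of_set (A - {a, b}). 
       power_gf (card (cyc A (cycle_of_list ys \<circ> (\<omega> \<circ> transpose a b)))))"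
  proof (intro sum.cong refl)
    fix a b ys assume ab: "a \<in> A" "b \<in> A - {a}" and ys: "ys \<in> permutations_of_set (A - {a, b})"
    have t: "transpose a b permutes A" using ab by (simp add: permutes_swap_id)
    have "cycle_of_list ys permutes A" using cycle_of_list_permutes[OF ys] by (rule permutes_subset) auto
    hence c: "(cycle_of_list ys \<circ> \<omega>) permutes A" using assms(2) by (simp add: permutes_compose)
    show "f (a # b # ys) = power_gf (card (cyc A (cycle_of_list ys \<circ> (\<omega> \<circ> transpose a b))))"
      using card_cyc_comm[OF assms(1) c t] by (simp add: f_def numeral_2_eq_2 o_assoc)
  qed
  finally show ?thesis .
qed

text \<open>Here omega, not alpha, is conjugated: its fixed point becomes the head of an ordering of
  A and the tail is its long cycle.\<close>

lemma sum_conj_eq_sum_remove: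
  assumes "finite A" "\<alpha> permutes A" "cs @ ds \<in> permutations_of_set A" "length cs = 1"
    and \<omega>: "\<omega> = cycle_of_list cs \<circ> cycle_of_list ds"
  shows "(\<Sum>\<sigma> | \<sigma> permutes A. power_gf (card (cyc A (\<sigma> \<circ> \<alpha> \<circ> inv \<sigma> \<circ> \<omega>)))) =
    (\<Sum>a\<in>A. \<Sum>ys\<in>permutations_of_set (A - {a}). power_gf (card (cyc A (cycle_of_list ys \<circ> \<alpha>))))"
proof -
  define f where "f xs = power_gf (card (cyc A (\<alpha> \<circ> cycle_of_list (tl xs))))" for xs
  have dist: "distinct cs" "distinct ds" "set cs \<union> set ds = A" 
    using assms(3) by (auto simp: permutations_of_set_def)
  obtain a0 where cs: "cs = [a0]" using assms(4) by (auto simp: length_Suc_conv)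
  have \<omega>': "\<omega> = cycle_of_list ds" by (simp add: \<omega> cs)
  have wA: "\<omega> permutes A" unfolding \<omega>' using cycle_permutes[of ds] by (rule permutes_subset) (use dist in auto)
  have "(\<Sum>\<sigma> | \<sigma> permutes A. power_gf (card (cyc A (\<sigma> \<circ> \<alpha> \<circ> inv \<sigma> \<circ> \<omega>)))) =
     (\<Sum>\<sigma> | \<sigma> permutes A. power_gf (card (cyc A (\<alpha> \<circ> (inv \<sigma> \<circ> \<omega> \<circ> \<sigma>)))))"
  proof (rule sum.cong)
    fix \<sigma> assume "\<sigma> \<in> {\<sigma>. \<sigma> permutes A}"
    hence s: "\<sigma> permutes A" by simp
    have "(\<alpha> \<circ> (inv \<sigma> \<circ> \<omega>)) permutes A"
      using assms(2) wA permutes_inv[OF s] by (intro permutes_compose)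
    from card_cyc_comm[OF assms(1) this s] 
    show "power_gf (card (cyc A (\<sigma> \<circ> \<alpha> \<circ> inv \<sigma> \<circ> \<omega>))) = power_gf (card (cyc A (\<alpha> \<circ> (inv \<sigma> \<circ> \<omega> \<circ> \<sigma>))))"
      by (simp add: o_assoc)
  qed simp
  \<comment> \<open>Conjugation has moved to omega with the inverse of sigma; reindexing by inverses
    turns it into a relabelling by sigma.\<close>
  also have "\<dots> = (\<Sum>\<sigma> | \<sigma> permutes A. power_gf (card (cyc A (\<alpha> \<circ> (inv (inv \<sigma>) \<circ> \<omega> \<circ> inv \<sigma>)))))"
    by (rule sum_permutations_inverse)
  also have "\<dots> = (\<Sum>\<sigma> | \<sigma> permutes A. f (map \<sigma> (cs @ ds)))"
  proof (rule sum.cong)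
    fix \<sigma> assume "\<sigma> \<in> {\<sigma>. \<sigma> permutes A}"
    hence s: "\<sigma> permutes A" by simp
    have "inv (inv \<sigma>) \<circ> \<omega> \<circ> inv \<sigma> = cycle_of_list (map \<sigma> ds)"
      unfolding \<omega>' permutes_inv_inv[OF s] by (rule conjugation_of_cycle[OF dist(2) permutes_bij[OF s]])
    thus "power_gf (card (cyc A (\<alpha> \<circ> (inv (inv \<sigma>) \<circ> \<omega> \<circ> inv \<sigma>)))) = f (map \<sigma> (cs @ ds))"
      by (simp add: f_def cs)
  qed simp
  also have "\<dots> = (\<Sum>xs\<in>permutations_of_set A. f xs)"
    by (rule sum_permutes_map[OF assms(1,3)])
  also have "\<dots> = (\<Sum>a\<in>A. \<Sum>ys\<in>permutations_of_set (A - {a}). f (a # ys))"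
    using dist cs by (intro sum_permutations_of_set_Cons assms(1)) auto
  also have "\<dots> = (\<Sum>a\<in>A. \<Sum>ys\<in>permutations_of_set (A - {a}). power_gf (card (cyc A (cycle_of_list ys \<circ> \<alpha>))))"
  proof (intro sum.cong refl)
    fix a ys assume ys: "ys \<in> permutations_of_set (A - {a})"
    have "cycle_of_list ys permutes A" using cycle_of_list_permutes[OF ys] by (rule permutes_subset) auto
    thus "f (a # ys) = power_gf (card (cyc A (cycle_of_list ys \<circ> \<alpha>)))"
      using card_cyc_comm[OF assms(1) assms(2)] by (simp add: f_def)
  qed
  finally show ?thesis .
qed

text \<open>The deleted point lies on the 2-cycle of alpha in 2 cases, leaving a fixed point with
  factor 1, and on the (n - 2)-cycle in n - 2 cases. For n = 3 the latter is itself a fixed point,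
  hence \<open>theta\<close>.\<close>

lemma sum_remove_two_cycles:
  assumes "finite A" "\<alpha> permutes A" "image_mset card (mset_set (cyc A \<alpha>)) = {#2, n - 2#}" "card A = n" "n \<ge> 3"
  shows "(\<Sum>a\<in>A. \<Sum>ys\<in>permutations_of_set (A - {a}). power_gf (card (cyc A (cycle_of_list ys \<circ> \<alpha>)))) =
    2 * (fact (n - 1) * base_gf * cyc_gf (n - 2)) + of_nat (n - 2) * (if n = 3 then theta (fact (n - 1) * base_gf * cyc_gf 2) else fact (n - 1) * base_gf * (cyc_gf 2 * cyc_gf (n - 3)))"
proof -
  have perm: "permutation \<alpha>" using assms by (intro permutes_permutation)
  define c :: "complex fls" where "c = fact (n - 1)"
  obtain C D where CD: "cyc A \<alpha> = {C, D}" "C \<noteq> D" "card C = 2" "card D = n - 2"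
    using two_cycles[OF assms(1-3)] .
  have g1: "cyc_gf 1 = 1" using one_minus_fls_X_nonzero[where 'a = complex] by (simp add: cyc_gf_def)
  define h where "h E = (if card E = 1 then theta (c * base_gf * cycles_gf (cyc A \<alpha> - {E}))
     else c * base_gf * (cycles_gf (cyc A \<alpha> - {E}) * cyc_gf (card E - 1)))" for E
  have "(\<Sum>a\<in>A. \<Sum>ys\<in>permutations_of_set (A - {a}). power_gf (card (cyc A (cycle_of_list ys \<circ> \<alpha>)))) = (\<Sum>a\<in>A. h (orbit \<alpha> a))"
  proof (rule sum.cong)
    fix a assume a: "a \<in> A"
    have "card (A - {a}) = n - 1" using a assms by simp
    moreover from this have "A - {a} \<noteq> {}" using assms(5) by force
    ultimately have IH: "long_cycle_sum (A - {a}) p = c * base_gf * cycles_gf (cyc (A - {a}) p)" if "p permutes (A - {a})" for p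
      using long_cycle_sum_eq[OF _ that] assms(1) by (simp add: c_def)
    show "(\<Sum>ys\<in>permutations_of_set (A - {a}). power_gf (card (cyc A (cycle_of_list ys \<circ> \<alpha>)))) = h (orbit \<alpha> a)"
      unfolding h_def by (rule sum_power_gf_remove_eq[OF assms(1,2) a IH])
  qed simp
  also have "\<dots> = (\<Sum>E\<in>cyc A \<alpha>. \<Sum>a\<in>E. h (orbit \<alpha> a))" by (rule sum_over_cyc[OF assms(1,2)])
  also have "\<dots> = (\<Sum>E\<in>cyc A \<alpha>. of_nat (card E) * h E)"
  proof (rule sum.cong)
    fix E assume E: "E \<in> cyc A \<alpha>"
    hence "h (orbit \<alpha> a) = h E" if "a \<in> E" for a using cyc_eq_orbit[OF perm E that] by simp
    thus "(\<Sum>a\<in>E. h (orbit \<alpha> a)) = of_nat (card E) * h E" by simp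
  qed simp
  also have "\<dots> = 2 * h C + of_nat (n - 2) * h D" using CD by simp
  also have "h C = c * base_gf * cyc_gf (n - 2)"
  proof -
    have "cyc A \<alpha> - {C} = {D}" using CD(1,2) by auto
    thus ?thesis unfolding h_def CD(3) using g1 by (simp add: cycles_gf_def CD(4))
  qed
  also have "h D = (if n = 3 then theta (c * base_gf * cyc_gf 2) else c * base_gf * (cyc_gf 2 * cyc_gf (n - 3)))"
  proof -
    have "cyc A \<alpha> - {D} = {C}" using CD(1,2) by auto
    moreover have "n - 2 = 1 \<longleftrightarrow> n = 3" "n - 2 - 1 = n - 3" using assms(5) by auto
    ultimately show ?thesis unfolding h_def CD(4) by (simp only: cycles_gf_def) (simp add: CD(3))
  qed
  finally show ?thesis unfolding c_def .
qed

section \<open>From generating functions back to polynomials\<close>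

lemma poly_eqI_of_nat:
  fixes p q :: "complex poly"
  assumes "\<And>N. N \<ge> N0 \<Longrightarrow> poly p (of_nat N) = poly q (of_nat N)"
  shows "p = q"
proof (rule ccontr)
  assume "p \<noteq> q"
  hence "finite {x. poly (p - q) x = 0}" by (intro poly_roots_finite) simp
  moreover have "of_nat ` {N0..} \<subseteq> {x. poly (p - q) x = 0}" using assms by auto
  ultimately have "finite (of_nat ` {N0..} :: complex set)" using finite_subset by blast
  moreover have "inj_on (of_nat :: nat \<Rightarrow> complex) {N0..}" by (simp add: inj_on_def)
  ultimately show False using finite_imageD infinite_Ici by blast
qed

lemma fps_to_fls_sum: "fps_to_fls (\<Sum>x\<in>S. f x) = (\<Sum>x\<in>S. fps_to_fls (f x))"
  by (induction S rule: infinite_finite_induct) simp_all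

text \<open>Two polynomials that agree up to scalars at all large natural numbers are proportional,
  so H has the zeros of the sum over the class. H is nonzero because that sum takes the value
  \<open>card Cl\<close> at 1.\<close>

lemma root_transfer:
  fixes Cl :: "'b set" and H :: "complex poly"
  assumes "finite Cl" "Cl \<noteq> {}"
    and eq: "fact n * (\<Sum>\<omega>\<in>Cl. power_gf (k \<omega>)) = of_nat (card Cl) * fps_to_fls R"
    and R: "\<And>N. N \<ge> N0 \<Longrightarrow> fps_nth R N = poly H (of_nat N)"
    and z: "poly (\<Sum>\<omega>\<in>Cl. monom 1 (k \<omega>)) z = 0"
  shows "poly H z = 0" "H \<noteq> 0"
proof -
  define S where "S = (\<Sum>\<omega>\<in>Cl. monom (1 :: complex) (k \<omega>))"
  have sumX: "(\<Sum>\<omega>\<in>Cl. power_gf (k \<omega>)) = fps_to_fls (Abs_fps (\<lambda>N. poly S (of_nat N)))"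
  proof -
    have "(\<Sum>\<omega>\<in>Cl. power_gf (k \<omega>)) = fps_to_fls (\<Sum>\<omega>\<in>Cl. Abs_fps (\<lambda>N. of_nat N ^ k \<omega>))"
      unfolding power_gf_def by (rule fps_to_fls_sum[symmetric])
    also have "(\<Sum>\<omega>\<in>Cl. Abs_fps (\<lambda>N. of_nat N ^ k \<omega> :: complex)) = Abs_fps (\<lambda>N. poly S (of_nat N))"
      by (rule fps_ext) (simp add: fps_sum_nth S_def poly_sum poly_monom)
    finally show ?thesis .
  qed
  have f: "fact n = (fps_to_fls (of_nat (fact n)) :: complex fls)" "of_nat (card Cl) = (fps_to_fls (of_nat (card Cl)) :: complex fls)"
    by (simp_all only: fps_to_fls_of_nat) (simp only: of_nat_fact)
  have "fps_to_fls (of_nat (fact n) * Abs_fps (\<lambda>N. poly S (of_nat N))) = fps_to_fls (of_nat (card Cl) * R)"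
    using eq unfolding sumX f by (simp only: fls_times_fps_to_fls)
  hence "of_nat (fact n) * Abs_fps (\<lambda>N. poly S (of_nat N)) = of_nat (card Cl) * R" by (simp only: fps_to_fls_eq_iff)
  hence "fps_nth (of_nat (fact n) * Abs_fps (\<lambda>N. poly S (of_nat N))) N = fps_nth (of_nat (card Cl) * R) N" for N by simp
  hence co: "of_nat (fact n) * poly S (of_nat N) = of_nat (card Cl) * fps_nth R N" for N
    by (simp del: of_nat_fact flip: fps_of_nat)
  have *: "smult (of_nat (fact n)) S = smult (of_nat (card Cl)) H"
    by (rule poly_eqI_of_nat[of N0]) (simp add: co R del: of_nat_fact)
  have cl: "of_nat (card Cl) \<noteq> (0 :: complex)" using assms(1,2) by simp
  have "of_nat (card Cl) * poly H z = of_nat (fact n) * poly S z" using arg_cong[OF *, of "\<lambda>p. poly p z"] by simp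
  thus "poly H z = 0" using z cl by (simp add: S_def)
  have "poly S 1 = of_nat (card Cl)" by (simp add: S_def poly_sum poly_monom)
  hence "poly S 1 \<noteq> 0" using cl by simp
  hence "smult (of_nat (fact n)) S \<noteq> 0" by auto
  thus "H \<noteq> 0" unfolding * by auto
qed

text \<open>The numerator prod (1 - z^b). Its roots are roots of unity, and they are the parameters
  rho of the shift operators.\<close>

definition cycle_type_poly :: "nat multiset \<Rightarrow> complex poly" where
  "cycle_type_poly \<beta> = (\<Prod>b\<in>#\<beta>. 1 + monom (-1) b)"

lemma degree_one_plus_monom: "b > 0 \<Longrightarrow> degree (1 + monom (-1 :: complex) b) = b"
  by (subst degree_add_eq_right) (simp_all add: degree_monom_eq)

lemma cycle_type_poly_props:
  assumes "\<forall>b\<in>#\<beta>. b > 0"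
  shows "degree (cycle_type_poly \<beta>) = sum_mset \<beta>" "cycle_type_poly \<beta> \<noteq> 0" "poly (cycle_type_poly \<beta>) \<rho> = 0 \<Longrightarrow> norm \<rho> = 1"
    "fps_to_fls (fps_of_poly (cycle_type_poly \<beta>)) = (1 - fls_X) ^ sum_mset \<beta> * (\<Prod>b\<in>#\<beta>. cyc_gf b)"
proof -
  have "degree (cycle_type_poly \<beta>) = sum_mset \<beta> \<and> cycle_type_poly \<beta> \<noteq> 0 \<and> (poly (cycle_type_poly \<beta>) \<rho> = 0 \<longrightarrow> norm \<rho> = 1) \<and>
    fps_to_fls (fps_of_poly (cycle_type_poly \<beta>)) = (1 - fls_X) ^ sum_mset \<beta> * (\<Prod>b\<in>#\<beta>. cyc_gf b)"
    using assms
  proof (induction \<beta>)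
    case (add b \<beta>)
    have b: "b > 0" using add.prems by simp
    have nz: "1 + monom (-1 :: complex) b \<noteq> 0" using degree_one_plus_monom[OF b] b by auto
    have cp: "cycle_type_poly (add_mset b \<beta>) = (1 + monom (-1) b) * cycle_type_poly \<beta>" by (simp add: cycle_type_poly_def)
    have "norm \<rho> = 1" if "poly (1 + monom (-1 :: complex) b) \<rho> = 0"
    proof -
      have "\<rho> ^ b = 1" using that by (simp add: poly_monom)
      hence "norm \<rho> ^ b = 1" by (metis norm_one norm_power)
      thus ?thesis using b power_eq_imp_eq_base[of "norm \<rho>" b 1] by simp
    qed
    moreover have "fps_of_poly (1 + monom (-1 :: complex) b) = 1 - fps_X ^ b"
      by (rule fps_ext) (auto simp: fps_X_power_iff)
    hence "fps_to_fls (fps_of_poly (1 + monom (-1 :: complex) b)) = fps_to_fls (1 - fps_X ^ b)"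
      by (simp only:)
    hence "fps_to_fls (fps_of_poly (1 + monom (-1 :: complex) b)) = 1 - fls_X ^ b"
      unfolding fps_to_fls_minus fps_to_fls_power by simp
    hence "fps_to_fls (fps_of_poly (1 + monom (-1 :: complex) b)) = (1 - fls_X) ^ b * cyc_gf b"
      using one_minus_fls_X_nonzero[where 'a = complex] by (simp add: cyc_gf_def)
    ultimately show ?case using add nz unfolding cp
      by (auto simp: degree_mult_eq degree_one_plus_monom fps_of_poly_mult fls_times_fps_to_fls power_add)
  qed (simp add: cycle_type_poly_def)
  thus "degree (cycle_type_poly \<beta>) = sum_mset \<beta>" "cycle_type_poly \<beta> \<noteq> 0" "poly (cycle_type_poly \<beta>) \<rho> = 0 \<Longrightarrow> norm \<rho> = 1"
    "fps_to_fls (fps_of_poly (cycle_type_poly \<beta>)) = (1 - fls_X) ^ sum_mset \<beta> * (\<Prod>b\<in>#\<beta>. cyc_gf b)" by auto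
qed

lemma fps_to_fls_rise_fps: "fps_to_fls (rise_fps r) = fact r / (1 - fls_X) ^ Suc r"
proof -
  have "fps_to_fls ((1 - fps_X) ^ Suc r * rise_fps r) = fps_to_fls (of_nat (fact r))"
    unfolding rise_fps_eq by simp
  hence "(1 - fls_X) ^ Suc r * fps_to_fls (rise_fps r) = of_nat (fact r)"
    unfolding fls_times_fps_to_fls fps_to_fls_power fps_to_fls_of_nat by simp
  thus ?thesis using one_minus_fls_X_nonzero[where 'a = complex]
    by (simp add: eq_divide_eq mult.commute)
qed

text \<open>The factor 1 - z lowers the exponent of the denominator from n to n - 1, and (n - 2)! /
  (1 - z)^(n-1) is the series of \<open>rise (n - 2)\<close>.\<close>

lemma second_deriv_gf_eq:
  assumes "n \<ge> 3" "\<forall>b\<in>#\<beta>. b > 0" "sum_mset \<beta> = n"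
  defines "K \<equiv> fps_of_poly (cycle_type_poly \<beta>) * rise_fps (n - 2)"
  shows "fact (n - 2) * (fls_X * (1 + fls_X) * fls_deriv (fls_deriv ((1 - fls_X) * (\<Prod>b\<in>#\<beta>. cyc_gf b)))) =
     fps_to_fls (fps_X * (1 + fps_X) * fps_deriv (fps_deriv K))"
proof -
  have nz: "1 - fls_X \<noteq> (0 :: complex fls)" by (rule one_minus_fls_X_nonzero)
  have n: "n = Suc (Suc (n - 2))" using assms(1) by simp
  have "fps_to_fls K = (1 - fls_X) ^ n * (\<Prod>b\<in>#\<beta>. cyc_gf b) * (fact (n - 2) / (1 - fls_X) ^ Suc (n - 2))"
    unfolding K_def fls_times_fps_to_fls fps_to_fls_rise_fps cycle_type_poly_props(4)[OF assms(2)] assms(3) ..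
  also have "(1 - fls_X) ^ n = (1 - fls_X) * (1 - fls_X :: complex fls) ^ Suc (n - 2)"
    by (subst n) (rule power_Suc)
  finally have K: "fps_to_fls K = of_nat (fact (n - 2)) * ((1 - fls_X) * (\<Prod>b\<in>#\<beta>. cyc_gf b))"
    using nz by simp
  have D: "fls_deriv (of_nat k * f) = of_nat k * fls_deriv f" for k and f :: "complex fls"
    by simp
  have "fps_to_fls (fps_X * (1 + fps_X) * fps_deriv (fps_deriv K)) = fls_X * (1 + fls_X) * fls_deriv (fls_deriv (fps_to_fls K))"
    by (simp add: fls_times_fps_to_fls fls_deriv_fps_to_fls)
  thus ?thesis unfolding K D by (simp add: mult_ac)
qed

text \<open>The coefficient of z^N in z (1 + z) K'' is N (N + 1) K_(N+1) + (N - 1) N K_N, where K_j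
  denotes the coefficients of K.\<close>

lemma second_deriv_gf_coeff:
  fixes Q :: "complex poly"
  assumes Q: "\<And>N. N \<ge> n \<Longrightarrow> poly Q (of_nat N) = fps_nth K N" and "N \<ge> n + 2"
  shows "fps_nth (fps_X * (1 + fps_X) * fps_deriv (fps_deriv K)) N = 
     poly ([:0, 1:] * ([:1, 1:] * pcompose Q [:1, 1:] + [:-1, 1:] * Q)) (of_nat N)"
proof -
  define E where "E = fps_deriv (fps_deriv K)"
  obtain M where N: "N = Suc (Suc M)" using assms(2) by (cases N; cases "N - 1") auto
  define x :: complex where "x = of_nat N"
  have x: "of_nat (Suc M) = x - 1" "of_nat (Suc (Suc M)) = x" "of_nat (Suc (Suc (Suc M))) = x + 1"
    by (simp_all add: N x_def)
  have E: "fps_nth E j = of_nat (Suc j) * (of_nat (Suc (Suc j)) * fps_nth K (Suc (Suc j)))" for j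
    by (simp add: E_def)
  have K: "fps_nth K (Suc (Suc M)) = poly Q x" "fps_nth K (Suc (Suc (Suc M))) = poly Q (x + 1)"
    using Q[of "Suc (Suc M)"] Q[of "Suc (Suc (Suc M))"] assms(2) unfolding x by (simp_all add: N)
  have "fps_nth (fps_X * (1 + fps_X) * E) N = fps_nth E (Suc M) + fps_nth E M"
    by (simp add: N mult.assoc distrib_right)
  also have "\<dots> = x * ((x + 1) * poly Q (x + 1)) + (x - 1) * (x * poly Q x)"
    unfolding E K x ..
  also have "\<dots> = poly ([:0, 1:] * ([:1, 1:] * pcompose Q [:1, 1:] + [:-1, 1:] * Q)) (of_nat N)"
    unfolding x_def[symmetric] by (simp add: poly_pcompose algebra_simps)
  finally show ?thesis unfolding E_def .
qed

text \<open>There are n shifts, one for each root of the numerator, and only n - 2 separate zeros.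
  So these all disappear, and the line ends at (n - (n - 2) - 1)/2 = 1/2.\<close>

lemma coeff_poly_roots_on_line:
  assumes "n \<ge> 3" "\<forall>b\<in>#\<beta>. b > 0" "sum_mset \<beta> = n"
  obtains Q where "\<And>N. N \<ge> n \<Longrightarrow> poly Q (of_nat N) = fps_nth (fps_of_poly (cycle_type_poly \<beta>) * rise_fps (n - 2)) N"
    "Q = 0 \<or> roots_on_line (1 / 2) Q"
proof -
  define G where "G = cycle_type_poly \<beta>"
  note G = cycle_type_poly_props[OF assms(2), folded G_def]
  obtain rs where rs: "G = smult (lead_coeff G) (\<Prod>r\<leftarrow>rs. [:-r, 1:])" "length rs = degree G"
      "G \<noteq> 0 \<longrightarrow> set rs = {r. poly G r = 0}"
    by (rule poly_eq_prod_roots[of G])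
  have len: "length rs = n" using rs(2) G(1) assms(3) by simp
  have "norm \<rho> = 1" if "\<rho> \<in> set rs" for \<rho> using rs(3) G(2,3) that by auto
  from foldr_shift_op_rise[of rs "n - 2", OF this] obtain A where
    A: "foldr shift_op rs (rise (n - 2)) = rise (n - 2 - length rs) * A"
      "A = 0 \<or> roots_on_line ((real (length rs) - real (n - 2) - 1) / 2) A" by auto
  have "(real (length rs) - real (n - 2) - 1) / 2 = 1 / 2" using len assms(1) by (simp add: of_nat_diff)
  hence A': "foldr shift_op rs (rise (n - 2)) = A" "A = 0 \<or> roots_on_line (1 / 2) A"
    using A len by simp_all
  \<comment> \<open>The shifts account for the monic polynomial with the roots of G; the leading
    coefficient of G is restored here.\<close>
  define Q where "Q = smult (lead_coeff G) A"
  have "poly Q (of_nat N) = fps_nth (fps_of_poly G * rise_fps (n - 2)) N" if "N \<ge> n" for N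
  proof -
    have eqG: "fps_of_poly G = fps_const (lead_coeff G) * fps_of_poly (\<Prod>r\<leftarrow>rs. [:-r, 1:])"
      by (subst rs(1)) (simp add: fps_of_poly_smult)
    have "poly A (of_nat N) = fps_nth (fps_of_poly (\<Prod>\<rho>\<leftarrow>rs. [:-\<rho>, 1:]) * rise_fps (n - 2)) N"
      unfolding A'(1)[symmetric] using that len by (intro foldr_shift_op_coeff) (simp_all add: rise_fps_def)
    thus ?thesis unfolding eqG Q_def by (simp only: poly_smult mult.assoc fps_mult_left_const_nth)
  qed
  moreover have "Q = 0 \<or> roots_on_line (1 / 2) Q"
    using A'(2) G(2) by (auto simp: Q_def roots_on_line_def)
  ultimately show ?thesis using that unfolding G_def by blast
qed

section \<open>Zeros for the cycle type [1, n-1]\<close>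

lemma norm_rise_minus_le:
  assumes "Re z > 0"
  shows "norm (poly (rise m) (- z)) \<le> norm (poly (rise m) z)" "poly (rise m) z \<noteq> 0"
proof -
  have *: "norm (- z + of_nat i) \<le> norm (z + of_nat i)" for i
  proof -
    have "0 \<le> Re z * real i" using assms by simp
    thus ?thesis using norm_less_norm_iff[of "z + of_nat i" "- z + of_nat i"]
      by (simp add: not_less[symmetric] power2_eq_square algebra_simps)
  qed
  show "norm (poly (rise m) (- z)) \<le> norm (poly (rise m) z)"
    unfolding poly_rise prod_norm[symmetric] using * by (intro prod_mono) simp
  have "z + of_nat i \<noteq> 0" for i
  proof
    assume "z + of_nat i = 0"
    hence "Re (z + of_nat i) = 0" by simp
    thus False using assms by simp
  qed
  thus "poly (rise m) z \<noteq> 0" unfolding poly_rise by simp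
qed

lemma hook_root_aux:
  assumes "Re z > 0" 
  shows "norm ((2 * - z + of_nat (Suc m)) * poly (rise m) (- z)) < norm ((2 * z + of_nat (Suc m)) * poly (rise m) z)"
proof -
  have "norm (2 * - z + of_nat (Suc m)) < norm (2 * z + of_nat (Suc m))"
    using assms unfolding norm_less_norm_iff
    by (simp add: power2_eq_square algebra_simps) (intro add_pos_nonneg, simp_all)
  moreover note norm_rise_minus_le[OF assms, of m]
  ultimately show ?thesis unfolding norm_mult
    by (smt (verit) mult_less_cancel_right mult_left_mono norm_ge_zero zero_less_norm_iff)
qed

text \<open>With g(z) = (2 z + m + 1) \<open>rise m\<close> (z), a nonzero zero satisfies |g(z)| =
  |g(-z)|. In the right half plane z + i is at least as large as -z + i for all i >= 0, and the
  linear factor makes the comparison strict.\<close>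

lemma hook_root:
  assumes "z * ((2 * z + of_nat (Suc m)) * poly (rise m) z + (-1) ^ m * ((2 * - z + of_nat (Suc m)) * poly (rise m) (- z))) = 0"
  shows "Re z = 0"
proof (cases "z = 0")
  case False
  hence "(2 * z + of_nat (Suc m)) * poly (rise m) z = - ((-1) ^ m * ((2 * - z + of_nat (Suc m)) * poly (rise m) (- z)))"
    using assms by (simp add: add_eq_0_iff)
  hence "norm ((2 * z + of_nat (Suc m)) * poly (rise m) z) = norm (- ((-1) ^ m * ((2 * - z + of_nat (Suc m)) * poly (rise m) (- z))))"
    by (simp only:)
  also have "\<dots> = norm ((2 * - z + of_nat (Suc m)) * poly (rise m) (- z))"
    by (simp only: norm_minus_cancel norm_mult norm_power) simp
  finally have eq: "norm ((2 * z + of_nat (Suc m)) * poly (rise m) z) = norm ((2 * - z + of_nat (Suc m)) * poly (rise m) (- z))" .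
  show ?thesis
    using hook_root_aux[of z m] hook_root_aux[of "- z" m] eq by (cases "Re z" "0 :: real" rule: linorder_cases) auto
qed simp

text \<open>The arguments x - k, ..., x - 1 read backwards. This turns large shifts into values at
  -x.\<close>

lemma rise_reflect: "poly (rise k) (x - of_nat (Suc k)) = (-1) ^ k * poly (rise k) (- x)"
proof -
  have "poly (rise k) (x - of_nat (Suc k)) = (\<Prod>i=1..k. x - of_nat (Suc k - i))"
    unfolding poly_rise by (intro prod.cong) (auto simp: of_nat_diff)
  also have "\<dots> = (\<Prod>i=1..k. x - of_nat i)"
    by (rule prod.reindex_bij_witness[of _ "\<lambda>i. Suc k - i" "\<lambda>i. Suc k - i"]) auto
  also have "\<dots> = (\<Prod>i=1..k. (-1) * (- x + of_nat i))" by (intro prod.cong) auto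
  also have "\<dots> = (-1) ^ k * poly (rise k) (- x)"
    unfolding poly_rise prod.distrib by simp
  finally show ?thesis .
qed

text \<open>The two small shifts are multiples of x \<open>rise m\<close> (x), with coefficients
  that add up to (m + 2)(2 x + m + 1). Reflection makes the two large shifts the same expression at
  -x.\<close>

lemma hook_poly_eq:
  fixes x :: complex and m :: nat
  defines "r \<equiv> poly (rise (Suc (Suc m)))"
  shows "of_nat (m + 3) * r (x - 1) + of_nat (m + 1) * r (x - 2) - of_nat (m + 1) * r (x - of_nat (m + 1)) - of_nat (m + 3) * r (x - of_nat (m + 2))
    = of_nat (m + 2) * (x * ((2 * x + of_nat (Suc m)) * poly (rise m) x + (-1) ^ m * ((2 * - x + of_nat (Suc m)) * poly (rise m) (- x))))"
proof -
  have r1: "r (y - 1) = y * ((y + of_nat (Suc m)) * poly (rise m) y)" for y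
    unfolding r_def poly_rise_Suc_minus_1 by (simp add: rise_Suc algebra_simps)
  have r2: "r (y - 2) = (y - 1) * (y * poly (rise m) y)" for y
    using poly_rise_Suc_minus_1[of "Suc m" "y - 1"] poly_rise_Suc_minus_1[of m y] unfolding r_def by (simp add: algebra_simps)
  have e: "x + 2 - of_nat (Suc (Suc (Suc m))) = x - of_nat (m + 1)" "- (x + 2) = - x - 2"
    "x + 1 - of_nat (Suc (Suc (Suc m))) = x - of_nat (m + 2)" "- (x + 1) = - x - 1" by simp_all
  have r3: "r (x - of_nat (m + 1)) = (-1) ^ m * r (- x - 2)"
    using rise_reflect[of "Suc (Suc m)" "x + 2"] unfolding r_def e by simp
  have r4: "r (x - of_nat (m + 2)) = (-1) ^ m * r (- x - 1)"
    using rise_reflect[of "Suc (Suc m)" "x + 1"] unfolding r_def e by simp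
  show ?thesis unfolding r3 r4 r2 r1 by (simp add: algebra_simps)
qed

section \<open>The two cases put together\<close>

lemma cycle_class_eq: "cycle_class n \<beta> = {p. p permutes {1..n} \<and> image_mset card (mset_set (cyc {1..n} p)) = \<beta>}"
  by (simp add: cycle_class_def perm_cycle_type_def perm_cycles_eq_cyc)

lemma cycles_gf_eq_prod_mset:
  "cycles_gf S = (\<Prod>b\<in>#image_mset card (mset_set S). cyc_gf b)"
  by (simp add: cycles_gf_def prod_unfold_prod_mset image_mset.compositionality o_def)

lemma big_cycles_root:
  fixes \<beta> :: "nat multiset"
  assumes "n \<ge> 3" and \<alpha>: "\<alpha> \<in> cycle_class n {#2, n - 2#}" and \<beta>: "\<forall>b\<in>#\<beta>. b \<ge> 3" "sum_mset \<beta> = n"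
    and ne: "finite (cycle_class n \<beta>)" "cycle_class n \<beta> \<noteq> {}"
    and z: "poly (\<Sum>\<omega>\<in>cycle_class n \<beta>. monom 1 (card (cyc {1..n} (\<alpha> \<circ> \<omega>)))) z = 0"
  shows "Re z = 0"
proof -
  define A where "A = {1..n}"
  define Cl where "Cl = cycle_class n \<beta>"
  have Cl: "Cl = {p. p permutes A \<and> image_mset card (mset_set (cyc A p)) = \<beta>}"
    by (simp add: Cl_def A_def cycle_class_eq)
  have finA: "finite A" and crdA: "card A = n" by (simp_all add: A_def)
  have pos: "\<forall>b\<in>#\<beta>. b > 0" using \<beta>(1) by fastforce
  have aA: "\<alpha> permutes A" "image_mset card (mset_set (cyc A \<alpha>)) = {#2, n - 2#}"
    using \<alpha> by (simp_all add: cycle_class_eq A_def)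
  obtain cs ds where cd: "\<alpha> = cycle_of_list cs \<circ> cycle_of_list ds" "cs @ ds \<in> permutations_of_set A" "length cs = 2"
    using two_cycles_lists[OF finA aA] by metis
  define K where "K = fps_of_poly (cycle_type_poly \<beta>) * rise_fps (n - 2)"
  define R where "R = fps_X * (1 + fps_X) * fps_deriv (fps_deriv K)"
  \<comment> \<open>The sum over conjugates depends on omega only through its cycle type beta, so
    summing over the class multiplies it by the size of the class.\<close>
  have each: "(\<Sum>\<sigma> | \<sigma> permutes A. power_gf (card (cyc A (\<sigma> \<circ> \<alpha> \<circ> inv \<sigma> \<circ> \<omega>)))) = fps_to_fls R" if "\<omega> \<in> Cl" for \<omega>
  proof -
    have w: "\<omega> permutes A" "image_mset card (mset_set (cyc A \<omega>)) = \<beta>" using that by (simp_all add: Cl)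
    have big: "card C \<ge> 3" if "C \<in> cyc A \<omega>" for C
    proof -
      have "card C \<in># image_mset card (mset_set (cyc A \<omega>))" using that finA by simp
      thus ?thesis using w(2) \<beta>(1) by simp
    qed
    have "A \<noteq> {}" using assms(1) by (simp add: A_def)
    hence "(\<Sum>a\<in>A. \<Sum>b\<in>A - {a}. \<Sum>ys\<in>permutations_of_set (A - {a, b}). 
       power_gf (card (cyc A (cycle_of_list ys \<circ> (\<omega> \<circ> transpose a b))))) =
       fact (n - 2) * (fls_X * (1 + fls_X) * fls_deriv (fls_deriv ((1 - fls_X) * (\<Prod>b\<in>#\<beta>. cyc_gf b))))"
      using sum_two_cycles[OF finA w(1) _ big] unfolding cycles_gf_eq_prod_mset w(2) crdA by simp
    thus ?thesis unfolding sum_conj_eq_sum_lists[OF finA w(1) cd(2,3,1)] R_def K_def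
      using second_deriv_gf_eq[OF assms(1) pos \<beta>(2)] by (simp only:)
  qed
  have eq: "fact n * (\<Sum>\<omega>\<in>Cl. power_gf (card (cyc A (\<alpha> \<circ> \<omega>)))) = of_nat (card Cl) * fps_to_fls R"
    using sum_class_conj[OF finA aA(1), of \<beta>, folded Cl] each by (simp add: crdA)
  obtain Q where Q: "\<And>N. N \<ge> n \<Longrightarrow> poly Q (of_nat N) = fps_nth K N" "Q = 0 \<or> roots_on_line (1 / 2) Q"
    using coeff_poly_roots_on_line[OF assms(1) pos \<beta>(2)] unfolding K_def by blast
  define H where "H = [:0, 1:] * ([:1, 1:] * pcompose Q [:1, 1:] + [:-1, 1:] * Q)"
  have RH: "fps_nth R N = poly H (of_nat N)" if "N \<ge> n + 2" for N
    unfolding R_def H_def using Q(1) that by (rule second_deriv_gf_coeff)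
  note rt = root_transfer[OF ne[folded Cl_def] eq RH z[folded Cl_def A_def]]
  \<comment> \<open>Since H is nonzero, the shifts did not cancel completely, so the zeros of Q do
    lie on the line.\<close>
  have "Q \<noteq> 0" using rt(2) by (auto simp: H_def)
  hence line: "roots_on_line (1 / 2) Q" using Q(2) by simp
  have "z * ((z + 1) * poly Q (z + 1) + (z - 1) * poly Q z) = poly H z"
    by (simp add: H_def poly_pcompose algebra_simps)
  hence "z = 0 \<or> (z + 1) * poly Q (z + 1) + (z - 1) * poly Q z = 0" using rt(1) by simp
  thus ?thesis using shift_sum_root_imaginary[OF line] by auto
qed

text \<open>\<open>theta\<close> multiplies \<open>base_gf\<close> by (1 + z) / (1 - z), which is
  the factor of a 2-cycle.\<close>

lemma base_gf_times_cyc_gf_2: "base_gf * cyc_gf 2 = power_gf 2"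
proof -
  have nz: "1 - fls_X \<noteq> (0 :: complex fls)" by (rule one_minus_fls_X_nonzero)
  have "cyc_gf 2 = (1 + fls_X) / (1 - fls_X)"
  proof -
    have "1 - fls_X ^ 2 = (1 + fls_X) * (1 - fls_X :: complex fls)" by (simp add: power2_eq_square algebra_simps)
    thus ?thesis using nz by (simp add: cyc_gf_def power2_eq_square)
  qed
  hence "base_gf * cyc_gf 2 = theta base_gf" using theta_base_gf by (simp add: theta_def base_gf_def)
  also have "\<dots> = power_gf 2" using power_gf_Suc[of 1] power_gf_1 by (simp add: numeral_2_eq_2)
  finally show ?thesis .
qed

text \<open>Here n = m + 3. Both terms have the denominator (1 - z)^(m+3), which together with (m +
  2)! is the series of \<open>rise (m + 2)\<close>; the numerator consists of four powers of z, that
  is, of four shifts.\<close>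

lemma hook_gf:
  fixes m :: nat
  shows "2 * (fact (m + 2) * base_gf * cyc_gf (m + 1)) + of_nat (m + 1) * (fact (m + 2) * base_gf * (cyc_gf 2 * cyc_gf m)) =
    fps_to_fls (rise_fps (m + 2) * (of_nat (m + 3) * fps_X + of_nat (m + 1) * fps_X ^ 2
       - of_nat (m + 1) * fps_X ^ (m + 1) - of_nat (m + 3) * fps_X ^ (m + 2)))"
proof -
  define z :: "complex fls" where "z = fls_X"
  have nz: "1 - z \<noteq> 0" unfolding z_def by (rule one_minus_fls_X_nonzero)
  have 1: "base_gf * cyc_gf (m + 1) = (z * (1 - z * z ^ m)) / (1 - z) ^ (m + 3)"
    unfolding base_gf_def cyc_gf_def z_def[symmetric] by (simp add: power_add power2_eq_square power3_eq_cube)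
  \<comment> \<open>This cancels the extra factor 1 - z in the denominator of the second
    term.\<close>
  have "1 - z ^ 2 = (1 + z) * (1 - z)" by (simp add: power2_eq_square algebra_simps)
  hence "base_gf * (cyc_gf 2 * cyc_gf m) = (z * (1 + z) * (1 - z ^ m)) * (1 - z) / (1 - z) ^ (m + 4)"
    unfolding base_gf_def cyc_gf_def z_def[symmetric] by (simp add: power_add power2_eq_square power4_eq_xxxx mult_ac)
  also have "m + 4 = Suc (m + 3)" by simp
  hence "(1 - z) ^ (m + 4) = (1 - z) * (1 - z) ^ (m + 3)" by (simp only: power_Suc)
  finally have 2: "base_gf * (cyc_gf 2 * cyc_gf m) = (z * (1 + z) * (1 - z ^ m)) / (1 - z) ^ (m + 3)"
    using nz by simp
  have "2 * (fact (m + 2) * base_gf * cyc_gf (m + 1)) + of_nat (m + 1) * (fact (m + 2) * base_gf * (cyc_gf 2 * cyc_gf m)) =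
     fact (m + 2) * (2 * (base_gf * cyc_gf (m + 1)) + of_nat (m + 1) * (base_gf * (cyc_gf 2 * cyc_gf m)))"
    by (simp only: distrib_left mult_ac)
  also have "\<dots> = fact (m + 2) / (1 - z) ^ (m + 3) * (2 * (z * (1 - z * z ^ m)) + of_nat (m + 1) * (z * (1 + z) * (1 - z ^ m)))"
    unfolding 1 2 by (simp only: distrib_left times_divide_eq_right times_divide_eq_left mult_ac add_divide_distrib)
  also have "2 * (z * (1 - z * z ^ m)) + of_nat (m + 1) * (z * (1 + z) * (1 - z ^ m)) =
     of_nat (m + 3) * z + of_nat (m + 1) * z ^ 2 - of_nat (m + 1) * z ^ (m + 1) - of_nat (m + 3) * z ^ (m + 2)"
    by (simp add: algebra_simps power2_eq_square power_add)
  also have "fact (m + 2) / (1 - z) ^ (m + 3) = fps_to_fls (rise_fps (m + 2))"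
    unfolding fps_to_fls_rise_fps z_def by (simp add: eval_nat_numeral)
  also have "of_nat (m + 3) * z + of_nat (m + 1) * z ^ 2 - of_nat (m + 1) * z ^ (m + 1) - of_nat (m + 3) * z ^ (m + 2) = 
     fps_to_fls (of_nat (m + 3) * fps_X + of_nat (m + 1) * fps_X ^ 2
       - of_nat (m + 1) * fps_X ^ (m + 1) - of_nat (m + 3) * fps_X ^ (m + 2))"
    unfolding fps_to_fls_minus fps_to_fls_plus fls_times_fps_to_fls fps_to_fls_of_nat fps_to_fls_power fps_X_to_fls z_def ..
  finally show ?thesis unfolding fls_times_fps_to_fls .
qed

text \<open>A factor z^j shifts the argument by j; no shift exceeds m + 2, so the bound on N keeps
  all indices nonnegative.\<close>

lemma hook_coeff:
  fixes m :: nat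
  defines "r \<equiv> rise (m + 2)"
  assumes "N \<ge> m + 2"
  shows "fps_nth (rise_fps (m + 2) * (of_nat (m + 3) * fps_X + of_nat (m + 1) * fps_X ^ 2
       - of_nat (m + 1) * fps_X ^ (m + 1) - of_nat (m + 3) * fps_X ^ (m + 2))) N =
    poly (smult (of_nat (m + 3)) (pcompose r [:-1, 1:]) + smult (of_nat (m + 1)) (pcompose r [:-2, 1:])
      - smult (of_nat (m + 1)) (pcompose r [:- of_nat (m + 1), 1:]) - smult (of_nat (m + 3)) (pcompose r [:- of_nat (m + 2), 1:])) (of_nat N)"
proof -
  have sh: "fps_nth (rise_fps (m + 2) * (of_nat c * fps_X ^ j)) N = of_nat c * poly r (of_nat N - of_nat j)" if "j \<le> N" for c j
  proof -
    have "rise_fps (m + 2) * (of_nat c * fps_X ^ j) = fps_const (of_nat c) * (rise_fps (m + 2) * fps_X ^ j)"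
      by (simp add: mult_ac fps_of_nat)
    also have "fps_nth \<dots> N = of_nat c * fps_nth (rise_fps (m + 2)) (N - j)"
      using that by (simp add: fps_X_power_mult_right_nth)
    finally show ?thesis using that by (simp add: rise_fps_def r_def of_nat_diff)
  qed
  have e: "poly [:- a, 1:] x = x - a" for a x :: complex by simp
  have le: "1 \<le> N" "2 \<le> N" "m + 1 \<le> N" using assms(2) by simp_all
  note sh' = sh[OF le(1), of "m + 3", unfolded power_one_right of_nat_1] sh[OF le(2), of "m + 1", unfolded of_nat_numeral] 
    sh[OF le(3), of "m + 1"] sh[OF assms(2), of "m + 3"]
  show ?thesis
    unfolding right_diff_distrib distrib_left fps_sub_nth fps_add_nth sh' poly_add poly_diff poly_smult poly_pcompose e ..
qed

lemma hook_case_root: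
  assumes "n \<ge> 3" and \<alpha>: "\<alpha> \<in> cycle_class n {#2, n - 2#}" and \<beta>: "\<beta> = {#1, n - 1#}"
    and ne: "finite (cycle_class n \<beta>)" "cycle_class n \<beta> \<noteq> {}"
    and z: "poly (\<Sum>\<omega>\<in>cycle_class n \<beta>. monom 1 (card (cyc {1..n} (\<alpha> \<circ> \<omega>)))) z = 0"
  shows "Re z = 0"
proof -
  define A where "A = {1..n}"
  define Cl where "Cl = cycle_class n \<beta>"
  have Cl: "Cl = {p. p permutes A \<and> image_mset card (mset_set (cyc A p)) = \<beta>}"
    by (simp add: Cl_def A_def cycle_class_eq)
  have finA: "finite A" and crdA: "card A = n" by (simp_all add: A_def)
  have aA: "\<alpha> permutes A" "image_mset card (mset_set (cyc A \<alpha>)) = {#2, n - 2#}"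
    using \<alpha> by (simp_all add: cycle_class_eq A_def)
  define R where "R = 2 * (fact (n - 1) * base_gf * cyc_gf (n - 2)) + of_nat (n - 2) * (if n = 3 then theta (fact (n - 1) * base_gf * cyc_gf 2) else fact (n - 1) * base_gf * (cyc_gf 2 * cyc_gf (n - 3)))"
  have each: "(\<Sum>\<sigma> | \<sigma> permutes A. power_gf (card (cyc A (\<sigma> \<circ> \<alpha> \<circ> inv \<sigma> \<circ> \<omega>)))) = R" if "\<omega> \<in> Cl" for \<omega>
  proof -
    have w: "\<omega> permutes A" "image_mset card (mset_set (cyc A \<omega>)) = {#1, n - 1#}" using that \<beta> by (simp_all add: Cl)
    obtain cs ds where cd: "\<omega> = cycle_of_list cs \<circ> cycle_of_list ds" "cs @ ds \<in> permutations_of_set A" "length cs = 1"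
      using two_cycles_lists[OF finA w] by metis
    show ?thesis unfolding sum_conj_eq_sum_remove[OF finA aA(1) cd(2,3,1)] R_def
      by (rule sum_remove_two_cycles[OF finA aA crdA assms(1)])
  qed
  have eq: "fact n * (\<Sum>\<omega>\<in>Cl. power_gf (card (cyc A (\<alpha> \<circ> \<omega>)))) = of_nat (card Cl) * R"
    using sum_class_conj[OF finA aA(1), of \<beta>, folded Cl] each by (simp add: crdA)
  show ?thesis
  proof (cases "n = 3")
    \<comment> \<open>Here the second cycle of alpha is a fixed point and \<open>theta\<close>
      remains. The polynomial is a multiple of x (x^2 + 2).\<close>
    case True
    have "cyc_gf 1 = 1" using one_minus_fls_X_nonzero[where 'a = complex] by (simp add: cyc_gf_def)
    hence "R = 4 * power_gf 1 + theta (of_nat 2 * power_gf 2)"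
      unfolding R_def power_gf_1 base_gf_times_cyc_gf_2[symmetric] using True by (simp add: mult.assoc)
    also have "\<dots> = 4 * power_gf 1 + 2 * power_gf 3" unfolding theta_of_nat power_gf_Suc[symmetric] by simp
    also have "\<dots> = fps_to_fls (Abs_fps (\<lambda>N. 4 * of_nat N + 2 * of_nat N ^ 3))"
    proof -
      have "Abs_fps (\<lambda>N. 4 * of_nat N + 2 * of_nat N ^ 3 :: complex) = 4 * Abs_fps (\<lambda>N. of_nat N ^ 1) + 2 * Abs_fps (\<lambda>N. of_nat N ^ 3)"
        by (rule fps_ext) (simp add: numeral_fps_const)
      thus ?thesis unfolding power_gf_def by (simp add: fls_times_fps_to_fls)
    qed
    finally have R: "R = fps_to_fls (Abs_fps (\<lambda>N. 4 * of_nat N + 2 * of_nat N ^ 3))" .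
    have "poly [:0, 4, 0, 2:] z = 0"
      by (rule root_transfer(1)[OF ne[folded Cl_def] eq[unfolded R] _ z[folded Cl_def A_def], of 0])
        (simp add: power3_eq_cube algebra_simps)
    moreover have "poly [:0, 4, 0, 2:] z = 2 * (z * (z ^ 2 + 2))" by (simp add: power2_eq_square algebra_simps)
    ultimately have "2 * (z * (z ^ 2 + 2)) = 0" by (simp only:)
    hence "z * (z ^ 2 + 2) = 0" by simp
    hence "z = 0 \<or> z ^ 2 = - 2" by (auto simp: add_eq_0_iff2)
    thus ?thesis
    proof
      assume "z ^ 2 = - 2"
      hence "Re (z ^ 2) = - 2" "Im (z ^ 2) = 0" by simp_all
      hence sq: "Re z * Re z - Im z * Im z = - 2" and "Re z * Im z = 0"
        by (auto simp: power2_eq_square)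
      moreover have "Im z \<noteq> 0"
      proof
        assume "Im z = 0"
        hence "Re z * Re z = - 2" using sq by simp
        thus False using zero_le_square[of "Re z"] by linarith
      qed
      ultimately show ?thesis by simp
    qed simp
  next
    case False
    define m where "m = n - 3"
    have n: "n = m + 3" "m \<noteq> 0" using False assms(1) by (auto simp: m_def)
    have "n - 1 = m + 2" "n - 2 = m + 1" "n - 3 = m" using n by auto
    hence R: "R = fps_to_fls (rise_fps (m + 2) * (of_nat (m + 3) * fps_X + of_nat (m + 1) * fps_X ^ 2
       - of_nat (m + 1) * fps_X ^ (m + 1) - of_nat (m + 3) * fps_X ^ (m + 2)))"
      unfolding R_def using False hook_gf[of m] by simp
    note rt = root_transfer(1)[OF ne[folded Cl_def] eq[unfolded R] hook_coeff z[folded Cl_def A_def]]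
    hence "of_nat (m + 2) * (z * ((2 * z + of_nat (Suc m)) * poly (rise m) z + (-1) ^ m * ((2 * - z + of_nat (Suc m)) * poly (rise m) (- z)))) = 0"
      unfolding hook_poly_eq[symmetric] by (simp add: poly_pcompose numeral_2_eq_2 algebra_simps)
    moreover have "of_nat (m + 2) \<noteq> (0 :: complex)" by (simp only: of_nat_eq_0_iff)
    ultimately show ?thesis using hook_root mult_eq_0_iff by blast
  qed
qed

theorem theorem4p3:
  fixes n :: nat and \<alpha> :: "nat \<Rightarrow> nat" and \<beta> :: "nat multiset" and z :: complex
  assumes "n \<ge> 3"
    and "\<alpha> \<in> cycle_class n {#2, n - 2#}"
    and "\<beta> \<turnstile>\<^sub>p n"
    and "(\<forall>b\<in>#\<beta>. b \<ge> 3) \<or> \<beta> = {#1, n - 1#}"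
    and "poly (P_poly n \<alpha> \<beta>) z = 0"
  shows "Re z = 0"
proof -
  have \<beta>: "\<forall>b\<in>#\<beta>. b > 0" "sum_mset \<beta> = n" using assms(3) by (simp_all add: is_partition_of_def)
  have fin: "finite (cycle_class n \<beta>)"
    by (rule finite_subset[OF _ finite_permutations[of "{1..n}"]]) (auto simp: cycle_class_def)
  have ne: "cycle_class n \<beta> \<noteq> {}"
    using cycle_type_exists[of "{1..n}" \<beta>] \<beta> by (auto simp: cycle_class_eq)
  have "of_nat (n * (n - 1)) / of_nat (card (cycle_class n \<beta>)) \<noteq> (0 :: complex)"
    using assms(1) fin ne by (simp del: of_nat_mult)
  hence "poly (\<Sum>\<omega>\<in>cycle_class n \<beta>. monom 1 (card (cyc {1..n} (\<alpha> \<circ> \<omega>)))) z = 0"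
    using assms(5) by (simp add: P_poly_def num_cycles_def perm_cycles_eq_cyc)
  thus ?thesis
    using assms(4) big_cycles_root[OF assms(1,2) _ \<beta>(2) fin ne] hook_case_root[OF assms(1,2) _ fin ne] by blast
qed

end
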